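(* Let $K\ge2$, let $\boldsymbol\beta,\boldsymbol\beta'$ be vectors in $\mathbb{R}^K$ with all entries positive, and let $\tau,\tau'>0$. The geodesic (Fisher–Rao) distance between the Concrete distributions $C(\boldsymbol\beta,\tau)$ and $C(\boldsymbol\beta',\tau')$ is $$ d(C(\boldsymbol\beta,\tau),C(\boldsymbol\beta',\tau')) = 2\ell\,\sinh^{-1}\left(\frac12\sqrt{\left(\sqrt{\frac{\tau'}{\tau}}-\sqrt{\frac{\tau}{\tau'}}\right)^2 + \frac{\sum_{i=1}^K\sum_{j=1}^K(\Delta_i-\Delta_j)^2}{2(K+1)\ell^2}}\right), $$ where $$\Delta_i = \sqrt{\frac{\tau'}{\tau}}\,\log\beta_i - \sqrt{\frac{\tau}{\tau'}}\,\log\beta_i' \qquad\text{and}\qquad \ell=\sqrt{\frac{(K-1)(K\pi^2/6+1)}{K+1}} .$$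
   Context: The simplex is $S_K = \{(x_1,\ldots,x_K)\in\mathbb{R}^K : \sum_{i=1}^K x_i = 1,\ x_i\ge 0\}$; densities on $S_K$ are with respect to Lebesgue measure $dx_1\cdots dx_{K-1}$ in the first $K-1$ coordinates, with $x_K = 1-\sum_{i=1}^{K-1}x_i$. For $\boldsymbol\beta=(\beta_1,\ldots,\beta_K)$ with all $\beta_i>0$ and $\tau>0$, the Concrete distribution $C(\boldsymbol\beta,\tau)$ is the probability distribution on $S_K$ with density $$f(\mathbf x) = \frac{(K-1)!\,\tau^{K-1}}{(\sum_{j=1}^K\beta_j/x_j^\tau)^K}\prod_{i=1}^K\frac{\beta_i}{x_i^{\tau+1}} .$$ It is invariant under $\boldsymbol\beta\to\lambda\boldsymbol\beta$, $\lambda>0$, so the family is a $K$-dimensional manifold: the set of all $(\boldsymbol\beta,\tau)$ with $\beta_i>0$, $\tau>0$, modulo this scaling (equivalently, with the constraint $\sum_{i=1}^K\beta_i=1$, in which case $\beta_1,\ldots,\beta_{K-1},\tau$ are independent coordinates). The information (Fisher–Rao) metric is the Riemannian metric $ds^2=\sum_{a,b=1}^K\mathcal{I}_{ab}\,d\eta_a\,d\eta_b$, where $\eta_1,\ldots,\eta_K$ are independent coordinates on this manifold and $\mathcal{I}_{ab}=\mathbb{E}\big(\frac{\partial\log f}{\partial\eta_a}\frac{\partial\log f}{\partial\eta_b}\big)$, with expectation over $\mathbf X\sim C(\boldsymbol\beta,\tau)$. The geodesic distance $d$ between two distributions in the family is the Riemannian distance (length of the connecting geodesic) with respect to this metric.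 *)

theory Defs
  imports "HOL-Probability.Probability"
begin

text \<open>
  Vectors in $R^K$ are functions on the index set \<open>{1..K}\<close>. Points of the simplex are extensional, so
  that they live in the product space \<open>PiM {1..K}\<close>; values of weight vectors and of coordinate
  vectors outside \<open>{1..K}\<close> are irrelevant.
\<close>

definition prob_simplex :: "nat \<Rightarrow> (nat \<Rightarrow> real) set" where
  "prob_simplex K = {x \<in> extensional {1..K}. (\<forall>i\<in>{1..K}. 0 \<le> x i) \<and> (\<Sum>i=1..K. x i) = 1}"

definition fill_last :: "nat \<Rightarrow> (nat \<Rightarrow> real) \<Rightarrow> nat \<Rightarrow> real" where
  "fill_last K x = x(K := 1 - (\<Sum>i=1..<K. x i))"

text \<open>
  The measure $dx_1 \ldots dx_{K-1}$ on the simplex, transported from the first $K-1$ coordinates.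
\<close>

definition simplex_lborel :: "nat \<Rightarrow> (nat \<Rightarrow> real) measure" where
  "simplex_lborel K =
    restrict_space
      (distr (\<Pi>\<^sub>M i\<in>{1..<K}. lborel) (\<Pi>\<^sub>M i\<in>{1..K}. borel) (fill_last K))
      (prob_simplex K)"

text \<open>
  On the boundary of the simplex, a null set, the following formula takes junk values.
\<close>

definition concrete_density :: "nat \<Rightarrow> (nat \<Rightarrow> real) \<Rightarrow> real \<Rightarrow> (nat \<Rightarrow> real) \<Rightarrow> real" where
  "concrete_density K \<beta> \<tau> x =
    fact (K - 1) * \<tau> ^ (K - 1) / (\<Sum>j=1..K. \<beta> j / x j powr \<tau>) ^ K
      * (\<Prod>i=1..K. \<beta> i / x i powr (\<tau> + 1))"

definition concrete :: "nat \<Rightarrow> (nat \<Rightarrow> real) \<Rightarrow> real \<Rightarrow> (nat \<Rightarrow> real) measure" where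
  "concrete K \<beta> \<tau> = density (simplex_lborel K) (\<lambda>x. ennreal (concrete_density K \<beta> \<tau> x))"

text \<open>
  The family is invariant under scaling of \<open>\<beta>\<close>. As a manifold it is given by the global chart
  $\eta = (\beta_1, \ldots, \beta_{K-1}, \tau)$ under the normalisation $\sum_i \beta_i = 1$; thus
  \<open>\<eta> K\<close> is $\tau$, whereas the weight $\beta_K$ is supplied by \<open>fill_last\<close>.
\<close>

definition concrete_coords :: "nat \<Rightarrow> (nat \<Rightarrow> real) set" where
  "concrete_coords K = {\<eta>. (\<forall>a\<in>{1..K}. 0 < \<eta> a) \<and> (\<Sum>i=1..<K. \<eta> i) < 1}"

definition coord_density :: "nat \<Rightarrow> (nat \<Rightarrow> real) \<Rightarrow> (nat \<Rightarrow> real) \<Rightarrow> real" where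
  "coord_density K \<eta> x = concrete_density K (fill_last K \<eta>) (\<eta> K) x"

definition coord_concrete :: "nat \<Rightarrow> (nat \<Rightarrow> real) \<Rightarrow> (nat \<Rightarrow> real) measure" where
  "coord_concrete K \<eta> = concrete K (fill_last K \<eta>) (\<eta> K)"

definition score :: "nat \<Rightarrow> (nat \<Rightarrow> real) \<Rightarrow> nat \<Rightarrow> (nat \<Rightarrow> real) \<Rightarrow> real" where
  "score K \<eta> a x = deriv (\<lambda>t. ln (coord_density K (\<eta>(a := t)) x)) (\<eta> a)"

definition fisher_information :: "nat \<Rightarrow> (nat \<Rightarrow> real) \<Rightarrow> nat \<Rightarrow> nat \<Rightarrow> real" where
  "fisher_information K \<eta> a b = (\<integral>x. score K \<eta> a x * score K \<eta> b x \<partial>coord_concrete K \<eta>)"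

text \<open>
  Lengths are extended nonnegative reals: the library's piecewise continuously differentiable
  functions may have unbounded derivative near a break point, and a curve of infinite length must
  not be assigned the default value 0 of a divergent integral.
\<close>

definition fisher_rao_length :: "nat \<Rightarrow> (real \<Rightarrow> nat \<Rightarrow> real) \<Rightarrow> ennreal" where
  "fisher_rao_length K \<gamma> =
    (\<integral>\<^sup>+t\<in>{0..1}. ennreal (sqrt (\<Sum>a=1..K. \<Sum>b=1..K.
        fisher_information K (\<gamma> t) a b * deriv (\<lambda>s. \<gamma> s a) t * deriv (\<lambda>s. \<gamma> s b) t)) \<partial>lborel)"

definition fisher_rao_curves ::
  "nat \<Rightarrow> (nat \<Rightarrow> real) measure \<Rightarrow> (nat \<Rightarrow> real) measure \<Rightarrow> (real \<Rightarrow> nat \<Rightarrow> real) set" where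
  "fisher_rao_curves K P Q = {\<gamma>.
      (\<forall>t\<in>{0..1}. \<gamma> t \<in> concrete_coords K) \<and>
      (\<forall>a\<in>{1..K}. (\<lambda>t. \<gamma> t a) piecewise_C1_differentiable_on {0..1}) \<and>
      coord_concrete K (\<gamma> 0) = P \<and> coord_concrete K (\<gamma> 1) = Q}"

definition fisher_rao_dist ::
  "nat \<Rightarrow> (nat \<Rightarrow> real) measure \<Rightarrow> (nat \<Rightarrow> real) measure \<Rightarrow> ennreal" where
  "fisher_rao_dist K P Q = (INF \<gamma>\<in>fisher_rao_curves K P Q. fisher_rao_length K \<gamma>)"

end

theory Submission
  imports Defs
begin

text \<open>
  If \<open>E\<^sub>1, \<dots>, E\<^sub>K\<close> are independent standard exponential variables, then normalising the vector of the
  \<open>(\<beta>\<^sub>i / E\<^sub>i) powr (1 / \<tau>)\<close> yields a sample \<open>x\<close> of the Concrete distribution, and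
  \<open>\<beta>\<^sub>i / x\<^sub>i powr \<tau>\<close> is proportional to \<open>E\<^sub>i\<close>. Hence the score is a function of \<open>E / S\<close>, where
  \<open>S = E\<^sub>1 + \<dots> + E\<^sub>K\<close> is independent of \<open>E / S\<close>. Weighting with \<open>S\<^sup>2\<close> turns products of scores into
  polynomials in the \<open>E\<^sub>i\<close> and \<open>ln E\<^sub>i\<close>, whose means follow from the derivatives of the Gamma function at
  1, 2 and 3. In the coordinates \<open>1 / \<tau>\<close> and \<open>(ln \<beta>\<^sub>i - mean) / \<tau>\<close> the resulting metric is a constant
  multiple of the hyperbolic metric of the upper half-space.
\<close>

section \<open>Substitution in product integrals\<close>

text \<open>The distance is an infimum over all piecewise C1 curves joining two measures. Three
  things are therefore needed besides the metric: the measures must determine their parameters up to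
  scaling, every curve needs a lower bound, and one explicit curve must attain it.

  Weighting by \<open>S ^ 2\<close> is legitimate because S is independent of E / S: it multiplies
  the mean of a function of E / S by the second moment K (K + 1) of S, and it clears the denominator
  S of both scores. What remains of a score is a linear form in the E_i - 1 plus a multiple of one
  fixed variable \<open>ln_sum_c\<close>. The two are uncorrelated, so no mixed term survives, and
  the variance of \<open>ln_sum_c\<close> divided by K (K + 1) is the square of the constant l of
  the theorem.

  The horizontal coordinates are K numbers with sum zero, so the family is a vertical slice of a
  half-space of dimension K + 1. Such slices are totally geodesic, hence the ambient distance
  formula and the ambient geodesics apply directly and no basis of the hyperplane has to be
  chosen.\<close>

abbreviation rvec :: "nat \<Rightarrow> (nat \<Rightarrow> real) measure" where
  "rvec K \<equiv> Pi\<^sub>M {1..K} (\<lambda>_. borel)"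

text \<open>The intervals \<open>{exp (- real (Suc n))..exp (real (Suc n))}\<close> exhaust the
  positive half-line and are the images of symmetric intervals, so monotone convergence extends the
  substitution rule for compact intervals.\<close>

lemma nn_integral_exp_substitution:
  assumes [measurable]: "h \<in> borel_measurable (borel :: real measure)"
  shows "(\<integral>\<^sup>+t. indicator {0<..} t * h t \<partial>lborel) = (\<integral>\<^sup>+a. ennreal (exp a) * h (exp a) \<partial>lborel)"
proof -
  \<comment> \<open>\<open>Suc n\<close> rather than \<open>n\<close> keeps the interval
    nondegenerate at index 0.\<close>
  have inc1: "incseq (\<lambda>(n::nat) t::real. h t * indicator {exp (- real (Suc n))..exp (real (Suc n))} t)"
  proof (intro monoI le_funI mult_left_mono indicator_leI)
    fix m n :: nat and t :: real
    assume "m \<le> n" and t: "t \<in> {exp (- real (Suc m))..exp (real (Suc m))}"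
    then have "exp (- real (Suc n)) \<le> exp (- real (Suc m))" "exp (real (Suc m)) \<le> exp (real (Suc n))" by auto
    with t show "t \<in> {exp (- real (Suc n))..exp (real (Suc n))}" by (meson atLeastAtMost_iff order_trans)
  qed simp
  have inc2: "incseq (\<lambda>(n::nat) t::real. h (exp t) * exp t * indicator {- real (Suc n)..real (Suc n)} t)"
    by (intro monoI le_funI mult_left_mono indicator_leI) auto
  have sup1: "(SUP n. h t * indicator {exp (- real (Suc n))..exp (real (Suc n))} t)
      = indicator {0<..} t * h t" for t :: real
  proof (cases "t > 0")
    case True
    obtain n :: nat where "\<bar>ln t\<bar> < real n" using reals_Archimedean2 by blast
    then have n: "\<bar>ln t\<bar> \<le> real (Suc n)" by simp
    then have "- real (Suc n) \<le> ln t" "ln t \<le> real (Suc n)" unfolding abs_le_iff by linarith+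
    then have "exp (- real (Suc n)) \<le> t \<and> t \<le> exp (real (Suc n))"
      using True by (simp only: ln_ge_iff ln_le_cancel_iff[of t "exp _", symmetric] ln_exp exp_gt_zero simp_thms)
    then have "h t * indicator {exp (- real (Suc n))..exp (real (Suc n))} t = h t" by simp
    then have "h t \<le> (SUP n. h t * indicator {exp (- real (Suc n))..exp (real (Suc n))} t)"
      by (intro SUP_upper2[of n]) (simp_all only: UNIV_I order_refl)
    moreover have "(SUP n. h t * indicator {exp (- real (Suc n))..exp (real (Suc n))} t) \<le> h t"
      by (rule SUP_least) (auto split: split_indicator)
    ultimately show ?thesis using True by (simp add: antisym)
  next
    case False
    then have "h t * indicator {exp (- real (Suc n))..exp (real (Suc n))} t = 0" for n
      by (smt (verit, best) atLeastAtMost_iff exp_gt_zero indicator_simps(2) mult_zero_right)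
    then show ?thesis using False by (simp only: indicator_simps greaterThan_iff) simp
  qed
  have sup2: "(SUP n. h (exp t) * exp t * indicator {- real (Suc n)..real (Suc n)} t)
      = ennreal (exp t) * h (exp t)" for t :: real
  proof -
    obtain n :: nat where "\<bar>t\<bar> < real n" using reals_Archimedean2 by blast
    then have n: "\<bar>t\<bar> \<le> real (Suc n)" by simp
    then have "h (exp t) * exp t * indicator {- real (Suc n)..real (Suc n)} t = h (exp t) * exp t"
      by (auto simp: abs_le_iff)
    then have "h (exp t) * exp t \<le> (SUP n. h (exp t) * exp t * indicator {- real (Suc n)..real (Suc n)} t)"
      by (intro SUP_upper2[of n]) (simp_all only: UNIV_I order_refl)
    moreover have "(SUP n. h (exp t) * exp t * indicator {- real (Suc n)..real (Suc n)} t) \<le> h (exp t) * exp t"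
      by (rule SUP_least) (auto split: split_indicator)
    ultimately show ?thesis by (simp add: antisym mult.commute)
  qed
  have "(\<integral>\<^sup>+t. indicator {0<..} t * h t \<partial>lborel)
      = (SUP n. \<integral>\<^sup>+t. h t * indicator {exp (- real (Suc n))..exp (real (Suc n))} t \<partial>lborel)"
    unfolding sup1[symmetric] by (rule nn_integral_monotone_convergence_SUP[OF inc1]) simp
  also have "\<dots> = (SUP n. \<integral>\<^sup>+t. h (exp t) * exp t * indicator {- real (Suc n)..real (Suc n)} t \<partial>lborel)"
    by (intro SUP_cong refl nn_integral_substitution_aux)
      (auto intro!: derivative_eq_intros continuous_intros)
  also have "\<dots> = (\<integral>\<^sup>+a. ennreal (exp a) * h (exp a) \<partial>lborel)"
    unfolding sup2[symmetric] by (rule nn_integral_monotone_convergence_SUP[OF inc2, symmetric]) simp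
  finally show ?thesis .
qed

text \<open>On the logarithmic scale the map \<open>b * y powr (- \<tau>)\<close> is affine with
  slope \<open>- \<tau>\<close>. It is therefore an affine substitution between two exponential
  ones; the absolute value of the slope absorbs the reversed orientation.\<close>

lemma nn_integral_powr_substitution:
  fixes b \<tau> :: real
  assumes [measurable]: "h \<in> borel_measurable borel" and "0 < b" "0 < \<tau>"
  shows "(\<integral>\<^sup>+t. indicator {0<..} t * h t \<partial>lborel)
    = (\<integral>\<^sup>+y. (indicator {0<..} y * ennreal (b * \<tau> * y powr (- \<tau> - 1))) * h (b * y powr (- \<tau>)) \<partial>lborel)"
proof -
  have "(\<integral>\<^sup>+t. indicator {0<..} t * h t \<partial>lborel) = (\<integral>\<^sup>+a. ennreal (exp a) * h (exp a) \<partial>lborel)"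
    by (rule nn_integral_exp_substitution) simp
  also have "\<dots> = \<bar>- \<tau>\<bar> * (\<integral>\<^sup>+a. ennreal (exp (ln b + (- \<tau>) * a)) * h (exp (ln b + (- \<tau>) * a)) \<partial>lborel)"
    using \<open>0 < \<tau>\<close> by (intro nn_integral_real_affine) auto
  also have "\<dots> = (\<integral>\<^sup>+a. ennreal \<tau> * (ennreal (exp (ln b + (- \<tau>) * a)) * h (exp (ln b + (- \<tau>) * a))) \<partial>lborel)"
    using \<open>0 < \<tau>\<close> by (subst nn_integral_cmult) auto
  also have "\<dots> = (\<integral>\<^sup>+a. ennreal (exp a) * (ennreal (b * \<tau> * exp a powr (- \<tau> - 1)) * h (b * exp a powr (- \<tau>))) \<partial>lborel)"
  proof (intro nn_integral_cong)
    fix a :: real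
    have 1: "exp (ln b + (- \<tau>) * a) = b * exp a powr (- \<tau>)"
      using \<open>0 < b\<close> by (simp add: exp_diff powr_def exp_minus divide_inverse)
    have 2: "\<tau> * (b * exp a powr (- \<tau>)) = exp a * (b * \<tau> * exp a powr (- \<tau> - 1))"
      by (simp add: powr_def exp_diff left_diff_distrib)
    have 3: "ennreal \<tau> * ennreal (b * exp a powr (- \<tau>)) = ennreal (exp a) * ennreal (b * \<tau> * exp a powr (- \<tau> - 1))"
      using arg_cong[OF 2, of ennreal] \<open>0 < \<tau>\<close> by (subst (asm) (1 2) ennreal_mult') auto
    show "ennreal \<tau> * (ennreal (exp (ln b + (- \<tau>) * a)) * h (exp (ln b + (- \<tau>) * a)))
      = ennreal (exp a) * (ennreal (b * \<tau> * exp a powr (- \<tau> - 1)) * h (b * exp a powr (- \<tau>)))"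
      unfolding 1 mult.assoc[symmetric] 3 ..
  qed
  also have "\<dots> = (\<integral>\<^sup>+y. indicator {0<..} y * (ennreal (b * \<tau> * y powr (- \<tau> - 1)) * h (b * y powr (- \<tau>))) \<partial>lborel)"
    by (rule nn_integral_exp_substitution[symmetric]) simp
  finally show ?thesis by (simp add: mult.assoc)
qed

text \<open>Coordinates are substituted one at a time. The rule \<open>sub\<close> is assumed for
  all test functions because at each stage the test function is \<open>H\<close> with the other
  coordinates frozen. It serves for the power map of the exponential variables as well as for the
  scaling of the simplex.\<close>

lemma nn_integral_PiM_lborel_substitution:
  fixes v w :: "'i \<Rightarrow> real \<Rightarrow> ennreal" and \<phi> :: "'i \<Rightarrow> real \<Rightarrow> real"
  assumes "finite I"
    and meas: "\<And>i. i \<in> I \<Longrightarrow> v i \<in> borel_measurable borel" "\<And>i. i \<in> I \<Longrightarrow> w i \<in> borel_measurable borel"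
      "\<And>i. i \<in> I \<Longrightarrow> \<phi> i \<in> borel_measurable borel"
    and sub: "\<And>i h. i \<in> I \<Longrightarrow> h \<in> borel_measurable borel \<Longrightarrow>
      (\<integral>\<^sup>+t. v i t * h t \<partial>lborel) = (\<integral>\<^sup>+y. w i y * h (\<phi> i y) \<partial>lborel)"
    and H: "H \<in> borel_measurable (Pi\<^sub>M I (\<lambda>_. borel))"
  shows "(\<integral>\<^sup>+x. (\<Prod>i\<in>I. v i (x i)) * H x \<partial>Pi\<^sub>M I (\<lambda>_. lborel))
    = (\<integral>\<^sup>+y. (\<Prod>i\<in>I. w i (y i)) * H (\<lambda>i\<in>I. \<phi> i (y i)) \<partial>Pi\<^sub>M I (\<lambda>_. lborel))"
  using assms
proof (induction I arbitrary: H rule: finite_induct)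
  case empty
  interpret product_sigma_finite "\<lambda>_::'i. lborel :: real measure" by standard
  show ?case by (simp add: nn_integral_empty restrict_def)
    (simp add: PiM_empty)
next
  case (insert j I)
  interpret product_sigma_finite "\<lambda>_. lborel" by standard
  note [measurable] = insert.prems
  have [measurable_cong]: "sets (Pi\<^sub>M A (\<lambda>_. lborel)) = sets (Pi\<^sub>M A (\<lambda>_. borel))" for A :: "'i set"
    by (intro sets_PiM_cong) auto
  have [measurable]: "\<And>i. i \<in> I \<Longrightarrow> v i \<in> borel_measurable borel" "\<And>i. i \<in> I \<Longrightarrow> w i \<in> borel_measurable borel"
     "\<And>i. i \<in> I \<Longrightarrow> \<phi> i \<in> borel_measurable borel" "v j \<in> borel_measurable borel" "w j \<in> borel_measurable borel"
     "\<phi> j \<in> borel_measurable borel"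
    using insert.prems by auto
  have upd: "(\<lambda>(x, y). x(j := f y)) \<in> Pi\<^sub>M I (\<lambda>_. borel) \<Otimes>\<^sub>M borel \<rightarrow>\<^sub>M Pi\<^sub>M (insert j I) (\<lambda>_. borel)"
    if [measurable]: "f \<in> borel_measurable borel" for f :: "real \<Rightarrow> real"
    unfolding case_prod_beta by measurable
  have Hu [measurable]: "(\<lambda>(x, y). H (x(j := f y))) \<in> borel_measurable (Pi\<^sub>M I (\<lambda>_. borel) \<Otimes>\<^sub>M borel)"
    if "f \<in> borel_measurable borel" for f :: "real \<Rightarrow> real"
    using measurable_compose[OF upd[OF that] insert.prems(5)] by (simp add: split_beta' fun_upd_def)
  have Hx: "(\<lambda>y. H (x(j := y))) \<in> borel_measurable borel" if "x \<in> space (Pi\<^sub>M I (\<lambda>_. borel))" for x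
    using measurable_Pair2[OF Hu[of "\<lambda>y. y"] that] by simp
  have pr: "(\<Prod>i\<in>I. u i (if i = j then y else x i)) = (\<Prod>i\<in>I. u i (x i))" for u :: "'i \<Rightarrow> real \<Rightarrow> ennreal" and x y
    using insert.hyps by (intro prod.cong) auto
  have sp: "space (Pi\<^sub>M I (\<lambda>_. lborel)) = space (Pi\<^sub>M I (\<lambda>_. borel :: real measure))"
    by (simp add: space_PiM)
  have "(\<integral>\<^sup>+x. (\<Prod>i\<in>insert j I. v i (x i)) * H x \<partial>Pi\<^sub>M (insert j I) (\<lambda>_. lborel))
     = (\<integral>\<^sup>+x. \<integral>\<^sup>+y. (\<Prod>i\<in>insert j I. v i ((x(j := y)) i)) * H (x(j := y)) \<partial>lborel \<partial>Pi\<^sub>M I (\<lambda>_. lborel))"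
    using insert.hyps by (intro product_nn_integral_insert) auto
  also have "\<dots> = (\<integral>\<^sup>+x. \<integral>\<^sup>+y. (\<Prod>i\<in>I. v i (x i)) * (v j y * H (x(j := y))) \<partial>lborel \<partial>Pi\<^sub>M I (\<lambda>_. lborel))"
    using insert.hyps by (simp add: pr mult_ac)
  also have "\<dots> = (\<integral>\<^sup>+x. (\<Prod>i\<in>I. v i (x i)) * (\<integral>\<^sup>+y. w j y * H (x(j := \<phi> j y)) \<partial>lborel) \<partial>Pi\<^sub>M I (\<lambda>_. lborel))"
  proof (rule nn_integral_cong, subst nn_integral_cmult)
    fix x :: "'i \<Rightarrow> real" assume x: "x \<in> space (Pi\<^sub>M I (\<lambda>_. lborel))"
    note [measurable] = Hx[OF x[unfolded sp]]
    show "(\<lambda>y. v j y * H (x(j := y))) \<in> borel_measurable lborel" by simp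
    show "(\<Prod>i\<in>I. v i (x i)) * (\<integral>\<^sup>+y. v j y * H (x(j := y)) \<partial>lborel)
      = (\<Prod>i\<in>I. v i (x i)) * (\<integral>\<^sup>+y. w j y * H (x(j := \<phi> j y)) \<partial>lborel)"
      by (subst insert.prems(4)) auto
  qed
  also have "\<dots> = (\<integral>\<^sup>+y. (\<Prod>i\<in>I. w i (y i)) * (\<integral>\<^sup>+t. w j t * H ((\<lambda>i\<in>I. \<phi> i (y i))(j := \<phi> j t)) \<partial>lborel) \<partial>Pi\<^sub>M I (\<lambda>_. lborel))"
  proof (intro insert.IH insert.prems)
    have "(\<lambda>(x, y). w j y * H (x(j := \<phi> j y))) \<in> borel_measurable (Pi\<^sub>M I (\<lambda>_. borel) \<Otimes>\<^sub>M lborel)"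
      using Hu[of "\<phi> j"] by (simp add: split_beta')
    then show "(\<lambda>x. \<integral>\<^sup>+y. w j y * H (x(j := \<phi> j y)) \<partial>lborel) \<in> borel_measurable (Pi\<^sub>M I (\<lambda>_. borel))"
      by (rule lborel.borel_measurable_nn_integral)
  qed auto
  also have "\<dots> = (\<integral>\<^sup>+y. \<integral>\<^sup>+t. (\<Prod>i\<in>I. w i (y i)) * (w j t * H ((\<lambda>i\<in>I. \<phi> i (y i))(j := \<phi> j t))) \<partial>lborel \<partial>Pi\<^sub>M I (\<lambda>_. lborel))"
  proof (rule nn_integral_cong, subst nn_integral_cmult)
    fix x :: "'i \<Rightarrow> real" assume x: "x \<in> space (Pi\<^sub>M I (\<lambda>_. lborel))"
    have "(\<lambda>i\<in>I. \<phi> i (x i)) \<in> space (Pi\<^sub>M I (\<lambda>_. borel))" by (simp add: space_PiM)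
    note [measurable] = Hx[OF this]
    show "(\<lambda>t. w j t * H ((\<lambda>i\<in>I. \<phi> i (x i))(j := \<phi> j t))) \<in> borel_measurable lborel" by simp
  qed simp
  also have "\<dots> = (\<integral>\<^sup>+y. \<integral>\<^sup>+t. (\<Prod>i\<in>insert j I. w i ((y(j := t)) i)) * H (\<lambda>i\<in>insert j I. \<phi> i ((y(j := t)) i)) \<partial>lborel \<partial>Pi\<^sub>M I (\<lambda>_. lborel))"
  proof -
    have "(\<lambda>i\<in>I. \<phi> i (y i))(j := \<phi> j t) = (\<lambda>i\<in>insert j I. \<phi> i ((y(j := t)) i))" for y t
      using insert.hyps by (auto simp: restrict_def fun_eq_iff)
    then show ?thesis using insert.hyps by (simp add: pr mult_ac)
  qed
  also have "\<dots> = (\<integral>\<^sup>+y. (\<Prod>i\<in>insert j I. w i (y i)) * H (\<lambda>i\<in>insert j I. \<phi> i (y i)) \<partial>Pi\<^sub>M (insert j I) (\<lambda>_. lborel))"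
    using insert.hyps by (intro product_nn_integral_insert[symmetric]) auto
  finally show ?case .
qed

text \<open>Polar coordinates with the coordinate sum as radius \<open>s\<close> and a point of the
  simplex as direction. Exchanging the last coordinate for the sum is a shift, and scaling the other
  K - 1 coordinates by \<open>s\<close> produces the Jacobian \<open>s ^ (K - 1)\<close>.\<close>

lemma nn_integral_simplex_polar:
  fixes F :: "(nat \<Rightarrow> real) \<Rightarrow> ennreal"
  assumes K: "1 \<le> K" and F [measurable]: "F \<in> borel_measurable (rvec K)"
  shows "(\<integral>\<^sup>+y. (\<Prod>i=1..K. indicator {0<..} (y i)) * F y \<partial>Pi\<^sub>M {1..K} (\<lambda>_. lborel))
    = (\<integral>\<^sup>+x. (\<Prod>i=1..K. indicator {0<..} (fill_last K x i)) *
        (\<integral>\<^sup>+s. indicator {0<..} s * (ennreal (s ^ (K - 1)) * F (\<lambda>i\<in>{1..K}. s * fill_last K x i)) \<partial>lborel)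
        \<partial>Pi\<^sub>M {1..<K} (\<lambda>_. lborel))"
proof -
  let ?r = "\<lambda>s x. \<lambda>i\<in>{1..K}. s * fill_last K x i"
  interpret product_sigma_finite "\<lambda>_::nat. lborel :: real measure" by standard
  interpret J: finite_product_sigma_finite "\<lambda>_::nat. lborel :: real measure" "{1..<K}" by standard simp
  interpret P: pair_sigma_finite "Pi\<^sub>M {1..<K} (\<lambda>_. lborel :: real measure)" lborel by standard
  have [measurable_cong]: "sets (Pi\<^sub>M A (\<lambda>_. lborel)) = sets (Pi\<^sub>M A (\<lambda>_. borel :: real measure))" for A :: "nat set"
    by (intro sets_PiM_cong) auto
  have ins: "{1..K} = insert K {1..<K}" "K \<notin> {1..<K}" using K by auto
  let ?L = "Pi\<^sub>M {1..<K} (\<lambda>_. lborel :: real measure)"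
  define G where "G y = (\<Prod>i=1..K. indicator {0<..} (y i)) * F y" for y
  have G [measurable]: "G \<in> borel_measurable (rvec K)" unfolding G_def by measurable
  have upd: "(\<lambda>x. (f x)(K := g x)) \<in> N \<rightarrow>\<^sub>M rvec K"
    if [measurable]: "f \<in> N \<rightarrow>\<^sub>M Pi\<^sub>M {1..<K} (\<lambda>_. borel)" "g \<in> borel_measurable N" for N and f :: "'z \<Rightarrow> nat \<Rightarrow> real" and g
    unfolding ins(1) by measurable
  have Gu: "(\<lambda>x. G ((f x)(K := g x))) \<in> borel_measurable N"
    if "f \<in> N \<rightarrow>\<^sub>M Pi\<^sub>M {1..<K} (\<lambda>_. borel)" "g \<in> borel_measurable N" for N and f :: "'z \<Rightarrow> nat \<Rightarrow> real" and g
    by (rule measurable_compose[OF upd[OF that] G])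
  have fl: "fill_last K x = x(K := 1 - (\<Sum>i=1..<K. x i))" for x by (simp add: fill_last_def)
  have "(\<integral>\<^sup>+y. G y \<partial>Pi\<^sub>M {1..K} (\<lambda>_. lborel)) = (\<integral>\<^sup>+x. \<integral>\<^sup>+t. G (x(K := t)) \<partial>lborel \<partial>?L)"
  proof -
    have "G \<in> borel_measurable (Pi\<^sub>M (insert K {1..<K}) (\<lambda>_. lborel))"
      unfolding ins(1)[symmetric] by measurable
    then show ?thesis unfolding ins(1) by (intro product_nn_integral_insert) auto
  qed
  also have "\<dots> = (\<integral>\<^sup>+x. \<integral>\<^sup>+s. G (x(K := s - (\<Sum>i=1..<K. x i))) \<partial>lborel \<partial>?L)"
  proof (rule nn_integral_cong)
    fix x assume x: "x \<in> space ?L"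
    have "(\<lambda>t. G (x(K := t))) \<in> borel_measurable borel"
      by (rule Gu) (use x in \<open>auto simp: space_PiM\<close>)
    from nn_integral_real_affine[OF this, of 1 "- (\<Sum>i=1..<K. x i)"]
    show "(\<integral>\<^sup>+t. G (x(K := t)) \<partial>lborel) = (\<integral>\<^sup>+s. G (x(K := s - (\<Sum>i=1..<K. x i))) \<partial>lborel)"
      by simp
  qed
  \<comment> \<open>The order is exchanged so that \<open>s\<close> is fixed while the remaining
    coordinates are scaled by it.\<close>
  also have "\<dots> = (\<integral>\<^sup>+s. \<integral>\<^sup>+x. G (x(K := s - (\<Sum>i=1..<K. x i))) \<partial>?L \<partial>lborel)"
  proof -
    have "(\<lambda>z. G ((fst z)(K := snd z - (\<Sum>i=1..<K. fst z i)))) \<in> borel_measurable (?L \<Otimes>\<^sub>M lborel)"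
      by (rule Gu) measurable
    then show ?thesis by (intro P.Fubini'[symmetric]) (simp add: split_beta')
  qed
  also have "\<dots> = (\<integral>\<^sup>+s. \<integral>\<^sup>+x. indicator {0<..} s * (ennreal (s ^ (K - 1)) * G (?r s x)) \<partial>?L \<partial>lborel)"
  proof (rule nn_integral_cong)
    fix s :: real
    show "(\<integral>\<^sup>+x. G (x(K := s - (\<Sum>i=1..<K. x i))) \<partial>?L)
      = (\<integral>\<^sup>+x. indicator {0<..} s * (ennreal (s ^ (K - 1)) * G (?r s x)) \<partial>?L)"
    proof (cases "0 < s")
      \<comment> \<open>Positive coordinates cannot have a nonpositive sum, so the integrand
        vanishes.\<close>
      case False
      have "G (x(K := s - (\<Sum>i=1..<K. x i))) = 0" for x
      proof (rule ccontr)
        assume "G (x(K := s - (\<Sum>i=1..<K. x i))) \<noteq> 0"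
        then have *: "\<forall>i\<in>{1..K}. 0 < (x(K := s - (\<Sum>i=1..<K. x i))) i"
          unfolding G_def by (auto split: split_indicator_asm)
        have "0 < s - (\<Sum>i=1..<K. x i)" using *[rule_format, of K] K by simp
        moreover have "0 \<le> (\<Sum>i=1..<K. x i)" 
        proof (rule sum_nonneg)
          fix i assume "i \<in> {1..<K}" then show "0 \<le> x i" using *[rule_format, of i] by simp
        qed
        ultimately show False using False by simp
      qed
      then show ?thesis using False by simp
    next
      case True
      have "(\<integral>\<^sup>+x. (\<Prod>i\<in>{1..<K}. 1) * G (x(K := s - (\<Sum>i=1..<K. x i))) \<partial>?L)
        = (\<integral>\<^sup>+x. (\<Prod>i\<in>{1..<K}. ennreal s) * G ((\<lambda>i\<in>{1..<K}. s * x i)(K := s - (\<Sum>i=1..<K. (\<lambda>i\<in>{1..<K}. s * x i) i))) \<partial>?L)"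
      proof (rule nn_integral_PiM_lborel_substitution)
        show "(\<integral>\<^sup>+t. 1 * h t \<partial>lborel) = (\<integral>\<^sup>+y. ennreal s * h (s * y) \<partial>lborel)"
          if [measurable]: "h \<in> borel_measurable borel" for h
          using nn_integral_real_affine[OF that, of s 0] True by (simp add: nn_integral_cmult)
        show "(\<lambda>x. G (x(K := s - (\<Sum>i=1..<K. x i)))) \<in> borel_measurable (Pi\<^sub>M {1..<K} (\<lambda>_. borel))"
          by (rule Gu) measurable
      qed auto
      moreover have "(\<lambda>i\<in>{1..<K}. s * x i)(K := s - (\<Sum>i=1..<K. (\<lambda>i\<in>{1..<K}. s * x i) i)) = (?r s x)" for x
        using K by (auto simp: fun_eq_iff fl restrict_def right_diff_distrib sum_distrib_left)
      ultimately show ?thesis using True by (simp add: ennreal_power)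
    qed
  qed
  also have "\<dots> = (\<integral>\<^sup>+x. \<integral>\<^sup>+s. indicator {0<..} s * (ennreal (s ^ (K - 1)) * G (?r s x)) \<partial>lborel \<partial>?L)"
  proof -
    have "(\<lambda>z. (fst z)(K := 1 - (\<Sum>i=1..<K. fst z i))) \<in> ?L \<Otimes>\<^sub>M lborel \<rightarrow>\<^sub>M rvec K"
      by (rule upd) measurable
    then have fm: "(\<lambda>z. fill_last K (fst z)) \<in> ?L \<Otimes>\<^sub>M lborel \<rightarrow>\<^sub>M rvec K"
      by (simp only: fl)
    have [measurable]: "(\<lambda>z. fill_last K (fst z) i) \<in> borel_measurable (?L \<Otimes>\<^sub>M lborel)" if "i \<in> {1..K}" for i
      by (rule measurable_compose[OF fm measurable_component_singleton[OF that]])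
    show ?thesis
      by (intro P.Fubini') (unfold split_beta', measurable)
  qed
  also have "\<dots> = (\<integral>\<^sup>+x. (\<Prod>i=1..K. indicator {0<..} (fill_last K x i)) *
        (\<integral>\<^sup>+s. indicator {0<..} s * (ennreal (s ^ (K - 1)) * F (?r s x)) \<partial>lborel) \<partial>?L)"
  proof (rule nn_integral_cong, subst nn_integral_cmult[symmetric])
    fix x :: "nat \<Rightarrow> real"
    show "(\<lambda>s. indicator {0<..} s * (ennreal (s ^ (K - 1)) * F (?r s x))) \<in> borel_measurable lborel"
      by measurable
    show "(\<integral>\<^sup>+s. indicator {0<..} s * (ennreal (s ^ (K - 1)) * G (?r s x)) \<partial>lborel)
      = (\<integral>\<^sup>+s. (\<Prod>i=1..K. indicator {0<..} (fill_last K x i)) * (indicator {0<..} s * (ennreal (s ^ (K - 1)) * F (?r s x))) \<partial>lborel)"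
    proof (rule nn_integral_cong)
      fix s :: real
      have "0 < s \<Longrightarrow> (\<Prod>i=1..K. indicator {0<..} (s * fill_last K x i) :: ennreal) = (\<Prod>i=1..K. indicator {0<..} (fill_last K x i))"
        by (intro prod.cong refl) (auto simp: zero_less_mult_iff split: split_indicator)
      then show "indicator {0<..} s * (ennreal (s ^ (K - 1)) * G (?r s x))
        = (\<Prod>i=1..K. indicator {0<..} (fill_last K x i)) * (indicator {0<..} s * (ennreal (s ^ (K - 1)) * F (?r s x)))"
        by (auto simp: G_def mult_ac split: split_indicator)
    qed
  qed
  finally show ?thesis unfolding G_def .
qed

section \<open>Exponential representation of the Concrete distribution\<close>

text \<open>Exponential vectors are products of densities, whereas the substitutions above act on
  Lebesgue measure; this is the passage between the two. Boxes determine a product measure, and on a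
  box the integral of the product density factorises.\<close>

lemma PiM_density:
  fixes M :: "'i \<Rightarrow> 'a measure"
  assumes "finite I" and M: "product_sigma_finite M" and D: "product_sigma_finite (\<lambda>i. density (M i) (f i))"
    and f [measurable]: "\<And>i. f i \<in> borel_measurable (M i)"
  shows "Pi\<^sub>M I (\<lambda>i. density (M i) (f i)) = density (Pi\<^sub>M I M) (\<lambda>x. \<Prod>i\<in>I. f i (x i))"
proof -
  interpret M: product_sigma_finite M by (rule M)
  interpret D: product_sigma_finite "\<lambda>i. density (M i) (f i)" by (rule D)
  have s: "sets (Pi\<^sub>M I (\<lambda>i. density (M i) (f i))) = sets (Pi\<^sub>M I M)" by (intro sets_PiM_cong) auto
  show ?thesis
  proof (rule D.PiM_eqI[OF \<open>finite I\<close>, symmetric])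
    fix A assume A: "\<And>i. i \<in> I \<Longrightarrow> A i \<in> sets (density (M i) (f i))"
    have [measurable]: "i \<in> I \<Longrightarrow> A i \<in> sets (M i)" for i using A by simp
    have Pm: "Pi\<^sub>E I A \<in> sets (Pi\<^sub>M I M)" using A \<open>finite I\<close> by (intro sets_PiM_I_finite) auto
    have "emeasure (density (Pi\<^sub>M I M) (\<lambda>x. \<Prod>i\<in>I. f i (x i))) (Pi\<^sub>E I A)
      = (\<integral>\<^sup>+x. (\<Prod>i\<in>I. f i (x i)) * indicator (Pi\<^sub>E I A) x \<partial>Pi\<^sub>M I M)"
      using Pm by (intro emeasure_density) (auto intro!: borel_measurable_prod_ennreal)
    also have "\<dots> = (\<integral>\<^sup>+x. (\<Prod>i\<in>I. f i (x i) * indicator (A i) (x i)) \<partial>Pi\<^sub>M I M)"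
    proof (rule nn_integral_cong)
      fix x assume "x \<in> space (Pi\<^sub>M I M)"
      then have "x \<in> extensional I" by (simp add: space_PiM PiE_def)
      then have "indicator (Pi\<^sub>E I A) x = (\<Prod>i\<in>I. indicator (A i) (x i) :: ennreal)"
        using \<open>finite I\<close> by (auto simp: PiE_iff indicator_def)
      then show "(\<Prod>i\<in>I. f i (x i)) * indicator (Pi\<^sub>E I A) x = (\<Prod>i\<in>I. f i (x i) * indicator (A i) (x i))"
        by (simp add: prod.distrib)
    qed
    also have "\<dots> = (\<Prod>i\<in>I. \<integral>\<^sup>+t. f i t * indicator (A i) t \<partial>M i)"
      using \<open>finite I\<close> by (intro M.product_nn_integral_prod) auto
    also have "\<dots> = (\<Prod>i\<in>I. emeasure (density (M i) (f i)) (A i))"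
      by (intro prod.cong refl emeasure_density[symmetric]) auto
    finally show "emeasure (density (Pi\<^sub>M I M) (\<lambda>x. \<Prod>i\<in>I. f i (x i))) (Pi\<^sub>E I A)
      = (\<Prod>i\<in>I. emeasure (density (M i) (f i)) (A i))" .
  qed (use s in simp)
qed

section \<open>Exponential vectors and the samples obtained from them by normalisation\<close>

definition std_exp :: "real measure" where
  "std_exp = density lborel (exponential_density 1)"

definition exp_vector :: "nat \<Rightarrow> (nat \<Rightarrow> real) measure" where
  "exp_vector K = (\<Pi>\<^sub>M i\<in>{1..K}. std_exp)"

definition concrete_sample :: "nat \<Rightarrow> (nat \<Rightarrow> real) \<Rightarrow> real \<Rightarrow> (nat \<Rightarrow> real) \<Rightarrow> nat \<Rightarrow> real" where
  "concrete_sample K \<beta> \<tau> E =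
    (\<lambda>i\<in>{1..K}. (\<beta> i / E i) powr (1 / \<tau>) / (\<Sum>j=1..K. (\<beta> j / E j) powr (1 / \<tau>)))"

abbreviation has_exp_mean :: "(real \<Rightarrow> real) \<Rightarrow> real \<Rightarrow> bool" where
  "has_exp_mean \<equiv> has_bochner_integral std_exp"

abbreviation has_vec_mean :: "nat \<Rightarrow> ((nat \<Rightarrow> real) \<Rightarrow> real) \<Rightarrow> real \<Rightarrow> bool" where
  "has_vec_mean K \<equiv> has_bochner_integral (exp_vector K)"

lemma prob_space_std_exp: "prob_space std_exp"
  unfolding std_exp_def by (rule prob_space_exponential_density) simp

lemma sets_std_exp [simp, measurable_cong]: "sets std_exp = sets borel"
  by (simp add: std_exp_def)

lemma space_std_exp [simp]: "space std_exp = UNIV"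
  by (simp add: std_exp_def)

lemma sets_exp_vector [measurable_cong]: "sets (exp_vector K) = sets (rvec K)"
  unfolding exp_vector_def by (intro sets_PiM_cong) auto

lemma measurable_concrete_sample [measurable]:
  "concrete_sample K \<beta> \<tau> \<in> rvec K \<rightarrow>\<^sub>M rvec K"
  unfolding concrete_sample_def by measurable

lemma measurable_concrete_density [measurable]:
  "concrete_density K \<beta> \<tau> \<in> borel_measurable (rvec K)"
  unfolding concrete_density_def by measurable

lemma measurable_fill_last [measurable]:
  assumes "1 \<le> K"
  shows "fill_last K \<in> Pi\<^sub>M {1..<K} (\<lambda>_. lborel) \<rightarrow>\<^sub>M rvec K"
proof -
  have [measurable_cong]: "sets (Pi\<^sub>M {1..<K} (\<lambda>_. lborel)) = sets (Pi\<^sub>M {1..<K} (\<lambda>_. borel :: real measure))"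
    by (intro sets_PiM_cong) auto
  have "{1..K} = insert K {1..<K}" using assms by auto
  then show ?thesis unfolding fill_last_def by (simp only:) measurable
qed

lemma prob_simplex_sets: "prob_simplex K \<inter> space (rvec K) \<in> sets (rvec K)"
proof -
  have "prob_simplex K \<inter> space (rvec K)
    = {x \<in> space (rvec K). (\<forall>i\<in>{1..K}. 0 \<le> x i) \<and> (\<Sum>i=1..K. x i) = 1}"
    by (auto simp: prob_simplex_def space_PiM PiE_def)
  also have "\<dots> \<in> sets (rvec K)" by measurable
  finally show ?thesis .
qed

lemma measurable_indicator_prob_simplex:
  "(indicator (prob_simplex K) :: _ \<Rightarrow> ennreal) \<in> borel_measurable (rvec K)"
proof (rule borel_measurable_indicator'[where A = "\<lambda>_. prob_simplex K" and f = "\<lambda>x. x"])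
  have "{x \<in> space (rvec K). x \<in> prob_simplex K} = prob_simplex K \<inter> space (rvec K)"
    by auto
  then show "{x \<in> space (rvec K). x \<in> prob_simplex K} \<in> sets (rvec K)"
    using prob_simplex_sets[of K] by (simp only:)
qed

lemma nn_integral_concrete:
  assumes K: "1 \<le> K" and G [measurable]: "G \<in> borel_measurable (rvec K)"
  shows "(\<integral>\<^sup>+x. G x \<partial>concrete K \<beta> \<tau>) = (\<integral>\<^sup>+x. ennreal (concrete_density K \<beta> \<tau> (fill_last K x)) * G (fill_last K x)
      * indicator (prob_simplex K) (fill_last K x) \<partial>Pi\<^sub>M {1..<K} (\<lambda>_. lborel))"
proof -
  let ?D = "distr (\<Pi>\<^sub>M i\<in>{1..<K}. lborel) (\<Pi>\<^sub>M i\<in>{1..K}. borel) (fill_last K)"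
  have [measurable]: "fill_last K \<in> Pi\<^sub>M {1..<K} (\<lambda>_. lborel) \<rightarrow>\<^sub>M rvec K"
    by (rule measurable_fill_last[OF K])
  note [measurable] = measurable_indicator_prob_simplex
  have 1: "f \<in> borel_measurable (restrict_space ?D (prob_simplex K))"
    if "f \<in> borel_measurable (rvec K)" for f :: "_ \<Rightarrow> ennreal"
    using that by (intro measurable_restrict_space1) simp
  have "(\<integral>\<^sup>+x. G x \<partial>concrete K \<beta> \<tau>)
    = (\<integral>\<^sup>+x. ennreal (concrete_density K \<beta> \<tau> x) * G x \<partial>restrict_space ?D (prob_simplex K))"
    unfolding concrete_def simplex_lborel_def by (rule nn_integral_density; rule 1; measurable)
  also have "\<dots> = (\<integral>\<^sup>+x. ennreal (concrete_density K \<beta> \<tau> x) * G x * indicator (prob_simplex K) x \<partial>?D)"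
    using prob_simplex_sets[of K] by (intro nn_integral_restrict_space) simp
  also have "\<dots> = (\<integral>\<^sup>+x. ennreal (concrete_density K \<beta> \<tau> (fill_last K x)) * G (fill_last K x)
      * indicator (prob_simplex K) (fill_last K x) \<partial>Pi\<^sub>M {1..<K} (\<lambda>_. lborel))"
    by (rule nn_integral_distr; measurable)
  finally show ?thesis .
qed

lemma nn_integral_power_exp:
  "(\<integral>\<^sup>+t. indicator {0<..} t * ennreal (t ^ k * exp (- t)) \<partial>lborel) = ennreal (fact k)"
proof -
  have "(\<integral>\<^sup>+t. indicator {0<..} t * ennreal (t ^ k * exp (- t)) \<partial>lborel)
    = (\<integral>\<^sup>+t. ennreal (t ^ k * exp (- t)) * indicator {0..} t \<partial>lborel)"
    by (rule nn_integral_cong_AE, use AE_lborel_singleton[of "0::real"] in eventually_elim)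
      (auto split: split_indicator)
  then show ?thesis by (simp add: nn_intergal_power_times_exp_Ici)
qed

lemma nn_integral_std_exp_powr:
  assumes [measurable]: "h \<in> borel_measurable borel" and "0 < b" "0 < \<tau>"
  shows "(\<integral>\<^sup>+t. ennreal (exponential_density 1 t) * h t \<partial>lborel)
    = (\<integral>\<^sup>+y. (indicator {0<..} y * ennreal (b * \<tau> * y powr (- \<tau> - 1) * exp (- (b * y powr (- \<tau>))))) * h (b * y powr (- \<tau>)) \<partial>lborel)"
proof -
  have "(\<integral>\<^sup>+t. ennreal (exponential_density 1 t) * h t \<partial>lborel)
    = (\<integral>\<^sup>+t. indicator {0<..} t * (ennreal (exp (- t)) * h t) \<partial>lborel)"
    by (rule nn_integral_cong_AE, use AE_lborel_singleton[of "0::real"] in eventually_elim)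
      (auto simp: exponential_density_def split: split_indicator)
  also have "\<dots> = (\<integral>\<^sup>+y. (indicator {0<..} y * ennreal (b * \<tau> * y powr (- \<tau> - 1))) *
      (ennreal (exp (- (b * y powr (- \<tau>)))) * h (b * y powr (- \<tau>))) \<partial>lborel)"
    by (rule nn_integral_powr_substitution) (use assms in auto)
  finally show ?thesis using assms by (simp add: ennreal_mult' mult_ac)
qed

text \<open>For these exponentials the unnormalised vector of powers is \<open>s * x\<close>, with
  sum \<open>s\<close>, so normalisation returns \<open>x\<close> whatever the radius. Hence the
  radial variable can be integrated out with the sample held fixed.\<close>

lemma concrete_sample_simplex:
  assumes "x \<in> extensional {1..K}" "\<And>i. i \<in> {1..K} \<Longrightarrow> 0 < x i" "(\<Sum>i=1..K. x i) = 1"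
    and "\<And>i. i \<in> {1..K} \<Longrightarrow> 0 < \<beta> i" "0 < \<tau>" "0 < s"
  shows "concrete_sample K \<beta> \<tau> (\<lambda>i\<in>{1..K}. \<beta> i * (s * x i) powr (- \<tau>)) = x"
proof -
  have *: "(\<beta> i / (\<lambda>i\<in>{1..K}. \<beta> i * (s * x i) powr (- \<tau>)) i) powr (1 / \<tau>) = s * x i" if "i \<in> {1..K}" for i
  proof -
    have y: "0 < s * x i" using assms(2)[OF that] assms(6) by simp
    then have "\<beta> i / (\<beta> i * (s * x i) powr (- \<tau>)) = (s * x i) powr \<tau>"
      using assms(4)[OF that] by (simp add: powr_minus field_simps)
    then show ?thesis using y that assms(5) by (simp add: powr_powr)
  qed
  then have "(\<Sum>i=1..K. (\<beta> i / (\<lambda>i\<in>{1..K}. \<beta> i * (s * x i) powr (- \<tau>)) i) powr (1 / \<tau>)) = s"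
    using assms(3) by (simp add: sum_distrib_left[symmetric])
  with * show ?thesis unfolding concrete_sample_def
    using assms(1,6) by (auto simp: fun_eq_iff extensional_def)
qed

text \<open>The substitution \<open>A * s powr (- \<tau>)\<close>, which is the total of the
  exponentials, turns the radial integral into the Gamma integral at K + d. The quotient of
  factorials is the d-th moment of that total; since it does not involve \<open>x\<close>, the total
  is independent of the sample.\<close>

lemma concrete_radial_integral:
  assumes K: "1 \<le> K" and x: "\<And>i. i \<in> {1..K} \<Longrightarrow> 0 < x i" and \<beta>: "\<And>i. i \<in> {1..K} \<Longrightarrow> 0 < \<beta> i" and \<tau>: "0 < \<tau>"
  shows "(\<integral>\<^sup>+s. indicator {0<..} s * ennreal (s ^ (K - 1) *
      (\<Prod>i=1..K. \<beta> i * \<tau> * (s * x i) powr (- \<tau> - 1) * exp (- (\<beta> i * (s * x i) powr (- \<tau>)))) *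
      (\<Sum>i=1..K. \<beta> i * (s * x i) powr (- \<tau>)) ^ d) \<partial>lborel)
    = ennreal (concrete_density K \<beta> \<tau> x * (fact (K + d - 1) / fact (K - 1)))"
proof -
  let ?R = "\<lambda>s. s ^ (K - 1) *
      (\<Prod>i=1..K. \<beta> i * \<tau> * (s * x i) powr (- \<tau> - 1) * exp (- (\<beta> i * (s * x i) powr (- \<tau>)))) *
      (\<Sum>i=1..K. \<beta> i * (s * x i) powr (- \<tau>)) ^ d"
  define A where "A = (\<Sum>i=1..K. \<beta> i * x i powr (- \<tau>))"
  define C where "C = (\<Prod>i=1..K. \<beta> i * \<tau> * x i powr (- \<tau> - 1))"
  have "0 < \<beta> i * x i powr (- \<tau>)" if "i \<in> {1..K}" for i
    using x[OF that] \<beta>[OF that] by simp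
  then have A: "0 < A" unfolding A_def using K by (intro sum_pos) auto
  have "0 < \<beta> i * \<tau> * x i powr (- \<tau> - 1)" if "i \<in> {1..K}" for i
    using x[OF that] \<beta>[OF that] \<tau> by simp
  then have C: "0 < C" unfolding C_def by (intro prod_pos) auto
  have split: "?R s
    = C / (A ^ K * \<tau>) * ((A * \<tau> * s powr (- \<tau> - 1)) * ((A * s powr (- \<tau>)) ^ (K + d - 1) * exp (- (A * s powr (- \<tau>)))))"
    if s: "0 < s" for s
  proof -
    have sx: "(s * x i) powr a = s powr a * x i powr a" if "i \<in> {1..K}" for i a
      using s x[OF that] by (simp add: powr_mult)
    have S: "(\<Sum>i=1..K. \<beta> i * (s * x i) powr (- \<tau>)) = A * s powr (- \<tau>)"
      unfolding A_def sum_distrib_right by (intro sum.cong) (auto simp: sx)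
    have P: "(\<Prod>i=1..K. \<beta> i * \<tau> * (s * x i) powr (- \<tau> - 1) * exp (- (\<beta> i * (s * x i) powr (- \<tau>))))
      = C * (s powr (- \<tau> - 1)) ^ K * exp (- (A * s powr (- \<tau>)))"
    proof -
      have "(\<Prod>i=1..K. \<beta> i * \<tau> * (s * x i) powr (- \<tau> - 1) * exp (- (\<beta> i * (s * x i) powr (- \<tau>))))
        = (\<Prod>i=1..K. (\<beta> i * \<tau> * x i powr (- \<tau> - 1)) * s powr (- \<tau> - 1)) * (\<Prod>i=1..K. exp (- (\<beta> i * (s * x i) powr (- \<tau>))))"
        unfolding prod.distrib[symmetric] by (intro prod.cong) (auto simp: sx)
      also have "(\<Prod>i=1..K. exp (- (\<beta> i * (s * x i) powr (- \<tau>)))) = exp (- (A * s powr (- \<tau>)))"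
        unfolding S[symmetric] by (simp add: exp_sum flip: sum_negf)
      finally show ?thesis by (simp add: prod.distrib C_def)
    qed
    \<comment> \<open>Both sides have exponent - 1 - \<tau> (K + d): the Jacobian cancels all but
      one of the K contributions - 1.\<close>
    have pw: "s ^ (K - 1) * (s powr (- \<tau> - 1)) ^ K * (s powr (- \<tau>)) ^ d
       = s powr (- \<tau> - 1) * (s powr (- \<tau>)) ^ (K + d - 1)"
      using s K by (simp add: powr_realpow[symmetric] powr_powr powr_add[symmetric] of_nat_diff algebra_simps)
    have Ap: "A ^ d = A ^ (K + d - 1) * A / A ^ K"
    proof -
      have "A ^ (K + d - 1) * A = A ^ Suc (K + d - 1)" by simp
      also have "Suc (K + d - 1) = K + d" using K by simp
      finally show ?thesis using A by (simp add: power_add)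
    qed
    have "s ^ (K - 1) * (C * (s powr (- \<tau> - 1)) ^ K * exp (- (A * s powr (- \<tau>)))) * (A * s powr (- \<tau>)) ^ d
      = (s ^ (K - 1) * (s powr (- \<tau> - 1)) ^ K * (s powr (- \<tau>)) ^ d) * C * A ^ d * exp (- (A * s powr (- \<tau>)))"
      by (simp add: power_mult_distrib mult_ac)
    also have "\<dots> = C / (A ^ K * \<tau>) * ((A * \<tau> * s powr (- \<tau> - 1)) * ((A * s powr (- \<tau>)) ^ (K + d - 1) * exp (- (A * s powr (- \<tau>)))))"
      unfolding pw Ap using A \<tau> by (simp add: power_mult_distrib mult_ac)
    finally show ?thesis unfolding P S .
  qed
  have "(\<integral>\<^sup>+s. indicator {0<..} s * ennreal (?R s) \<partial>lborel)
    = (\<integral>\<^sup>+s. ennreal (C / (A ^ K * \<tau>)) * ((indicator {0<..} s * ennreal (A * \<tau> * s powr (- \<tau> - 1))) *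
        ennreal ((A * s powr (- \<tau>)) ^ (K + d - 1) * exp (- (A * s powr (- \<tau>))))) \<partial>lborel)"
  proof (rule nn_integral_cong)
    fix s :: real
    show "indicator {0<..} s * ennreal (?R s)
      = ennreal (C / (A ^ K * \<tau>)) * ((indicator {0<..} s * ennreal (A * \<tau> * s powr (- \<tau> - 1))) *
        ennreal ((A * s powr (- \<tau>)) ^ (K + d - 1) * exp (- (A * s powr (- \<tau>)))))"
    proof (cases "0 < s")
      case True
      then have i1: "indicator {0<..} s = (1::ennreal)" by simp
      have m: "ennreal (a * (b * c)) = ennreal a * (ennreal b * ennreal c)" if "0 \<le> a" "0 \<le> b" for a b c :: real
        using that by (simp add: ennreal_mult')
      show ?thesis unfolding split[OF True] i1 mult_1_left
        by (rule m) (use A C \<tau> in auto)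
    qed simp
  qed
  also have "\<dots> = ennreal (C / (A ^ K * \<tau>)) * (\<integral>\<^sup>+t. indicator {0<..} t * ennreal (t ^ (K + d - 1) * exp (- t)) \<partial>lborel)"
    by (subst nn_integral_cmult) (use A \<tau> in \<open>auto simp: nn_integral_powr_substitution[where b = A and \<tau> = \<tau>]\<close>)
  also have "\<dots> = ennreal (C / (A ^ K * \<tau>) * fact (K + d - 1))"
    unfolding nn_integral_power_exp by (rule ennreal_mult'[symmetric]) (use A C \<tau> in auto)
  also have "C / (A ^ K * \<tau>) * fact (K + d - 1) = concrete_density K \<beta> \<tau> x * (fact (K + d - 1) / fact (K - 1))"
  proof -
    have "C = \<tau> ^ K * (\<Prod>i=1..K. \<beta> i / x i powr (\<tau> + 1))"
      unfolding C_def prod.distrib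
      using x by (simp add: prod.distrib prod_dividef powr_minus_divide[of _ "\<tau> + 1", simplified] mult_ac)
    moreover have "A = (\<Sum>j=1..K. \<beta> j / x j powr \<tau>)"
      unfolding A_def by (simp add: powr_minus_divide)
    moreover have "\<tau> ^ K = \<tau> * \<tau> ^ (K - 1)" using K by (cases K) auto
    ultimately show ?thesis unfolding concrete_density_def using A \<tau> by (simp add: field_simps)
  qed
  finally show ?thesis .
qed

text \<open>Independence of total and sample in integrated form: weighting by the d-th power of the
  total changes the law of the sample only by a constant factor. Later d = 2 is used for products of
  two scores and d = 0 for log-ratios.\<close>

lemma nn_integral_concrete_sample:
  assumes K: "1 \<le> K" and \<beta>: "\<And>i. i \<in> {1..K} \<Longrightarrow> 0 < \<beta> i" and \<tau>: "0 < \<tau>"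
    and G [measurable]: "G \<in> borel_measurable (rvec K)"
  shows "(\<integral>\<^sup>+E. ennreal ((\<Sum>i=1..K. E i) ^ d) * G (concrete_sample K \<beta> \<tau> E) \<partial>exp_vector K)
    = ennreal (fact (K + d - 1) / fact (K - 1)) * (\<integral>\<^sup>+x. G x \<partial>concrete K \<beta> \<tau>)"
proof -
  let ?L = "Pi\<^sub>M {1..K} (\<lambda>_. lborel :: real measure)"
  have sl [measurable_cong]: "sets (Pi\<^sub>M A (\<lambda>_. lborel)) = sets (Pi\<^sub>M A (\<lambda>_. borel :: real measure))" for A :: "nat set"
    by (intro sets_PiM_cong) auto
  interpret E: prob_space std_exp by (rule prob_space_std_exp)
  have PE: "exp_vector K = density ?L (\<lambda>x. \<Prod>i=1..K. ennreal (exponential_density 1 (x i)))"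
    unfolding exp_vector_def std_exp_def
  proof (rule PiM_density)
    show "product_sigma_finite (\<lambda>i::nat. density lborel (\<lambda>x. ennreal (exponential_density 1 x)))"
      unfolding std_exp_def[symmetric] by standard
    show "product_sigma_finite (\<lambda>_::nat. lborel :: real measure)" by standard
  qed auto
  define H where "H E = ennreal ((\<Sum>i=1..K. E i) ^ d) * G (concrete_sample K \<beta> \<tau> E)" for E
  have Hm [measurable]: "H \<in> borel_measurable (rvec K)" unfolding H_def by measurable
  define R where "R i y = \<beta> i * \<tau> * y powr (- \<tau> - 1) * exp (- (\<beta> i * y powr (- \<tau>)))" for i y
  have R0: "0 \<le> R i y" if "i \<in> {1..K}" for i y unfolding R_def using \<beta>[OF that] \<tau> by simp
  have [measurable]: "R i \<in> borel_measurable borel" for i unfolding R_def by measurable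
  define \<phi> where "\<phi> i y = \<beta> i * y powr (- \<tau>)" for i y
  have [measurable]: "\<phi> i \<in> borel_measurable borel" for i unfolding \<phi>_def by measurable
  define F where "F y = (\<Prod>i=1..K. ennreal (R i (y i))) * H (\<lambda>i\<in>{1..K}. \<phi> i (y i))" for y
  have [measurable]: "F \<in> borel_measurable (rvec K)" unfolding F_def by measurable
  have "(\<integral>\<^sup>+E. H E \<partial>exp_vector K) = (\<integral>\<^sup>+x. (\<Prod>i=1..K. ennreal (exponential_density 1 (x i))) * H x \<partial>?L)"
    unfolding PE by (rule nn_integral_density) measurable
  also have "\<dots> = (\<integral>\<^sup>+y. (\<Prod>i=1..K. indicator {0<..} (y i) * ennreal (R i (y i))) * H (\<lambda>i\<in>{1..K}. \<phi> i (y i)) \<partial>?L)"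
  proof (rule nn_integral_PiM_lborel_substitution)
    fix i :: nat and h :: "real \<Rightarrow> ennreal" assume i: "i \<in> {1..K}" and h: "h \<in> borel_measurable borel"
    show "(\<integral>\<^sup>+t. ennreal (exponential_density 1 t) * h t \<partial>lborel)
       = (\<integral>\<^sup>+y. indicator {0<..} y * ennreal (R i y) * h (\<phi> i y) \<partial>lborel)"
      unfolding R_def \<phi>_def by (rule nn_integral_std_exp_powr[OF h \<beta>[OF i] \<tau>])
  qed (use Hm in auto)
  also have "\<dots> = (\<integral>\<^sup>+y. (\<Prod>i=1..K. indicator {0<..} (y i)) * F y \<partial>?L)"
    by (simp add: prod.distrib F_def mult_ac)
  also have "\<dots> = (\<integral>\<^sup>+x. (\<Prod>i=1..K. indicator {0<..} (fill_last K x i)) *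
        (\<integral>\<^sup>+s. indicator {0<..} s * (ennreal (s ^ (K - 1)) * F (\<lambda>i\<in>{1..K}. s * fill_last K x i)) \<partial>lborel)
        \<partial>Pi\<^sub>M {1..<K} (\<lambda>_. lborel))"
    by (rule nn_integral_simplex_polar[OF K]) measurable
  also have "\<dots> = (\<integral>\<^sup>+x. ennreal (fact (K + d - 1) / fact (K - 1)) *
      (ennreal (concrete_density K \<beta> \<tau> (fill_last K x)) * G (fill_last K x)
      * indicator (prob_simplex K) (fill_last K x)) \<partial>Pi\<^sub>M {1..<K} (\<lambda>_. lborel))"
  proof (rule nn_integral_cong)
    fix x assume "x \<in> space (Pi\<^sub>M {1..<K} (\<lambda>_. lborel :: real measure))"
    then have xe: "x \<in> extensional {1..<K}" by (simp add: space_PiM PiE_def)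
    define \<xi> where "\<xi> = fill_last K x"
    have \<xi>e: "\<xi> \<in> extensional {1..K}" using xe K by (auto simp: \<xi>_def fill_last_def extensional_def)
    have \<xi>1: "(\<Sum>i=1..K. \<xi> i) = 1"
    proof -
      have "{1..K} = insert K {1..<K}" using K by auto
      then show ?thesis by (simp add: \<xi>_def fill_last_def sum.insert_remove)
    qed
    let ?goal = "(\<Prod>i=1..K. indicator {0<..} (\<xi> i)) *
        (\<integral>\<^sup>+s. indicator {0<..} s * (ennreal (s ^ (K - 1)) * F (\<lambda>i\<in>{1..K}. s * \<xi> i)) \<partial>lborel)
      = ennreal (fact (K + d - 1) / fact (K - 1)) *
      (ennreal (concrete_density K \<beta> \<tau> \<xi>) * G \<xi> * indicator (prob_simplex K) \<xi>)"
    show "(\<Prod>i=1..K. indicator {0<..} (fill_last K x i)) *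
        (\<integral>\<^sup>+s. indicator {0<..} s * (ennreal (s ^ (K - 1)) * F (\<lambda>i\<in>{1..K}. s * fill_last K x i)) \<partial>lborel)
      = ennreal (fact (K + d - 1) / fact (K - 1)) *
      (ennreal (concrete_density K \<beta> \<tau> (fill_last K x)) * G (fill_last K x)
      * indicator (prob_simplex K) (fill_last K x))"
      unfolding \<xi>_def[symmetric]
    proof (cases "\<forall>i\<in>{1..K}. 0 < \<xi> i")
      case True
      then have \<xi>p: "\<And>i. i \<in> {1..K} \<Longrightarrow> 0 < \<xi> i" by blast
      have sx: "\<xi> \<in> prob_simplex K" using \<xi>e \<xi>1 True by (auto simp: prob_simplex_def less_imp_le)
      have dens0: "0 \<le> concrete_density K \<beta> \<tau> \<xi>"
        unfolding concrete_density_def using \<beta> \<xi>p \<tau>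
        by (intro mult_nonneg_nonneg divide_nonneg_nonneg prod_nonneg zero_le_power sum_nonneg) (auto simp: less_imp_le)
      have "indicator {0<..} s * (ennreal (s ^ (K - 1)) * F (\<lambda>i\<in>{1..K}. s * \<xi> i))
        = G \<xi> * (indicator {0<..} s * ennreal (s ^ (K - 1) * (\<Prod>i=1..K. R i (s * \<xi> i)) * (\<Sum>i=1..K. \<phi> i (s * \<xi> i)) ^ d))" for s
      proof (cases "0 < s")
        case s: True
        have "(\<lambda>i\<in>{1..K}. \<phi> i ((\<lambda>i\<in>{1..K}. s * \<xi> i) i)) = (\<lambda>i\<in>{1..K}. \<beta> i * (s * \<xi> i) powr (- \<tau>))"
          by (auto simp: \<phi>_def)
        then have "H (\<lambda>i\<in>{1..K}. \<phi> i ((\<lambda>i\<in>{1..K}. s * \<xi> i) i)) = ennreal ((\<Sum>i=1..K. \<phi> i (s * \<xi> i)) ^ d) * G \<xi>"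
          unfolding H_def using concrete_sample_simplex[OF \<xi>e \<xi>p \<xi>1 \<beta> \<tau> s] by (simp add: \<phi>_def)
        moreover have "(\<Prod>i=1..K. ennreal (R i ((\<lambda>i\<in>{1..K}. s * \<xi> i) i))) = ennreal (\<Prod>i=1..K. R i (s * \<xi> i))"
          by (subst prod_ennreal[OF R0, symmetric]) (auto intro!: prod.cong)
        moreover have "0 \<le> (\<Prod>i=1..K. R i (s * \<xi> i))" using R0 by (intro prod_nonneg) auto
        ultimately show ?thesis unfolding F_def using s by (simp add: ennreal_mult' mult_ac)
      qed simp
      then have "(\<integral>\<^sup>+s. indicator {0<..} s * (ennreal (s ^ (K - 1)) * F (\<lambda>i\<in>{1..K}. s * \<xi> i)) \<partial>lborel)
        = G \<xi> * ennreal (concrete_density K \<beta> \<tau> \<xi> * (fact (K + d - 1) / fact (K - 1)))"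
        using concrete_radial_integral[OF K \<xi>p \<beta> \<tau>, where d = d]
        by (simp only: R_def \<phi>_def) (subst nn_integral_cmult; simp add: R_def[symmetric] \<phi>_def[symmetric])
      then show ?goal
        using sx \<xi>p dens0
        by (simp add: ennreal_mult' mult_ac times_divide_eq_right[symmetric] del: times_divide_eq_right)
    next
      case False
      then obtain i where i: "i \<in> {1..K}" "\<not> 0 < \<xi> i" by blast
      then have "(\<Prod>i=1..K. indicator {0<..} (\<xi> i) :: ennreal) = 0"
        by (intro prod_zero) (auto intro!: bexI[of _ i])
      moreover have "ennreal (concrete_density K \<beta> \<tau> \<xi>) * G \<xi> * indicator (prob_simplex K) \<xi> = 0"
      proof (cases "\<xi> \<in> prob_simplex K")
        case True
        then have "\<xi> i = 0" using i by (force simp: prob_simplex_def)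
        \<comment> \<open>Division by zero yields 0, so the density formula vanishes on the boundary
          and both sides agree there.\<close>
        then have "(\<Prod>i=1..K. \<beta> i / \<xi> i powr (\<tau> + 1)) = 0" using i by (intro prod_zero) auto
        then show ?thesis unfolding concrete_density_def by (simp only: mult_zero_right mult_zero_left ennreal_0)
      qed simp
      ultimately show ?goal
        by (simp only: mult_zero_left mult_zero_right)
    qed
  qed
  also have "\<dots> = ennreal (fact (K + d - 1) / fact (K - 1)) * (\<integral>\<^sup>+x. G x \<partial>concrete K \<beta> \<tau>)"
  proof -
    note [measurable] = measurable_fill_last[OF K]
    note [measurable] = measurable_indicator_prob_simplex
    show ?thesis unfolding nn_integral_concrete[OF K G] by (rule nn_integral_cmult) measurable
  qed
  finally show ?thesis unfolding H_def .
qed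

section \<open>Moments of the logarithm of an exponential variable\<close>

text \<open>
  Moments of \<open>X\<close> from its moment generating function: integrating the exponential series termwise
  exhibits the latter as a power series whose coefficients are the moments.
\<close>

lemma moments_from_mgf:
  fixes X :: "'a \<Rightarrow> real" and F F1 :: "real \<Rightarrow> real"
  assumes [measurable]: "X \<in> borel_measurable M" and a: "0 < a"
    and F: "\<And>s. \<bar>s\<bar> < a \<Longrightarrow> has_bochner_integral M (\<lambda>x. exp (s * X x)) (F s)"
    and F1: "\<And>s. \<bar>s\<bar> < a \<Longrightarrow> (F has_real_derivative F1 s) (at s)"
    and F2: "(F1 has_real_derivative F2) (at 0)"
  shows "has_bochner_integral M X (F1 0)" and "has_bochner_integral M (\<lambda>x. (X x)\<^sup>2) F2"
proof -
  have int: "integrable M (\<lambda>x. exp (s * X x) + exp (- s * X x))" if "\<bar>s\<bar> < a" for s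
    using F[OF that] F[of "- s"] that by (intro Bochner_Integration.integrable_add) (auto simp: has_bochner_integral_iff)
  \<comment> \<open>Partial sums of the exponential series of the absolute value stay below its
    exponential, which is one of the two summands on the right. This majorant gives integrability of
    each term and justifies termwise integration.\<close>
  have bound: "(\<Sum>i<n. \<bar>(s * X x) ^ i / fact i\<bar>) \<le> exp (s * X x) + exp (- s * X x)" for s x and n :: nat
  proof -
    have "(\<Sum>i<n. \<bar>s * X x\<bar> ^ i / fact i) \<le> exp \<bar>s * X x\<bar>"
      unfolding exp_def using sum_le_suminf[OF summable_exp_generic[of "\<bar>s * X x\<bar>"], of "{..<n}"]
      by (simp add: field_simps)
    also have "\<dots> \<le> exp (s * X x) + exp (- s * X x)" by (simp add: abs_if)
    finally show ?thesis by (simp add: abs_divide power_abs)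
  qed
  have intp: "integrable M (\<lambda>x. (s * X x) ^ n / fact n)" if "\<bar>s\<bar> < a" for s and n :: nat
  proof (rule Bochner_Integration.integrable_bound[OF int[OF that]])
    show "AE x in M. norm ((s * X x) ^ n / fact n) \<le> norm (exp (s * X x) + exp (- s * X x))"
    proof (rule AE_I2)
      fix x
      have "\<bar>(s * X x) ^ n / fact n\<bar> \<le> (\<Sum>i<Suc n. \<bar>(s * X x) ^ i / fact i\<bar>)"
        by (simp add: sum_nonneg)
      also note bound
      finally show "norm ((s * X x) ^ n / fact n) \<le> norm (exp (s * X x) + exp (- s * X x))" by simp
    qed
  qed measurable
  define c where "c n = (\<integral>x. X x ^ n \<partial>M) / fact n" for n
  have sums: "(\<lambda>n. c n * s ^ n) sums F s" if s: "norm s < a" for s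
  proof -
    have s': "\<bar>s\<bar> < a" using s by simp
    have "(\<lambda>n. \<integral>x. (s * X x) ^ n / fact n \<partial>M) sums (\<integral>x. (\<Sum>n. (s * X x) ^ n / fact n) \<partial>M)"
    proof (rule sums_integral)
      show "AE x in M. summable (\<lambda>n. norm ((s * X x) ^ n / fact n))"
        using summable_norm_exp[of "s * X x" for x] by (simp add: divide_inverse norm_mult mult.commute)
      show "summable (\<lambda>n. \<integral>x. norm ((s * X x) ^ n / fact n) \<partial>M)"
      proof (rule summableI_nonneg_bounded)
        fix n
        have "(\<Sum>i<n. \<integral>x. norm ((s * X x) ^ i / fact i) \<partial>M) = (\<integral>x. (\<Sum>i<n. norm ((s * X x) ^ i / fact i)) \<partial>M)"
          by (rule Bochner_Integration.integral_sum[symmetric]) (intro integrable_norm intp[OF s'])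
        also have "\<dots> \<le> (\<integral>x. exp (s * X x) + exp (- s * X x) \<partial>M)"
          using bound intp[OF s'] by (intro integral_mono int[OF s'] Bochner_Integration.integrable_sum integrable_norm) auto
        finally show "(\<Sum>i<n. \<integral>x. norm ((s * X x) ^ i / fact i) \<partial>M) \<le> (\<integral>x. exp (s * X x) + exp (- s * X x) \<partial>M)" .
      qed simp
    qed (rule intp[OF s'])
    moreover have "(\<Sum>n. (s * X x) ^ n / fact n) = exp (s * X x)" for x
      by (simp add: exp_def divide_inverse mult.commute)
    moreover have "(\<integral>x. (s * X x) ^ n / fact n \<partial>M) = c n * s ^ n" for n
      by (simp add: c_def power_mult_distrib mult.commute)
    ultimately show ?thesis using F[OF s'] by (simp add: has_bochner_integral_iff)
  qed
  \<comment> \<open>The first derivative is identified on a whole interval, so that its series can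
    be differentiated once more at 0.\<close>
  have sums1: "(\<lambda>n. diffs c n * s ^ n) sums F1 s" if "norm s < a" for s
    by (rule termdiffs_sums_strong[OF sums _ that]) (use F1 that in auto)
  have sums2: "(\<lambda>n. diffs (diffs c) n * 0 ^ n) sums F2"
    by (rule termdiffs_sums_strong[OF sums1 F2]) (use a in auto)
  have z: "(\<lambda>n. d n * (0::real) ^ n) sums y \<Longrightarrow> d 0 = y" for d y
    using powser_sums_zero[of d] sums_unique2 by blast
  have "c 1 = F1 0" using z[OF sums1[of 0]] a by (simp add: diffs_def)
  moreover have "2 * c 2 = F2" using z[OF sums2] by (simp add: diffs_def numeral_2_eq_2)
  \<comment> \<open>Any nonzero argument inside the interval would do; \<open>a / 2\<close> is one,
    and its power is divided out again.\<close>
  moreover have "integrable M (\<lambda>x. X x ^ n)" for n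
  proof -
    have "integrable M (\<lambda>x. (a / 2 * X x) ^ n / fact n)" by (rule intp) (use a in simp)
    then have "integrable M (\<lambda>x. fact n / (a / 2) ^ n * ((a / 2 * X x) ^ n / fact n))"
      by (intro integrable_mult_right)
    moreover have "fact n / (a / 2) ^ n * ((a / 2 * X x) ^ n / fact n) = X x ^ n" for x
      unfolding power_mult_distrib using a by simp
    ultimately show ?thesis by (simp only:)
  qed
  from this[of 1] this[of 2] have "integrable M X" "integrable M (\<lambda>x. (X x)\<^sup>2)" by simp_all
  ultimately show "has_bochner_integral M X (F1 0)" and "has_bochner_integral M (\<lambda>x. (X x)\<^sup>2) F2"
    by (simp_all add: has_bochner_integral_iff c_def)
qed

section \<open>Logarithmic moments of the exponential law from the Gamma function\<close>

lemma AE_std_exp_pos: "AE t in std_exp. 0 < t"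
proof -
  have "AE t in lborel. 0 < exponential_density 1 t \<longrightarrow> 0 < (t::real)"
    using AE_lborel_singleton[of "0::real"] by eventually_elim (auto simp: exponential_density_def split: if_splits)
  then show ?thesis unfolding std_exp_def by (subst AE_density) auto
qed

text \<open>Euler's integral for Gamma, read as the moment generating function of \<open>ln\<close>
  under the exponential law weighted by \<open>t ^ k\<close>.\<close>

lemma std_exp_powr:
  assumes "\<bar>s\<bar> < 1"
  shows "has_exp_mean (\<lambda>t. t ^ k * exp (s * ln t)) (Gamma (real k + 1 + s))"
proof (rule has_bochner_integral_nn_integral)
  show "AE t in std_exp. 0 \<le> t ^ k * exp (s * ln t)"
    using AE_std_exp_pos by eventually_elim simp
  show "0 \<le> Gamma (real k + 1 + s)" using assms by (intro less_imp_le[OF Gamma_real_pos]) auto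
  show "(\<lambda>t. t ^ k * exp (s * ln t)) \<in> borel_measurable std_exp" by measurable
  have "(\<integral>\<^sup>+t. ennreal (t ^ k * exp (s * ln t)) \<partial>std_exp)
    = (\<integral>\<^sup>+t. ennreal (exponential_density 1 t) * ennreal (t ^ k * exp (s * ln t)) \<partial>lborel)"
    unfolding std_exp_def by (rule nn_integral_density) measurable
  also have "\<dots> = (\<integral>\<^sup>+t. ennreal (indicator {0..} t * t powr ((real k + 1 + s) - 1) / exp t) \<partial>lborel)"
  proof (rule nn_integral_cong_AE, use AE_lborel_singleton[of "0::real"] in eventually_elim)
    case (elim t)
    show ?case
    proof (cases "0 < t")
      case True
      then have "t powr (real k + 1 + s - 1) = t ^ k * exp (s * ln t)"
        by (simp add: powr_add powr_realpow powr_def[of t s])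
      then show ?thesis using True
        by (simp add: exponential_density_def exp_minus divide_inverse mult_ac flip: ennreal_mult')
    qed (use elim in \<open>auto simp: exponential_density_def\<close>)
  qed
  also have "\<dots> = ennreal (Gamma (real k + 1 + s))"
    using assms by (subst Gamma_conv_nn_integral_real) auto
  finally show "(\<integral>\<^sup>+t. ennreal (t ^ k * exp (s * ln t)) \<partial>std_exp) = ennreal (Gamma (real k + 1 + s))" .
qed

text \<open>Under the weight \<open>t ^ k\<close> the generating function of \<open>ln\<close> is
  \<open>Gamma (z + s)\<close>. Its first two derivatives at \<open>s = 0\<close> are the moments,
  and Digamma and trigamma express them through the logarithmic derivative of Gamma.\<close>

lemma std_exp_moments:
  fixes k :: nat
  defines "z \<equiv> real k + 1"
  shows "has_exp_mean (\<lambda>t. t ^ k) (Gamma z)"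
    and "has_exp_mean (\<lambda>t. t ^ k * ln t) (Gamma z * Digamma z)"
    and "has_exp_mean (\<lambda>t. t ^ k * (ln t)\<^sup>2) (Gamma z * ((Digamma z)\<^sup>2 + Polygamma 1 z))"
proof -
  define M where "M = density std_exp (\<lambda>t. ennreal (t ^ k))"
  have [measurable_cong]: "sets M = sets borel" by (simp add: M_def)
  have M: "has_bochner_integral M f y \<longleftrightarrow> has_exp_mean (\<lambda>t. t ^ k * f t) y"
    if [measurable]: "f \<in> borel_measurable borel" for f :: "real \<Rightarrow> real" and y
  proof -
    have "AE t in std_exp. 0 \<le> t ^ k" using AE_std_exp_pos by eventually_elim simp
    then show ?thesis unfolding M_def has_bochner_integral_iff
      by (simp add: integrable_density integral_density)
  qed
  have z: "z + s \<notin> \<int>\<^sub>\<le>\<^sub>0" "0 < z + s" if "\<bar>s\<bar> < 1" for s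
  proof -
    show "0 < z + s" using that unfolding z_def by linarith
    then show "z + s \<notin> \<int>\<^sub>\<le>\<^sub>0" by (auto simp: nonpos_Ints_def)
  qed
  have mgf: "has_bochner_integral M (\<lambda>t. exp (s * ln t)) (Gamma (z + s))" if "\<bar>s\<bar> < 1" for s
    using std_exp_powr[OF that, of k] by (subst M) (auto simp: z_def)
  have d1: "((\<lambda>s. Gamma (z + s)) has_real_derivative Gamma (z + s) * Digamma (z + s)) (at s)" if "\<bar>s\<bar> < 1" for s
    using z[OF that] by (auto intro!: derivative_eq_intros)
  have d2: "((\<lambda>s. Gamma (z + s) * Digamma (z + s)) has_real_derivative Gamma z * ((Digamma z)\<^sup>2 + Polygamma 1 z)) (at 0)"
    using z[of 0] by (auto intro!: derivative_eq_intros simp: power2_eq_square algebra_simps)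
  have m: "has_bochner_integral M ln (Gamma (z + 0) * Digamma (z + 0))"
    "has_bochner_integral M (\<lambda>x. (ln x)\<^sup>2) (Gamma z * ((Digamma z)\<^sup>2 + Polygamma 1 z))"
    using moments_from_mgf[where X = ln and M = M and a = 1, OF _ _ mgf d1 d2] by (simp_all cong: measurable_cong_sets)
  show "has_exp_mean (\<lambda>t. t ^ k) (Gamma z)"
    using std_exp_powr[of 0 k] by (simp add: z_def)
  show "has_exp_mean (\<lambda>t. t ^ k * ln t) (Gamma z * Digamma z)"
    using m(1) by (subst (asm) M) auto
  show "has_exp_mean (\<lambda>t. t ^ k * (ln t)\<^sup>2) (Gamma z * ((Digamma z)\<^sup>2 + Polygamma 1 z))"
    using m(2) by (subst (asm) M) auto
qed

text \<open>The trigamma series at 1 is the Basel series; this is the origin of \<open>pi\<close> in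
  the distance formula.\<close>

lemma Polygamma_1_1: "Polygamma 1 (1::real) = pi\<^sup>2 / 6"
proof -
  have "(\<lambda>k. inverse ((1 + real k) ^ Suc 1)) sums ((-1) ^ Suc 1 * (- Polygamma 1 (1::real)) / fact 1 * (-1))"
    using Polygamma_LIMSEQ[of "1::real" 1] by simp
  moreover have "(\<lambda>k. inverse ((1 + real k) ^ Suc 1)) = (\<lambda>n. 1 / (real n + 1)\<^sup>2)"
    by (simp add: fun_eq_iff power2_eq_square divide_inverse add.commute)
  ultimately have "(\<lambda>n. 1 / (real n + 1)\<^sup>2) sums Polygamma 1 (1::real)" by simp
  moreover have "(\<lambda>n. 1 / (real n + 1)\<^sup>2) sums (pi\<^sup>2 / 6)"
    using inverse_squares_sums by (simp add: add.commute)
  ultimately show ?thesis by (rule sums_unique2)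
qed

section \<open>Moments of the score\<close>

text \<open>A standard exponential variable has mean 1 and its logarithm has mean
  \<open>- euler_mascheroni\<close>, so \<open>exp_c\<close> and \<open>ln_c\<close> are
  centred.\<close>

definition exp_c :: "real \<Rightarrow> real" where "exp_c t = t - 1"
definition ln_c :: "real \<Rightarrow> real" where "ln_c t = ln t + euler_mascheroni"
text \<open>The product \<open>exp_c t * ln_c t\<close> has mean 1. Subtracting it from
  \<open>t\<close> instead of 1 makes the difference uncorrelated with \<open>exp_c\<close> as well
  as centred.\<close>

definition res_c :: "real \<Rightarrow> real" where "res_c t = t - exp_c t * ln_c t"

text \<open>Every mean needed below is that of a polynomial of degree at most 2 in \<open>t\<close>
  and in \<open>ln t\<close>; the weights of the coefficients in \<open>y\<close> are the nine basic
  moments. Since \<open>f\<close> and \<open>y\<close> enter through equations, each instance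
  reduces to two algebraic identities.\<close>

lemma has_exp_mean_poly:
  fixes a :: "nat \<Rightarrow> real" and g :: real
  defines "g \<equiv> euler_mascheroni"
  assumes "\<And>t. f t = a 0 + a 1 * t + a 2 * t\<^sup>2 + (a 3 + a 4 * t + a 5 * t\<^sup>2) * ln t + (a 6 + a 7 * t + a 8 * t\<^sup>2) * (ln t)\<^sup>2"
    and "y = a 0 + a 1 + 2 * a 2 + (- g * a 3 + (1 - g) * a 4 + (3 - 2 * g) * a 5)
      + ((g\<^sup>2 + pi\<^sup>2 / 6) * a 6 + (g\<^sup>2 + pi\<^sup>2 / 6 - 2 * g) * a 7 + (2 - 6 * g + 2 * g\<^sup>2 + pi\<^sup>2 / 3) * a 8)"
  shows "has_exp_mean f y"
proof -
  have D: "Digamma (1::real) = - g" "Digamma (2::real) = 1 - g" "Digamma (3::real) = 3 / 2 - g"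
    using Digamma_plus1[of "1::real"] Digamma_plus1[of "2::real"] by (simp_all add: g_def)
  have P: "Polygamma 1 (1::real) = pi\<^sup>2 / 6" "Polygamma 1 (2::real) = pi\<^sup>2 / 6 - 1" "Polygamma 1 (3::real) = pi\<^sup>2 / 6 - 5 / 4"
    using Polygamma_plus1[of "1::real" 1] Polygamma_plus1[of "2::real" 1] Polygamma_1_1 by (simp_all add: power2_eq_square)
  have G: "Gamma (1::real) = 1" "Gamma (2::real) = 1" "Gamma (3::real) = 2"
    using Gamma_fact[of 0, where ?'a = real] Gamma_fact[of 1, where ?'a = real] Gamma_fact[of 2, where ?'a = real] by (simp_all add: fact_2)
  note m = std_exp_moments[of 0] std_exp_moments[of 1] std_exp_moments[of 2]
  have m0: "has_exp_mean (\<lambda>t. 1) (1::real)" "has_exp_mean (\<lambda>t. t) 1"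
     "has_exp_mean (\<lambda>t. t\<^sup>2) 2"
    using m(1,4,7) by (simp_all add: G)
  have m1: "has_exp_mean (\<lambda>t. ln t) (- g)" "has_exp_mean (\<lambda>t. t * ln t) (1 - g)"
     "has_exp_mean (\<lambda>t. t\<^sup>2 * ln t) (3 - 2 * g)"
    using m(2,5,8) by (simp_all add: G D flip: g_def)
  have m2: "has_exp_mean (\<lambda>t. (ln t)\<^sup>2) (g\<^sup>2 + pi\<^sup>2 / 6)"
     "has_exp_mean (\<lambda>t. t * (ln t)\<^sup>2) ((1 - g)\<^sup>2 + (pi\<^sup>2 / 6 - 1))"
     "has_exp_mean (\<lambda>t. t\<^sup>2 * (ln t)\<^sup>2) (2 * ((3 / 2 - g)\<^sup>2 + (pi\<^sup>2 / 6 - 5 / 4)))"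
    using m(3,6,9) by (simp_all add: G D P[unfolded One_nat_def] flip: g_def)
  have "has_exp_mean (\<lambda>t. a 0 * 1 + a 1 * t + a 2 * t\<^sup>2 + (a 3 * ln t + a 4 * (t * ln t) + a 5 * (t\<^sup>2 * ln t))
      + (a 6 * (ln t)\<^sup>2 + a 7 * (t * (ln t)\<^sup>2) + a 8 * (t\<^sup>2 * (ln t)\<^sup>2)))
    (a 0 * 1 + a 1 * 1 + a 2 * 2 + (a 3 * (- g) + a 4 * (1 - g) + a 5 * (3 - 2 * g))
      + (a 6 * (g\<^sup>2 + pi\<^sup>2 / 6) + a 7 * ((1 - g)\<^sup>2 + (pi\<^sup>2 / 6 - 1)) + a 8 * (2 * ((3 / 2 - g)\<^sup>2 + (pi\<^sup>2 / 6 - 5 / 4)))))"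
    by (intro has_bochner_integral_add has_bochner_integral_mult_right m0 m1 m2)
  moreover have "f = (\<lambda>t. a 0 * 1 + a 1 * t + a 2 * t\<^sup>2 + (a 3 * ln t + a 4 * (t * ln t) + a 5 * (t\<^sup>2 * ln t))
      + (a 6 * (ln t)\<^sup>2 + a 7 * (t * (ln t)\<^sup>2) + a 8 * (t\<^sup>2 * (ln t)\<^sup>2)))"
    using assms(2) by (simp add: fun_eq_iff algebra_simps)
  moreover have "y = a 0 * 1 + a 1 * 1 + a 2 * 2 + (a 3 * (- g) + a 4 * (1 - g) + a 5 * (3 - 2 * g))
      + (a 6 * (g\<^sup>2 + pi\<^sup>2 / 6) + a 7 * ((1 - g)\<^sup>2 + (pi\<^sup>2 / 6 - 1)) + a 8 * (2 * ((3 / 2 - g)\<^sup>2 + (pi\<^sup>2 / 6 - 5 / 4))))"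
    unfolding assms(3) by (simp add: power2_eq_square field_simps)
  ultimately show ?thesis by (simp only:)
qed

text \<open>Euler's constant cancels throughout because of the centring. The vanishing mean of
  \<open>exp_c t * res_c t\<close> is what later separates the \<tau> direction from the linear part
  of the score.\<close>

lemma std_exp_centred_moments:
  shows "has_exp_mean exp_c 0" "has_exp_mean ln_c 0"
    "has_exp_mean res_c 0"
    "has_exp_mean (\<lambda>t. exp_c t * exp_c t) 1"
    "has_exp_mean (\<lambda>t. exp_c t * ln_c t) 1"
    "has_exp_mean (\<lambda>t. ln_c t * ln_c t) (pi\<^sup>2 / 6)"
    "has_exp_mean (\<lambda>t. exp_c t * res_c t) 0"
    "has_exp_mean (\<lambda>t. res_c t * res_c t) (pi\<^sup>2 / 6)"
    "has_exp_mean (\<lambda>t. res_c t * ln_c t) 1"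
    "has_exp_mean (\<lambda>t. 1) (1::real)"
proof -
  let ?g = "euler_mascheroni :: real"
  note c = exp_c_def ln_c_def res_c_def algebra_simps eval_nat_numeral
  show "has_exp_mean exp_c 0"
    by (rule has_exp_mean_poly[of _ "\<lambda>i. [-1, 1, 0, 0, 0, 0, 0, 0, 0] ! i"])
      (simp_all add: c)
  show "has_exp_mean ln_c 0"
    by (rule has_exp_mean_poly[of _ "\<lambda>i. [?g, 0, 0, 1, 0, 0, 0, 0, 0] ! i"])
      (simp_all add: c)
  show "has_exp_mean res_c 0"
    by (rule has_exp_mean_poly[of _ "\<lambda>i. [?g, 1 - ?g, 0, 1, -1, 0, 0, 0, 0] ! i"])
      (simp_all add: c)
  show "has_exp_mean (\<lambda>t. exp_c t * exp_c t) 1"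
    by (rule has_exp_mean_poly[of _ "\<lambda>i. [1, -2, 1, 0, 0, 0, 0, 0, 0] ! i"])
      (simp_all add: c)
  show "has_exp_mean (\<lambda>t. exp_c t * ln_c t) 1"
    by (rule has_exp_mean_poly[of _ "\<lambda>i. [- ?g, ?g, 0, -1, 1, 0, 0, 0, 0] ! i"])
      (simp_all add: c)
  show "has_exp_mean (\<lambda>t. ln_c t * ln_c t) (pi\<^sup>2 / 6)"
    by (rule has_exp_mean_poly[of _ "\<lambda>i. [?g\<^sup>2, 0, 0, 2 * ?g, 0, 0, 1, 0, 0] ! i"])
      (simp_all add: c)
  show "has_exp_mean (\<lambda>t. exp_c t * res_c t) 0"
    by (rule has_exp_mean_poly[of _ "\<lambda>i. [- ?g, 2 * ?g - 1, 1 - ?g, -1, 2, -1, 0, 0, 0] ! i"])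
      (simp_all add: c)
  show "has_exp_mean (\<lambda>t. res_c t * res_c t) (pi\<^sup>2 / 6)"
    by (rule has_exp_mean_poly[of _ "\<lambda>i. [?g\<^sup>2, 2 * ?g * (1 - ?g), (1 - ?g)\<^sup>2, 2 * ?g, 2 * (1 - ?g) - 2 * ?g, - 2 * (1 - ?g), 1, -2, 1] ! i"])
      (simp_all add: c)
  show "has_exp_mean (\<lambda>t. res_c t * ln_c t) 1"
    by (rule has_exp_mean_poly[of _ "\<lambda>i. [?g\<^sup>2, ?g - ?g\<^sup>2, 0, 2 * ?g, 1 - 2 * ?g, 0, 1, -1, 0] ! i"])
      (simp_all add: c)
  show "has_exp_mean (\<lambda>t. 1) (1::real)"
    by (rule has_exp_mean_poly[of _ "\<lambda>i. [1, 0, 0, 0, 0, 0, 0, 0, 0] ! i"])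
      (simp_all add: c)
qed

lemma has_vec_mean_prod:
  assumes "\<And>n. n \<in> {1..K} \<Longrightarrow> has_exp_mean (f n) (I n)"
  shows "has_vec_mean K (\<lambda>x. \<Prod>n=1..K. f n (x n)) (\<Prod>n=1..K. I n :: real)"
proof -
  interpret std_exp: prob_space std_exp by (rule prob_space_std_exp)
  interpret product_sigma_finite "\<lambda>_::nat. std_exp" by standard
  have "integrable std_exp (f n)" "integral\<^sup>L std_exp (f n) = I n" if "n \<in> {1..K}" for n
    using assms[OF that] by (simp_all add: has_bochner_integral_iff)
  then show ?thesis unfolding exp_vector_def has_bochner_integral_iff
    using product_integrable_prod[of "{1..K}" f] product_integral_prod[of "{1..K}" f] by simp
qed

text \<open>By independence each mean is a product over the coordinates, and it vanishes as soon as
  one coordinate carries a factor of mean 0. Two off-diagonal pairs interact only if they are equal,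
  giving the variance of \<open>ln_c\<close>, or transposed, giving the square of the covariance 1
  of \<open>exp_c\<close> and \<open>ln_c\<close>.\<close>

lemma exp_vector_cross_moments:
  assumes i: "i \<in> {1..K}" and k: "k \<in> {1..K}"
  shows "has_vec_mean K (\<lambda>x. exp_c (x i) * exp_c (x k)) (if i = k then 1 else 0)" (is ?A)
    and "has_vec_mean K (\<lambda>x. res_c (x i) * res_c (x k)) (if i = k then pi\<^sup>2 / 6 else 0)" (is ?B)
    and "has_vec_mean K (\<lambda>x. exp_c (x i) * res_c (x k)) 0" (is ?C)
    and "\<And>j. j \<in> {1..K} \<Longrightarrow> i \<noteq> j \<Longrightarrow>
      has_vec_mean K (\<lambda>x. exp_c (x k) * (exp_c (x i) * ln_c (x j))) 0"
    and "\<And>j. j \<in> {1..K} \<Longrightarrow> i \<noteq> j \<Longrightarrow>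
      has_vec_mean K (\<lambda>x. res_c (x k) * (exp_c (x i) * ln_c (x j))) 0"
    and "\<And>j m. j \<in> {1..K} \<Longrightarrow> m \<in> {1..K} \<Longrightarrow> i \<noteq> j \<Longrightarrow> k \<noteq> m \<Longrightarrow>
      has_vec_mean K (\<lambda>x. (exp_c (x i) * ln_c (x j)) * (exp_c (x k) * ln_c (x m)))
        (if k = i \<and> m = j then pi\<^sup>2 / 6 else if k = j \<and> m = i then 1 else 0)"
proof -
  note m = std_exp_centred_moments
  have m' : "has_exp_mean (\<lambda>t. ln_c t * exp_c t) 1" "has_exp_mean (\<lambda>t. res_c t * exp_c t) 0"
    using m(5,7) by (simp_all add: mult.commute)
  have p0: "(\<Prod>n=1..K. I n) = (0::real)" if "n \<in> {1..K}" "I n = 0" for n and I :: "nat \<Rightarrow> real"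
    using that by (intro prod_zero) auto
  have pd: "(\<Prod>n=1..K. if n = i then g n else (1::real)) = g i" if "i \<in> {1..K}" for i and g :: "nat \<Rightarrow> real"
    using that by (simp add: prod.delta)
  \<comment> \<open>A function of one coordinate, padded by the constant 1 elsewhere, so that every
    integrand becomes a full product over the coordinates.\<close>
  define d1 :: "nat \<Rightarrow> nat \<Rightarrow> (real \<Rightarrow> real) \<Rightarrow> real \<Rightarrow> real" where "d1 n i g t = (if n = i then g t else 1)" for n i g t
  have pd1: "(\<Prod>n=1..K. d1 n i g (x n)) = g (x i)" if "i \<in> {1..K}" for i g and x :: "nat \<Rightarrow> real"
    unfolding d1_def by (rule pd[OF that, of "\<lambda>n. g (x n)"])
  have two: "has_vec_mean K (\<lambda>x. g (x i) * h (x k)) (\<Prod>n=1..K. I n)"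
    if "\<And>n. n \<in> {1..K} \<Longrightarrow> has_exp_mean (\<lambda>t. d1 n i g t * d1 n k h t) (I n)" for g h I
    using has_vec_mean_prod[of K "\<lambda>n t. d1 n i g t * d1 n k h t" I, OF that]
    unfolding prod.distrib pd1[OF i] pd1[OF k] .
  have three: "has_vec_mean K (\<lambda>x. g (x k) * (exp_c (x i) * ln_c (x j))) (\<Prod>n=1..K. I n)"
    if "j \<in> {1..K}" "\<And>n. n \<in> {1..K} \<Longrightarrow> has_exp_mean (\<lambda>t. d1 n k g t * (d1 n i exp_c t * d1 n j ln_c t)) (I n)" for g j I
    using has_vec_mean_prod[of K "\<lambda>n t. d1 n k g t * (d1 n i exp_c t * d1 n j ln_c t)" I, OF that(2)]
    unfolding prod.distrib pd1[OF i] pd1[OF k] pd1[OF that(1)] .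
  have four: "has_vec_mean K (\<lambda>x. (exp_c (x i) * ln_c (x j)) * (exp_c (x k) * ln_c (x m))) (\<Prod>n=1..K. I n)"
    if "j \<in> {1..K}" "m \<in> {1..K}" "\<And>n. n \<in> {1..K} \<Longrightarrow>
      has_exp_mean (\<lambda>t. (d1 n i exp_c t * d1 n j ln_c t) * (d1 n k exp_c t * d1 n m ln_c t)) (I n)" for j m I
    using has_vec_mean_prod[of K
        "\<lambda>n t. (d1 n i exp_c t * d1 n j ln_c t) * (d1 n k exp_c t * d1 n m ln_c t)" I, OF that(3)]
    unfolding prod.distrib pd1[OF i] pd1[OF k] pd1[OF that(1)] pd1[OF that(2)] .
  show ?A
  proof -
    have "has_vec_mean K (\<lambda>x. exp_c (x i) * exp_c (x k))
      (\<Prod>n=1..K. if n = i \<and> n = k then 1 else if n = i \<or> n = k then 0 else 1)"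
      by (rule two) (use m in \<open>auto simp: d1_def\<close>)
    also have "(\<Prod>n=1..K. if n = i \<and> n = k then 1 else if n = i \<or> n = k then 0 else 1) = (if i = k then 1 else 0 :: real)"
    proof (cases "i = k")
      case True
      then have "(\<Prod>n=1..K. if n = i \<and> n = k then 1 else if n = i \<or> n = k then 0 else 1) = (\<Prod>n=1..K. if n = i then 1 else (1::real))"
        by (intro prod.cong) auto
      then show ?thesis using pd[OF i, of "\<lambda>_. 1"] True by (simp only: if_True simp_thms)
    next
      case False
      then show ?thesis using p0[OF i, of "\<lambda>n. if n = i \<and> n = k then 1 else if n = i \<or> n = k then 0 else 1"]
        by (simp del: prod_zero_iff)
    qed
    finally show ?thesis .
  qed
  show ?B
  proof -
    have "has_vec_mean K (\<lambda>x. res_c (x i) * res_c (x k))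
      (\<Prod>n=1..K. if n = i \<and> n = k then pi\<^sup>2 / 6 else if n = i \<or> n = k then 0 else 1)"
      by (rule two) (use m in \<open>auto simp: d1_def\<close>)
    also have "(\<Prod>n=1..K. if n = i \<and> n = k then pi\<^sup>2 / 6 else if n = i \<or> n = k then 0 else 1) = (if i = k then pi\<^sup>2 / 6 else 0 :: real)"
    proof (cases "i = k")
      case True
      then have "(\<Prod>n=1..K. if n = i \<and> n = k then pi\<^sup>2 / 6 else if n = i \<or> n = k then 0 else 1) = (\<Prod>n=1..K. if n = i then pi\<^sup>2 / 6 else (1::real))"
        by (intro prod.cong) auto
      then show ?thesis using pd[OF i, of "\<lambda>_. pi\<^sup>2 / 6"] True by (simp only: if_True simp_thms)
    next
      case False
      then show ?thesis using p0[OF i, of "\<lambda>n. if n = i \<and> n = k then pi\<^sup>2 / 6 else if n = i \<or> n = k then 0 else 1"]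
        by (simp del: prod_zero_iff)
    qed
    finally show ?thesis .
  qed
  show ?C
  proof -
    have "has_vec_mean K (\<lambda>x. exp_c (x i) * res_c (x k))
      (\<Prod>n=1..K. if n = i \<or> n = k then 0 else 1)"
      by (rule two) (cases "i = k"; use m in \<open>auto simp: d1_def\<close>)
    moreover have "(\<Prod>n=1..K. if n = i \<or> n = k then 0 else (1::real)) = 0" by (rule p0[OF i]) simp
    ultimately show ?thesis by (simp only:)
  qed
  show "has_vec_mean K (\<lambda>x. exp_c (x k) * (exp_c (x i) * ln_c (x j))) 0" if j: "j \<in> {1..K}" "i \<noteq> j" for j
  proof -
    let ?I = "\<lambda>n. if n = k \<and> (n = i \<or> n = j) then 1 else if n = k \<or> n = i \<or> n = j then 0 else (1::real)"
    have "has_vec_mean K (\<lambda>x. exp_c (x k) * (exp_c (x i) * ln_c (x j))) (\<Prod>n=1..K. ?I n)"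
      by (rule three) (use m m' j in \<open>auto simp: d1_def\<close>)
    moreover have "(\<Prod>n=1..K. ?I n) = 0"
      using p0[OF i, of ?I] p0[OF j(1), of ?I] j(2) by (cases "k = i") (simp_all del: prod_zero_iff)
    ultimately show ?thesis by (simp only:)
  qed
  show "has_vec_mean K (\<lambda>x. res_c (x k) * (exp_c (x i) * ln_c (x j))) 0" if j: "j \<in> {1..K}" "i \<noteq> j" for j
  proof -
    let ?I = "\<lambda>n. if n = k \<and> n = j then 1 else if n = k \<or> n = i \<or> n = j then 0 else (1::real)"
    have "has_vec_mean K (\<lambda>x. res_c (x k) * (exp_c (x i) * ln_c (x j))) (\<Prod>n=1..K. ?I n)"
      by (rule three[OF j(1)]) (cases "i = k"; use m m' j in \<open>auto simp: d1_def\<close>)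
    moreover have "(\<Prod>n=1..K. ?I n) = 0"
      using p0[OF i, of ?I] j(2) by (simp del: prod_zero_iff)
    ultimately show ?thesis by (simp only:)
  qed
  show "has_vec_mean K (\<lambda>x. (exp_c (x i) * ln_c (x j)) * (exp_c (x k) * ln_c (x m)))
        (if k = i \<and> m = j then pi\<^sup>2 / 6 else if k = j \<and> m = i then 1 else 0)"
    if j: "j \<in> {1..K}" "m \<in> {1..K}" "i \<noteq> j" "k \<noteq> m" for j m
  proof -
    \<comment> \<open>The mean of the factor at coordinate \<open>n\<close>: squares of
      \<open>exp_c\<close> and of \<open>ln_c\<close>, the mixed product, a single centred factor,
      and the empty product, in this order.\<close>
    let ?I = "\<lambda>n. if n = i \<and> n = k then 1 else if n = j \<and> n = m then pi\<^sup>2 / 6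
      else if n = i \<and> n = m \<or> n = j \<and> n = k then 1 else if n = i \<or> n = j \<or> n = k \<or> n = m then 0 else (1::real)"
    have "has_vec_mean K (\<lambda>x. (exp_c (x i) * ln_c (x j)) * (exp_c (x k) * ln_c (x m))) (\<Prod>n=1..K. ?I n)"
      by (rule four) (use m m' j in \<open>auto simp: d1_def\<close>)
    moreover have "(\<Prod>n=1..K. ?I n) = (if k = i \<and> m = j then pi\<^sup>2 / 6 else if k = j \<and> m = i then 1 else 0)"
    proof -
      consider "k = i" "m = j" | "k = j" "m = i" | "k = i" "m \<noteq> j" | "k = j" "m \<noteq> i" | "k \<noteq> i" "k \<noteq> j" by blast
      then show ?thesis
      proof cases
        case 1
        then have "(\<Prod>n=1..K. ?I n) = (\<Prod>n=1..K. if n = j then pi\<^sup>2 / 6 else 1)"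
          using j by (intro prod.cong) auto
        also have "\<dots> = pi\<^sup>2 / 6" by (rule pd[OF j(1)])
        finally show ?thesis using 1 by simp
      next
        case 2
        then have "(\<Prod>n=1..K. ?I n) = (\<Prod>n=1..K. 1)"
          using j by (intro prod.cong) auto
        then show ?thesis using 2 j by simp
      next
        case 3
        then show ?thesis using p0[OF j(1), of ?I] j by (simp del: prod_zero_iff)
      next
        case 4
        then show ?thesis using p0[OF i, of ?I] j by (simp del: prod_zero_iff)
      next
        case 5
        then show ?thesis using p0[OF k, of ?I] j by (simp del: prod_zero_iff)
      qed
    qed
    ultimately show ?thesis by (simp only:)
  qed
qed

text \<open>The part of S times the score that is proportional to the relative velocity of \<tau>,
  arranged into one-variable terms and products over two distinct indices. In this form its two
  parts are uncorrelated with each other and with every linear form in the \<open>exp_c\<close>; the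
  closed form is in \<open>ln_sum_c_eq\<close>.\<close>

definition ln_sum_c :: "nat \<Rightarrow> (nat \<Rightarrow> real) \<Rightarrow> real" where
  "ln_sum_c K x = (real K - 1) * (\<Sum>i=1..K. res_c (x i))
    + (\<Sum>p\<in>{p\<in>{1..K} \<times> {1..K}. fst p \<noteq> snd p}. exp_c (x (fst p)) * ln_c (x (snd p)))"

lemma card_off_diagonal: "real (card {p \<in> {1..K} \<times> {1..K}. fst p \<noteq> snd p}) = real K * (real K - 1)"
proof -
  have "{1..K} \<times> {1..K} = {p \<in> {1..K} \<times> {1..K}. fst p \<noteq> snd p} \<union> (\<lambda>i. (i, i)) ` {1..K}" by auto
  then have "card ({1..K} \<times> {1..K}) = card ({p \<in> {1..K} \<times> {1..K}. fst p \<noteq> snd p} \<union> (\<lambda>i. (i, i)) ` {1..K})" by simp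
  also have "\<dots> = card {p \<in> {1..K} \<times> {1..K}. fst p \<noteq> snd p} + card ((\<lambda>i. (i, i)) ` {1..K})"
    by (intro card_Un_disjoint) auto
  also have "card ((\<lambda>i. (i, i)) ` {1..K}) = K" by (subst card_image) (auto simp: inj_on_def)
  finally have "real (K * K) = real (card {p \<in> {1..K} \<times> {1..K}. fst p \<noteq> snd p} + K)" by (simp add: card_cartesian_product)
  then show ?thesis by (simp add: algebra_simps)
qed

text \<open>Only squares of like parts survive. The one-variable part of \<open>ln_sum_c\<close>
  contributes (K - 1)^2 K pi^2 / 6 and the off-diagonal part K (K - 1) (pi^2 / 6 + 1), which add up
  to the stated factor.\<close>

lemma exp_vector_score_moment:
  fixes c c' :: "nat \<Rightarrow> real"
  shows "has_vec_mean K
    (\<lambda>x. ((\<Sum>i=1..K. c i * exp_c (x i)) + r * ln_sum_c K x) * ((\<Sum>i=1..K. c' i * exp_c (x i)) + r' * ln_sum_c K x))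
    ((\<Sum>i=1..K. c i * c' i) + r * r' * (real K * (real K - 1) * (real K * pi\<^sup>2 / 6 + 1)))"
proof -
  let ?M = "exp_vector K"
  let ?P = "{p\<in>{1..K} \<times> {1..K}. fst p \<noteq> snd p}"
  define A where "A c x = (\<Sum>i=1..K. c i * exp_c (x i))" for c x :: "nat \<Rightarrow> real"
  define Q where "Q x = (\<Sum>i=1..K. res_c (x i))" for x :: "nat \<Rightarrow> real"
  define D where "D x = (\<Sum>p\<in>?P. exp_c (x (fst p)) * ln_c (x (snd p)))" for x :: "nat \<Rightarrow> real"
  note cm = exp_vector_cross_moments
  have finP: "finite ?P" by (rule finite_subset[of _ "{1..K} \<times> {1..K}"]) auto
  have AA: "has_bochner_integral ?M (\<lambda>x. A c x * A c' x) (\<Sum>i=1..K. c i * c' i)" for c c'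
  proof -
    have "has_bochner_integral ?M (\<lambda>x. \<Sum>i=1..K. \<Sum>j=1..K. (c i * c' j) * (exp_c (x i) * exp_c (x j)))
      (\<Sum>i=1..K. \<Sum>j=1..K. (c i * c' j) * (if i = j then 1 else 0))"
      by (intro has_bochner_integral_sum has_bochner_integral_mult_right cm)
    moreover have "(\<lambda>x. A c x * A c' x) = (\<lambda>x. \<Sum>i=1..K. \<Sum>j=1..K. (c i * c' j) * (exp_c (x i) * exp_c (x j)))"
      unfolding A_def sum_product by (simp add: mult_ac)
    moreover have "(\<Sum>i=1..K. \<Sum>j=1..K. (c i * c' j) * (if i = j then 1 else 0)) = (\<Sum>i=1..K. c i * c' i)"
      by (intro sum.cong refl) (simp add: if_distrib[of "\<lambda>t. _ * t"] cong: if_cong)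
    ultimately show ?thesis by (simp only:)
  qed
  have QQ: "has_bochner_integral ?M (\<lambda>x. Q x * Q x) (real K * (pi\<^sup>2 / 6))"
  proof -
    have "has_bochner_integral ?M (\<lambda>x. \<Sum>i=1..K. \<Sum>j=1..K. res_c (x i) * res_c (x j))
      (\<Sum>i=1..K. \<Sum>j=1..K. (if i = j then pi\<^sup>2 / 6 else 0))"
      by (intro has_bochner_integral_sum cm)
    moreover have "(\<Sum>i=1..K. \<Sum>j=1..K. (if i = j then pi\<^sup>2 / 6 else 0)) = real K * (pi\<^sup>2 / 6)" by simp
    ultimately show ?thesis unfolding Q_def sum_product by (simp only:)
  qed
  have AQ: "has_bochner_integral ?M (\<lambda>x. A c x * Q x) 0" for c
  proof -
    have "has_bochner_integral ?M (\<lambda>x. \<Sum>i=1..K. \<Sum>j=1..K. c i * (exp_c (x i) * res_c (x j)))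
      (\<Sum>i=1..K. \<Sum>j=1..K. c i * 0)"
      by (intro has_bochner_integral_sum has_bochner_integral_mult_right cm)
    then show ?thesis unfolding A_def Q_def sum_product by (simp add: mult_ac)
  qed
  have AD: "has_bochner_integral ?M (\<lambda>x. A c x * D x) 0" for c
  proof -
    have "has_bochner_integral ?M (\<lambda>x. \<Sum>i=1..K. \<Sum>p\<in>?P. c i * (exp_c (x i) * (exp_c (x (fst p)) * ln_c (x (snd p)))))
      (\<Sum>i=1..K. \<Sum>p\<in>?P. c i * 0)"
      by (intro has_bochner_integral_sum has_bochner_integral_mult_right cm) auto
    then show ?thesis unfolding A_def D_def sum_product by (simp add: mult_ac)
  qed
  have QD: "has_bochner_integral ?M (\<lambda>x. Q x * D x) 0"
  proof -
    have "has_bochner_integral ?M (\<lambda>x. \<Sum>i=1..K. \<Sum>p\<in>?P. (res_c (x i) * (exp_c (x (fst p)) * ln_c (x (snd p)))))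
      (\<Sum>i=1..K. \<Sum>p\<in>?P. 0)"
      by (intro has_bochner_integral_sum cm) auto
    then show ?thesis unfolding Q_def D_def sum_product by simp
  qed
  have DD: "has_bochner_integral ?M (\<lambda>x. D x * D x) (real K * (real K - 1) * (pi\<^sup>2 / 6 + 1))"
  proof -
    have "has_bochner_integral ?M (\<lambda>x. \<Sum>p\<in>?P. \<Sum>q\<in>?P. (exp_c (x (fst p)) * ln_c (x (snd p))) * (exp_c (x (fst q)) * ln_c (x (snd q))))
      (\<Sum>p\<in>?P. \<Sum>q\<in>?P. if fst q = fst p \<and> snd q = snd p then pi\<^sup>2 / 6 else if fst q = snd p \<and> snd q = fst p then 1 else 0)"
      by (intro has_bochner_integral_sum cm) auto
    moreover have "(\<Sum>q\<in>?P. if fst q = fst p \<and> snd q = snd p then pi\<^sup>2 / 6 else if fst q = snd p \<and> snd q = fst p then 1 else 0)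
      = pi\<^sup>2 / 6 + 1" if p: "p \<in> ?P" for p
    proof -
      \<comment> \<open>Besides \<open>p\<close> itself only its transpose contributes; these are
        two different elements because \<open>p\<close> is off the diagonal.\<close>
      have "(\<Sum>q\<in>?P. if fst q = fst p \<and> snd q = snd p then pi\<^sup>2 / 6 else if fst q = snd p \<and> snd q = fst p then 1 else 0)
        = (\<Sum>q\<in>?P. (if q = p then pi\<^sup>2 / 6 else 0) + (if q = (snd p, fst p) then 1 else 0))"
        using p by (intro sum.cong) (auto simp: prod_eq_iff)
      also have "\<dots> = pi\<^sup>2 / 6 + 1" using p finP by (auto simp: sum.distrib)
      finally show ?thesis .
    qed
    then have "(\<Sum>p\<in>?P. \<Sum>q\<in>?P. if fst q = fst p \<and> snd q = snd p then pi\<^sup>2 / 6 else if fst q = snd p \<and> snd q = fst p then 1 else 0)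
      = (\<Sum>p\<in>?P. pi\<^sup>2 / 6 + 1)" by (rule sum.cong[OF refl])
    ultimately have "has_bochner_integral ?M (\<lambda>x. \<Sum>p\<in>?P. \<Sum>q\<in>?P. (exp_c (x (fst p)) * ln_c (x (snd p))) * (exp_c (x (fst q)) * ln_c (x (snd q))))
      (\<Sum>p\<in>?P. pi\<^sup>2 / 6 + 1)" by (simp only:)
    then show ?thesis unfolding D_def sum_product using card_off_diagonal[of K] by simp
  qed
  have V: "ln_sum_c K x = (real K - 1) * Q x + D x" for x unfolding ln_sum_c_def Q_def D_def ..
  let ?f = "\<lambda>x. A c x * A c' x + (r' * (real K - 1)) * (A c x * Q x) + r' * (A c x * D x)
     + (r * (real K - 1)) * (A c' x * Q x) + r * (A c' x * D x)
     + (r * r' * (real K - 1)\<^sup>2) * (Q x * Q x) + (2 * r * r' * (real K - 1)) * (Q x * D x) + (r * r') * (D x * D x)"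
  let ?I = "(\<Sum>i=1..K. c i * c' i) + (r' * (real K - 1)) * 0 + r' * 0 + (r * (real K - 1)) * 0 + r * 0
     + (r * r' * (real K - 1)\<^sup>2) * (real K * (pi\<^sup>2 / 6)) + (2 * r * r' * (real K - 1)) * 0
     + (r * r') * (real K * (real K - 1) * (pi\<^sup>2 / 6 + 1))"
  have "has_bochner_integral ?M ?f
    ?I"
    by (intro has_bochner_integral_add has_bochner_integral_mult_right AA AQ AD QQ QD DD)
  moreover have "?f
    = (\<lambda>x. (A c x + r * ln_sum_c K x) * (A c' x + r' * ln_sum_c K x))"
    unfolding V by (simp add: fun_eq_iff power2_eq_square algebra_simps)
  moreover have "?I
    = (\<Sum>i=1..K. c i * c' i) + r * r' * (real K * (real K - 1) * (real K * pi\<^sup>2 / 6 + 1))"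
    by (simp add: power2_eq_square field_simps)
  ultimately show ?thesis unfolding A_def by (simp only:)
qed

section \<open>The score and the Fisher information\<close>

lemma eventually_pos_if_isCont:
  fixes f :: "real \<Rightarrow> real"
  assumes "isCont f t" "0 < f t"
  shows "\<forall>\<^sub>F u in nhds t. 0 < f u"
  using assms order_tendstoD(1)[of f "f t" "nhds t" 0] by (simp add: isCont_def tendsto_at_iff_tendsto_nhds)

text \<open>Writing the powers as \<open>exp (- \<tau> * ln (x j))\<close> exposes the dependence on
  \<tau> to elementary differentiation.\<close>

lemma ln_concrete_density:
  assumes "1 \<le> K" "\<And>i. i \<in> {1..K} \<Longrightarrow> 0 < \<beta> i" "\<And>i. i \<in> {1..K} \<Longrightarrow> 0 < x i" "0 < \<tau>"
  shows "ln (concrete_density K \<beta> \<tau> x) = ln (fact (K - 1)) + real (K - 1) * ln \<tau>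
    - real K * ln (\<Sum>j=1..K. \<beta> j * exp (- \<tau> * ln (x j))) + (\<Sum>i=1..K. ln (\<beta> i) - (\<tau> + 1) * ln (x i))"
proof -
  have e: "\<beta> j / x j powr \<tau> = \<beta> j * exp (- \<tau> * ln (x j))" if "j \<in> {1..K}" for j
    using assms(3)[OF that] by (simp add: powr_def exp_minus divide_inverse)
  define A where "A = (\<Sum>j=1..K. \<beta> j * exp (- \<tau> * ln (x j)))"
  have A: "0 < A" unfolding A_def using assms by (intro sum_pos) auto
  have A': "(\<Sum>j=1..K. \<beta> j / x j powr \<tau>) = A" unfolding A_def by (intro sum.cong e refl)
  have p: "0 < \<beta> i / x i powr (\<tau> + 1)" if "i \<in> {1..K}" for i using assms(2,3)[OF that] by simp
  have "ln (\<Prod>i=1..K. \<beta> i / x i powr (\<tau> + 1)) = (\<Sum>i=1..K. ln (\<beta> i / x i powr (\<tau> + 1)))"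
    by (rule ln_prod) (blast intro: p | metis p less_irrefl)+
  also have "\<dots> = (\<Sum>i=1..K. ln (\<beta> i) - (\<tau> + 1) * ln (x i))"
  proof (intro sum.cong refl)
    fix i assume "i \<in> {1..K}"
    then show "ln (\<beta> i / x i powr (\<tau> + 1)) = ln (\<beta> i) - (\<tau> + 1) * ln (x i)"
      using assms(2)[of i] assms(3)[of i] by (simp add: ln_div ln_powr)
  qed
  finally have P: "ln (\<Prod>i=1..K. \<beta> i / x i powr (\<tau> + 1)) = (\<Sum>i=1..K. ln (\<beta> i) - (\<tau> + 1) * ln (x i))" .
  have P0: "0 < (\<Prod>i=1..K. \<beta> i / x i powr (\<tau> + 1))" using p by (intro prod_pos) auto
  show ?thesis unfolding concrete_density_def A' A_def[symmetric] P[symmetric]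
    using A assms(4) less_imp_neq[OF P0, symmetric] by (subst ln_mult) (simp_all add: ln_mult ln_div ln_realpow)
qed

text \<open>\<open>b\<close> and \<open>s\<close> are the velocities of the weights and of \<tau>.
  The weights are not assumed normalised here, so the constraint enters only through the choice of
  \<open>b\<close>.\<close>

definition log_density_deriv :: "nat \<Rightarrow> (nat \<Rightarrow> real) \<Rightarrow> real \<Rightarrow> (nat \<Rightarrow> real) \<Rightarrow> real \<Rightarrow> (nat \<Rightarrow> real) \<Rightarrow> real" where
  "log_density_deriv K \<beta> \<tau> b s x = real (K - 1) * (s / \<tau>)
    - real K * ((\<Sum>j=1..K. (b j - \<beta> j * s * ln (x j)) * exp (- \<tau> * ln (x j))) / (\<Sum>j=1..K. \<beta> j * exp (- \<tau> * ln (x j))))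
    + (\<Sum>i=1..K. b i / \<beta> i - s * ln (x i))"

lemma ln_concrete_density_has_derivative:
  fixes \<beta> :: "real \<Rightarrow> nat \<Rightarrow> real" and \<tau> :: "real \<Rightarrow> real"
  assumes K: "1 \<le> K" and x: "\<And>i. i \<in> {1..K} \<Longrightarrow> 0 < x i"
    and \<beta>: "\<And>i. i \<in> {1..K} \<Longrightarrow> 0 < \<beta> t i" "\<And>i. i \<in> {1..K} \<Longrightarrow> ((\<lambda>u. \<beta> u i) has_real_derivative b i) (at t)"
    and \<tau>: "0 < \<tau> t" "(\<tau> has_real_derivative s) (at t)"
  shows "((\<lambda>u. ln (concrete_density K (\<beta> u) (\<tau> u) x)) has_real_derivative
    log_density_deriv K (\<beta> t) (\<tau> t) b s x) (at t)"
proof -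
  define A where "A = (\<lambda>u. \<Sum>j=1..K. \<beta> u j * exp (- \<tau> u * ln (x j)))"
  have A: "0 < A t" unfolding A_def using \<beta>(1) K by (intro sum_pos) auto
  have dA: "(A has_real_derivative (\<Sum>j=1..K. (b j - \<beta> t j * s * ln (x j)) * exp (- \<tau> t * ln (x j)))) (at t)"
    unfolding A_def
  proof (rule DERIV_sum)
    fix j assume j: "j \<in> {1..K}"
    show "((\<lambda>u. \<beta> u j * exp (- \<tau> u * ln (x j))) has_real_derivative (b j - \<beta> t j * s * ln (x j)) * exp (- \<tau> t * ln (x j))) (at t)"
      by (rule derivative_eq_intros \<beta>(2)[OF j] \<tau>(2) refl | simp add: algebra_simps; fail)+
  qed
  have d1: "((\<lambda>u. real (K - 1) * ln (\<tau> u)) has_real_derivative real (K - 1) * (s / \<tau> t)) (at t)"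
    using \<tau>(1) by (auto intro!: derivative_eq_intros \<tau>(2))
  have d2: "((\<lambda>u. real K * ln (A u)) has_real_derivative
      real K * ((\<Sum>j=1..K. (b j - \<beta> t j * s * ln (x j)) * exp (- \<tau> t * ln (x j))) / A t)) (at t)"
    using A by (auto intro!: derivative_eq_intros dA)
  have d3: "((\<lambda>u. \<Sum>i=1..K. ln (\<beta> u i) - (\<tau> u + 1) * ln (x i)) has_real_derivative (\<Sum>i=1..K. b i / \<beta> t i - s * ln (x i))) (at t)"
  proof (rule DERIV_sum)
    fix i assume i: "i \<in> {1..K}"
    show "((\<lambda>u. ln (\<beta> u i) - (\<tau> u + 1) * ln (x i)) has_real_derivative b i / \<beta> t i - s * ln (x i)) (at t)"
      using \<beta>(1)[OF i] by (auto intro!: derivative_eq_intros \<beta>(2)[OF i] \<tau>(2))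
  qed
  have "((\<lambda>u. ln (fact (K - 1)) + real (K - 1) * ln (\<tau> u) - real K * ln (A u) + (\<Sum>i=1..K. ln (\<beta> u i) - (\<tau> u + 1) * ln (x i)))
    has_real_derivative log_density_deriv K (\<beta> t) (\<tau> t) b s x) (at t)"
    using DERIV_add[OF DERIV_diff[OF DERIV_add[OF DERIV_const[of "ln (fact (K - 1))"] d1] d2] d3]
    unfolding log_density_deriv_def A_def by simp
  \<comment> \<open>The closed form of the logarithm holds for positive parameters only; continuity
    provides a neighbourhood of \<open>t\<close> on which they stay positive.\<close>
  moreover have "\<forall>\<^sub>F u in nhds t. ln (concrete_density K (\<beta> u) (\<tau> u) x)
    = ln (fact (K - 1)) + real (K - 1) * ln (\<tau> u) - real K * ln (A u) + (\<Sum>i=1..K. ln (\<beta> u i) - (\<tau> u + 1) * ln (x i))"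
  proof -
    have "\<forall>\<^sub>F u in nhds t. \<forall>i\<in>{1..K}. 0 < \<beta> u i"
      using \<beta> by (intro eventually_ball_finite ballI eventually_pos_if_isCont DERIV_isCont) auto
    moreover have "\<forall>\<^sub>F u in nhds t. 0 < \<tau> u"
      using \<tau> by (intro eventually_pos_if_isCont DERIV_isCont) auto
    ultimately show ?thesis
    proof eventually_elim
      case (elim u)
      then show ?case unfolding A_def using ln_concrete_density[OF K _ x, where \<beta> = "\<beta> u" and \<tau> = "\<tau> u"] by auto
    qed
  qed
  ultimately show ?thesis by (subst DERIV_cong_ev[OF refl _ refl]) auto
qed

text \<open>The differential of \<open>fill_last\<close>. Entry K of \<open>w\<close> is the
  velocity of \<tau>; it is overwritten by the velocity of the last weight, which keeps the sum of
  the weights constant.\<close>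

definition chart_velocity :: "nat \<Rightarrow> (nat \<Rightarrow> real) \<Rightarrow> nat \<Rightarrow> real" where
  "chart_velocity K w = w(K := - (\<Sum>i=1..<K. w i))"

lemma fill_last_has_derivative:
  assumes "\<And>a. a \<in> {1..K} \<Longrightarrow> ((\<lambda>t. \<gamma> t a) has_real_derivative w a) (at t)" "i \<in> {1..K}"
  shows "((\<lambda>t. fill_last K (\<gamma> t) i) has_real_derivative chart_velocity K w i) (at t)"
proof (cases "i = K")
  case True
  have "((\<lambda>t. \<Sum>a=1..<K. \<gamma> t a) has_real_derivative (\<Sum>a=1..<K. w a)) (at t)"
    by (rule DERIV_sum) (use assms in auto)
  from DERIV_diff[OF DERIV_const[of 1] this] show ?thesis using True
    by (simp add: fill_last_def chart_velocity_def)
next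
  case False
  then show ?thesis using assms by (simp add: fill_last_def chart_velocity_def)
qed

definition unit_dir :: "nat \<Rightarrow> nat \<Rightarrow> real" where "unit_dir a = (\<lambda>i. if i = a then 1 else 0)"

lemma fill_last_pos:
  assumes "\<eta> \<in> concrete_coords K" "i \<in> {1..K}"
  shows "0 < fill_last K \<eta> i"
  using assms by (auto simp: concrete_coords_def fill_last_def)

lemma score_interior:
  assumes K: "1 \<le> K" and \<eta>: "\<eta> \<in> concrete_coords K" and a: "a \<in> {1..K}" and x: "\<And>i. i \<in> {1..K} \<Longrightarrow> 0 < x i"
  shows "score K \<eta> a x = log_density_deriv K (fill_last K \<eta>) (\<eta> K) (chart_velocity K (unit_dir a)) (unit_dir a K) x"
proof -
  have d: "((\<lambda>t. (\<eta>(a := t)) c) has_real_derivative unit_dir a c) (at (\<eta> a))" for c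
    by (auto simp: unit_dir_def)
  have "((\<lambda>t. ln (coord_density K (\<eta>(a := t)) x)) has_real_derivative
      log_density_deriv K (fill_last K (\<eta>(a := \<eta> a))) ((\<eta>(a := \<eta> a)) K) (chart_velocity K (unit_dir a)) (unit_dir a K) x) (at (\<eta> a))"
    unfolding coord_density_def
  proof (rule ln_concrete_density_has_derivative[OF K x])
    fix i assume i: "i \<in> {1..K}"
    show "0 < fill_last K (\<eta>(a := \<eta> a)) i" using fill_last_pos[OF \<eta> i] by simp
    show "((\<lambda>u. fill_last K (\<eta>(a := u)) i) has_real_derivative chart_velocity K (unit_dir a) i) (at (\<eta> a))"
      by (rule fill_last_has_derivative[OF d i])
  next
    show "0 < (\<eta>(a := \<eta> a)) K" using \<eta> K by (simp add: concrete_coords_def)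
    show "((\<lambda>u. (\<eta>(a := u)) K) has_real_derivative unit_dir a K) (at (\<eta> a))" by (rule d)
  qed
  then show ?thesis unfolding score_def by (simp add: DERIV_imp_deriv)
qed

text \<open>On the boundary of the simplex the density has the junk value 0, hence so has the score.\<close>

lemma score_boundary:
  assumes "i \<in> {1..K}" "x i = 0"
  shows "score K \<eta> a x = 0"
proof -
  have "(\<Prod>i=1..K. \<beta> i / x i powr (\<tau> + 1)) = 0" for \<beta> \<tau> using assms by (intro prod_zero) auto
  then have "coord_density K \<eta>' x = 0" for \<eta>'
    unfolding coord_density_def concrete_density_def by (simp only: mult_zero_right)
  then show ?thesis unfolding score_def by simp
qed

text \<open>K times the deviation of s / \<tau> * ln \<beta>_i - b_i / \<beta>_i from its mean over
  i. The centring makes the coefficients sum to zero and removes the scaling direction of the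
  weights.\<close>

definition score_coeff :: "nat \<Rightarrow> (nat \<Rightarrow> real) \<Rightarrow> real \<Rightarrow> (nat \<Rightarrow> real) \<Rightarrow> real \<Rightarrow> nat \<Rightarrow> real" where
  "score_coeff K \<beta> \<tau> b s i = real K * (s / \<tau> * ln (\<beta> i) - b i / \<beta> i) - (\<Sum>j=1..K. s / \<tau> * ln (\<beta> j) - b j / \<beta> j)"

text \<open>Adding the diagonal makes the double sum a product of two single sums; what is taken
  away again combines with the \<open>res_c\<close> terms, and all occurrences of Euler's constant
  cancel.\<close>

lemma ln_sum_c_eq:
  assumes "1 \<le> K"
  shows "ln_sum_c K E = (real K - 1) * (\<Sum>i=1..K. E i) - (\<Sum>i=1..K. (real K * E i - (\<Sum>j=1..K. E j)) * ln (E i))"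
proof -
  let ?P = "{p\<in>{1..K} \<times> {1..K}. fst p \<noteq> snd p}"
  let ?g = "euler_mascheroni :: real"
  define S where "S = (\<Sum>i=1..K. E i)"
  define L where "L = (\<Sum>i=1..K. ln (E i))"
  define T where "T = (\<Sum>i=1..K. E i * ln (E i))"
  have se: "(\<Sum>i=1..K. exp_c (E i)) = S - K" by (simp add: exp_c_def S_def sum_subtractf)
  have sl: "(\<Sum>i=1..K. ln_c (E i)) = L + K * ?g" by (simp add: ln_c_def L_def sum.distrib)
  have sel: "(\<Sum>i=1..K. exp_c (E i) * ln_c (E i)) = T + ?g * S - L - K * ?g"
    by (simp add: exp_c_def ln_c_def L_def T_def S_def sum.distrib sum_subtractf sum_distrib_left algebra_simps)
  have "(\<Sum>p\<in>{1..K} \<times> {1..K}. exp_c (E (fst p)) * ln_c (E (snd p)))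
    = (\<Sum>p\<in>?P. exp_c (E (fst p)) * ln_c (E (snd p))) + (\<Sum>p\<in>(\<lambda>i. (i, i)) ` {1..K}. exp_c (E (fst p)) * ln_c (E (snd p)))"
    by (subst sum.union_disjoint[symmetric]) (auto intro!: sum.cong finite_subset[of ?P "{1..K} \<times> {1..K}"])
  also have "(\<Sum>p\<in>(\<lambda>i. (i, i)) ` {1..K}. exp_c (E (fst p)) * ln_c (E (snd p))) = (\<Sum>i=1..K. exp_c (E i) * ln_c (E i))"
    by (subst sum.reindex) (auto simp: inj_on_def)
  also have "(\<Sum>p\<in>{1..K} \<times> {1..K}. exp_c (E (fst p)) * ln_c (E (snd p))) = (\<Sum>i=1..K. exp_c (E i)) * (\<Sum>i=1..K. ln_c (E i))"
    by (simp add: sum_product sum.cartesian_product case_prod_beta)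
  finally have D: "(\<Sum>p\<in>?P. exp_c (E (fst p)) * ln_c (E (snd p))) = (S - K) * (L + K * ?g) - (T + ?g * S - L - K * ?g)"
    unfolding se sl sel by simp
  have Q: "(\<Sum>i=1..K. res_c (E i)) = S - (T + ?g * S - L - K * ?g)"
    unfolding res_c_def sum_subtractf sel S_def ..
  have R: "(\<Sum>i=1..K. (real K * E i - S) * ln (E i)) = K * T - S * L"
    by (simp add: T_def L_def sum_subtractf sum_distrib_left algebra_simps)
  show ?thesis unfolding ln_sum_c_def D Q S_def[symmetric] R by (simp add: algebra_simps)
qed

text \<open>At a sample, \<beta>_i * x_i powr (- \<tau>) equals E_i times a factor \<open>Y\<close>
  common to all i, so the quotient in the log-derivative becomes an average with weights E_i / S.
  After multiplication by S only E_i and ln E_i remain.\<close>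

lemma log_density_deriv_sample:
  assumes K: "1 \<le> K" and E: "\<And>i. i \<in> {1..K} \<Longrightarrow> 0 < E i" and \<beta>: "\<And>i. i \<in> {1..K} \<Longrightarrow> 0 < \<beta> i" and \<tau>: "0 < \<tau>"
  shows "\<And>i. i \<in> {1..K} \<Longrightarrow> 0 < concrete_sample K \<beta> \<tau> E i"
    and "\<exists>N. \<forall>i\<in>{1..K}. ln (concrete_sample K \<beta> \<tau> E i) = (ln (\<beta> i) - ln (E i)) / \<tau> - N"
    and "(\<Sum>i=1..K. E i) * log_density_deriv K \<beta> \<tau> b s (concrete_sample K \<beta> \<tau> E)
      = (\<Sum>i=1..K. score_coeff K \<beta> \<tau> b s i * exp_c (E i)) + s / \<tau> * ln_sum_c K E"
proof -
  define S where "S = (\<Sum>i=1..K. E i)"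
  have S: "0 < S" unfolding S_def using E K by (intro sum_pos) auto
  define Z where "Z = (\<Sum>j=1..K. (\<beta> j / E j) powr (1 / \<tau>))"
  have zp: "0 < (\<beta> j / E j) powr (1 / \<tau>)" if "j \<in> {1..K}" for j using E[OF that] \<beta>[OF that] by simp
  have Z: "0 < Z" unfolding Z_def using zp K by (intro sum_pos) auto
  define x where "x = concrete_sample K \<beta> \<tau> E"
  have xi: "x i = (\<beta> i / E i) powr (1 / \<tau>) / Z" if "i \<in> {1..K}" for i
    using that by (simp add: x_def concrete_sample_def Z_def)
  show xp: "0 < concrete_sample K \<beta> \<tau> E i" if "i \<in> {1..K}" for i
    using xi[OF that] zp[OF that] Z by (simp add: x_def)
  have lx: "ln (x i) = (ln (\<beta> i) - ln (E i)) / \<tau> - ln Z" if "i \<in> {1..K}" for i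
    unfolding xi[OF that] using zp[OF that] Z E[OF that] \<beta>[OF that] by (simp add: ln_div ln_powr)
  then show "\<exists>N. \<forall>i\<in>{1..K}. ln (concrete_sample K \<beta> \<tau> E i) = (ln (\<beta> i) - ln (E i)) / \<tau> - N"
    unfolding x_def by blast
  define Y where "Y = exp (\<tau> * ln Z)"
  have Y: "0 < Y" by (simp add: Y_def)
  have ex: "exp (- \<tau> * ln (x i)) = E i / \<beta> i * Y" if "i \<in> {1..K}" for i
  proof -
    have "- \<tau> * ln (x i) = ln (E i) - ln (\<beta> i) + \<tau> * ln Z"
      unfolding lx[OF that] using \<tau> by (simp add: field_simps)
    then show ?thesis using E[OF that] \<beta>[OF that] by (simp add: exp_add exp_diff Y_def)
  qed
  define r where "r = s / \<tau>"
  define h where "h i = b i / \<beta> i - s * ln (x i)" for i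
  have A: "(\<Sum>j=1..K. \<beta> j * exp (- \<tau> * ln (x j))) = S * Y"
    unfolding S_def sum_distrib_right
  proof (intro sum.cong refl)
    fix j assume j: "j \<in> {1..K}"
    show "\<beta> j * exp (- \<tau> * ln (x j)) = E j * Y" unfolding ex[OF j] using \<beta>[OF j] by simp
  qed
  have B: "(\<Sum>j=1..K. (b j - \<beta> j * s * ln (x j)) * exp (- \<tau> * ln (x j))) = (\<Sum>j=1..K. E j * h j) * Y"
    unfolding sum_distrib_right
  proof (intro sum.cong refl)
    fix j assume j: "j \<in> {1..K}"
    show "(b j - \<beta> j * s * ln (x j)) * exp (- \<tau> * ln (x j)) = E j * h j * Y"
      unfolding ex[OF j] h_def using \<beta>[OF j] by (simp add: field_simps)
  qed
  \<comment> \<open>\<open>Y\<close> cancels between numerator and denominator.\<close>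
  have "log_density_deriv K \<beta> \<tau> b s x = (real K - 1) * r - real K * ((\<Sum>j=1..K. E j * h j) / S) + (\<Sum>i=1..K. h i)"
    unfolding log_density_deriv_def A B r_def using Y K by (simp add: h_def of_nat_diff)
  then have "S * log_density_deriv K \<beta> \<tau> b s x = (real K - 1) * r * S - real K * (\<Sum>j=1..K. E j * h j) + S * (\<Sum>i=1..K. h i)"
    using S by (simp add: field_simps)
  also have "\<dots> = (real K - 1) * r * S + (\<Sum>i=1..K. (S - real K * E i) * h i)"
    by (simp add: sum_subtractf sum_distrib_left left_diff_distrib mult.assoc)
  also have "(\<Sum>i=1..K. (S - real K * E i) * h i)
    = (\<Sum>i=1..K. (real K * E i - S) * (r * ln (\<beta> i) - b i / \<beta> i)) - r * (\<Sum>i=1..K. (real K * E i - S) * ln (E i))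
      + (\<Sum>i=1..K. S - real K * E i) * (s * ln Z)"
    unfolding sum_distrib_left sum_distrib_right sum_subtractf[symmetric] sum.distrib[symmetric]
  proof (intro sum.cong refl)
    fix i assume i: "i \<in> {1..K}"
    have "h i = b i / \<beta> i - r * ln (\<beta> i) + r * ln (E i) + s * ln Z"
      unfolding h_def lx[OF i] r_def using \<tau> by (simp add: field_simps)
    then show "(S - real K * E i) * h i = (real K * E i - S) * (r * ln (\<beta> i) - b i / \<beta> i) - r * ((real K * E i - S) * ln (E i))
      + (S - real K * E i) * (s * ln Z)" by (simp only:) (simp add: algebra_simps)
  qed
  \<comment> \<open>These coefficients sum to zero, which eliminates the normalising constant
    \<open>Z\<close>.\<close>
  also have "(\<Sum>i=1..K. S - real K * E i) = 0"
    by (simp add: sum_subtractf sum_distrib_left[symmetric] S_def)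
  \<comment> \<open>\<open>E i\<close> may be replaced by \<open>E i - 1\<close> because the
    coefficients \<open>score_coeff\<close> sum to zero.\<close>
  also have "(\<Sum>i=1..K. (real K * E i - S) * (r * ln (\<beta> i) - b i / \<beta> i)) = (\<Sum>i=1..K. score_coeff K \<beta> \<tau> b s i * exp_c (E i))"
  proof -
    define v where "v i = r * ln (\<beta> i) - b i / \<beta> i" for i
    define V where "V = (\<Sum>i=1..K. v i)"
    have "(\<Sum>i=1..K. score_coeff K \<beta> \<tau> b s i * exp_c (E i)) = (\<Sum>i=1..K. (real K * v i - V) * (E i - 1))"
      by (simp add: score_coeff_def V_def v_def r_def exp_c_def)
    also have "\<dots> = real K * (\<Sum>i=1..K. v i * E i) - V * S - (real K * V - real K * V)"
    proof -
      have "(\<Sum>i=1..K. (real K * v i - V) * (E i - 1)) = (\<Sum>i=1..K. real K * (v i * E i) - V * E i - (real K * v i - V))"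
        by (intro sum.cong refl) (simp add: algebra_simps)
      then show ?thesis unfolding sum_subtractf sum_distrib_left[symmetric] V_def[symmetric] S_def[symmetric] by simp
    qed
    also have "\<dots> = (\<Sum>i=1..K. real K * (v i * E i) - S * v i)"
      unfolding sum_subtractf sum_distrib_left[symmetric] V_def by simp
    also have "\<dots> = (\<Sum>i=1..K. (real K * E i - S) * v i)"
      by (simp add: algebra_simps)
    finally show ?thesis unfolding v_def ..
  qed
  finally show "(\<Sum>i=1..K. E i) * log_density_deriv K \<beta> \<tau> b s (concrete_sample K \<beta> \<tau> E)
      = (\<Sum>i=1..K. score_coeff K \<beta> \<tau> b s i * exp_c (E i)) + s / \<tau> * ln_sum_c K E"
    unfolding ln_sum_c_eq[OF K] S_def[symmetric] x_def[symmetric] r_def[symmetric] by (simp add: algebra_simps)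
qed

section \<open>Transfer of expectations to the exponential vector, and the Fisher matrix\<close>

lemma AE_exp_vector_pos: "AE E in exp_vector K. \<forall>i\<in>{1..K}. 0 < E i"
proof -
  interpret E: prob_space std_exp by (rule prob_space_std_exp)
  have "AE E in exp_vector K. 0 < E i" if "i \<in> {1..K}" for i
    unfolding exp_vector_def using that AE_std_exp_pos
    by (intro AE_PiM_component) (auto simp: prob_space_std_exp)
  then show ?thesis by (intro AE_finite_allI) auto
qed

text \<open>The nonnegative version applied to indicators identifies two measures. Equality of
  measures then covers signed \<open>g\<close> without an integrability assumption, since both
  Bochner integrals take the same default value.\<close>

lemma integral_concrete:
  assumes K: "1 \<le> K" and \<beta>: "\<And>i. i \<in> {1..K} \<Longrightarrow> 0 < \<beta> i" and \<tau>: "0 < \<tau>"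
    and g [measurable]: "g \<in> borel_measurable (rvec K)"
  shows "(\<integral>x. g x \<partial>concrete K \<beta> \<tau>)
    = (\<integral>E. (\<Sum>i=1..K. E i) ^ d / (fact (K + d - 1) / fact (K - 1)) * (g (concrete_sample K \<beta> \<tau> E) :: real) \<partial>exp_vector K)"
proof -
  let ?N = "rvec K"
  define c where "c = (fact (K + d - 1) / fact (K - 1) :: real)"
  have c: "0 < c" by (simp add: c_def)
  let ?C = "concrete K \<beta> \<tau>"
  have id: "(\<lambda>x. x) \<in> ?C \<rightarrow>\<^sub>M ?N"
    unfolding concrete_def simplex_lborel_def
    by (simp add: measurable_ident_sets measurable_restrict_space1)
  define w where "w E = (\<Sum>i=1..K. E i) ^ d / c" for E :: "nat \<Rightarrow> real"
  have [measurable]: "w \<in> borel_measurable (exp_vector K)" unfolding w_def by measurable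
  have wpos: "AE E in exp_vector K. 0 \<le> w E"
    using AE_exp_vector_pos
  proof eventually_elim
    case (elim E)
    then have "0 \<le> (\<Sum>i=1..K. E i)" by (intro sum_nonneg) (auto intro: less_imp_le)
    then show ?case unfolding w_def using c by (intro divide_nonneg_pos zero_le_power)
  qed
  have sm [measurable]: "concrete_sample K \<beta> \<tau> \<in> density (exp_vector K) w \<rightarrow>\<^sub>M ?N" by measurable
  \<comment> \<open>The push-forward under the identity moves the Concrete law from the simplex to
    the full product space, where both measures have the same sigma-algebra.\<close>
  have "distr ?C ?N (\<lambda>x. x) = distr (density (exp_vector K) w) ?N (concrete_sample K \<beta> \<tau>)"
  proof (rule measure_eqI)
    fix A assume "A \<in> sets (distr ?C ?N (\<lambda>x. x))"
    then have A [measurable]: "A \<in> sets ?N" by simp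
    have "emeasure (distr (density (exp_vector K) w) ?N (concrete_sample K \<beta> \<tau>)) A
      = (\<integral>\<^sup>+x. indicator A x \<partial>distr (density (exp_vector K) w) ?N (concrete_sample K \<beta> \<tau>))"
      by (rule nn_integral_indicator[symmetric]) (use A in simp)
    also have "\<dots> = (\<integral>\<^sup>+E. indicator A (concrete_sample K \<beta> \<tau> E) \<partial>density (exp_vector K) w)"
      by (rule nn_integral_distr; measurable)
    also have "\<dots> = (\<integral>\<^sup>+E. ennreal (w E) * indicator A (concrete_sample K \<beta> \<tau> E) \<partial>exp_vector K)"
      by (rule nn_integral_density; measurable)
    also have "\<dots> = (\<integral>\<^sup>+E. ennreal (1 / c) * (ennreal ((\<Sum>i=1..K. E i) ^ d) * indicator A (concrete_sample K \<beta> \<tau> E)) \<partial>exp_vector K)"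
    proof (rule nn_integral_cong)
      fix E
      have "ennreal (w E) = ennreal (1 / c) * ennreal ((\<Sum>i=1..K. E i) ^ d)"
        using c by (subst ennreal_mult'[symmetric]) (auto simp: w_def)
      then show "ennreal (w E) * indicator A (concrete_sample K \<beta> \<tau> E)
        = ennreal (1 / c) * (ennreal ((\<Sum>i=1..K. E i) ^ d) * indicator A (concrete_sample K \<beta> \<tau> E))"
        by (simp only: mult.assoc)
    qed
    also have "\<dots> = ennreal (1 / c) * (\<integral>\<^sup>+E. ennreal ((\<Sum>i=1..K. E i) ^ d) * indicator A (concrete_sample K \<beta> \<tau> E) \<partial>exp_vector K)"
      by (rule nn_integral_cmult) measurable
    also have "\<dots> = ennreal (1 / c) * (ennreal c * (\<integral>\<^sup>+x. indicator A x \<partial>?C))"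
      unfolding c_def by (subst nn_integral_concrete_sample[OF K \<beta> \<tau> borel_measurable_indicator[OF A]]) (assumption, rule refl)
    also have "\<dots> = (ennreal (1 / c) * ennreal c) * (\<integral>\<^sup>+x. indicator A x \<partial>?C)"
      by (simp only: mult.assoc)
    also have "ennreal (1 / c) * ennreal c = 1"
      using c by (subst ennreal_mult'[symmetric]) auto
    also have "1 * (\<integral>\<^sup>+x. indicator A x \<partial>?C) = (\<integral>\<^sup>+x. indicator A x \<partial>distr ?C ?N (\<lambda>x. x))"
      unfolding mult_1_left by (rule nn_integral_distr[symmetric, OF id]) measurable
    also have "\<dots> = emeasure (distr ?C ?N (\<lambda>x. x)) A"
      by (rule nn_integral_indicator) (use A in simp)
    finally show "emeasure (distr ?C ?N (\<lambda>x. x)) A = emeasure (distr (density (exp_vector K) w) ?N (concrete_sample K \<beta> \<tau>)) A" ..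
  qed simp
  then have "integral\<^sup>L (distr ?C ?N (\<lambda>x. x)) g = integral\<^sup>L (distr (density (exp_vector K) w) ?N (concrete_sample K \<beta> \<tau>)) g" by simp
  then have "(\<integral>x. g x \<partial>?C) = (\<integral>E. g (concrete_sample K \<beta> \<tau> E) \<partial>density (exp_vector K) w)"
    by (simp only: integral_distr[OF id g] integral_distr[OF sm g])
  also have "\<dots> = (\<integral>E. w E * g (concrete_sample K \<beta> \<tau> E) \<partial>exp_vector K)"
    using wpos by (subst integral_density) auto
  finally show ?thesis unfolding w_def c_def .
qed

lemma space_concrete: "space (concrete K \<beta> \<tau>) \<subseteq> prob_simplex K"
  by (auto simp: concrete_def simplex_lborel_def space_restrict_space)

lemma measurable_log_density_deriv [measurable]:
  "log_density_deriv K \<beta> \<tau> b s \<in> borel_measurable (rvec K)"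
  unfolding log_density_deriv_def by measurable

definition coord_coeff :: "nat \<Rightarrow> (nat \<Rightarrow> real) \<Rightarrow> (nat \<Rightarrow> real) \<Rightarrow> nat \<Rightarrow> real" where
  "coord_coeff K \<eta> w = score_coeff K (fill_last K \<eta>) (\<eta> K) (chart_velocity K w) (w K)"

text \<open>With d = 2 the weight is the square of the total, one factor for each score. The
  products become bilinear in the variables of \<open>exp_vector_score_moment\<close>, and the
  denominator is the second moment of the total.\<close>

lemma fisher_information_eq:
  assumes K: "1 \<le> K" and \<eta>: "\<eta> \<in> concrete_coords K" and a: "a \<in> {1..K}" and b: "b \<in> {1..K}"
  shows "fisher_information K \<eta> a b
    = ((\<Sum>i=1..K. coord_coeff K \<eta> (unit_dir a) i * coord_coeff K \<eta> (unit_dir b) i)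
      + unit_dir a K / \<eta> K * (unit_dir b K / \<eta> K) * (real K * (real K - 1) * (real K * pi\<^sup>2 / 6 + 1)))
      / (real K * (real K + 1))"
proof -
  let ?\<beta> = "fill_last K \<eta>" and ?\<tau> = "\<eta> K"
  have \<beta>: "\<And>i. i \<in> {1..K} \<Longrightarrow> 0 < ?\<beta> i" by (rule fill_last_pos[OF \<eta>])
  have \<tau>: "0 < ?\<tau>" using \<eta> K by (simp add: concrete_coords_def)
  define D where "D a = log_density_deriv K ?\<beta> ?\<tau> (chart_velocity K (unit_dir a)) (unit_dir a K)" for a
  have [measurable]: "D a \<in> borel_measurable (rvec K)" for a unfolding D_def by measurable
  \<comment> \<open>The formula for the score holds in the interior only. The value 0 elsewhere
    agrees with the scores on the boundary and keeps \<open>g\<close> measurable on the whole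
    product space.\<close>
  define g where "g x = (if \<forall>i\<in>{1..K}. 0 < x i then D a x * D b x else 0)" for x
  have g: "g \<in> borel_measurable (rvec K)" unfolding g_def by measurable
  define V where "V a E = (\<Sum>i=1..K. coord_coeff K \<eta> (unit_dir a) i * exp_c (E i)) + unit_dir a K / ?\<tau> * ln_sum_c K E" for a E
  have "fisher_information K \<eta> a b = (\<integral>x. g x \<partial>concrete K ?\<beta> ?\<tau>)"
    unfolding fisher_information_def coord_concrete_def
  proof (rule Bochner_Integration.integral_cong[OF refl])
    fix x assume "x \<in> space (concrete K ?\<beta> ?\<tau>)"
    then have x: "x \<in> prob_simplex K" using space_concrete by blast
    show "score K \<eta> a x * score K \<eta> b x = g x"
    proof (cases "\<forall>i\<in>{1..K}. 0 < x i")
      case True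
      then show ?thesis
        unfolding g_def D_def using score_interior[OF K \<eta> a, where x = x] score_interior[OF K \<eta> b, where x = x] by auto
    next
      case False
      then obtain i where i: "i \<in> {1..K}" "x i = 0" using x by (force simp: prob_simplex_def)
      then show ?thesis using score_boundary[where x = x and i = i and K = K and \<eta> = \<eta> and a = a] False
        unfolding g_def by (simp only: mult_zero_left if_False)
    qed
  qed
  also have "\<dots> = (\<integral>E. (\<Sum>i=1..K. E i) ^ 2 / (fact (K + 2 - 1) / fact (K - 1)) * g (concrete_sample K ?\<beta> ?\<tau> E) \<partial>exp_vector K)"
    by (rule integral_concrete[OF K \<beta> \<tau> g])
  also have "\<dots> = (\<integral>E. V a E * V b E / (real K * (real K + 1)) \<partial>exp_vector K)"
  proof (rule integral_cong_AE)
    have fct: "(fact (K + 2 - 1) / fact (K - 1) :: real) = real K * (real K + 1)"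
    proof -
      obtain n where n: "K = Suc n" using K by (cases K) auto
      show ?thesis by (simp add: n)
    qed
    have g' [measurable]: "g \<in> borel_measurable (rvec K)" by (rule g)
    show "(\<lambda>E. (\<Sum>i=1..K. E i) ^ 2 / (fact (K + 2 - 1) / fact (K - 1)) * g (concrete_sample K ?\<beta> ?\<tau> E)) \<in> borel_measurable (exp_vector K)"
      by measurable
    show "(\<lambda>E. V a E * V b E / (real K * (real K + 1))) \<in> borel_measurable (exp_vector K)"
      unfolding V_def by (intro borel_measurable_divide borel_measurable_const borel_measurable_has_bochner_integral[OF exp_vector_score_moment])
    show "AE E in exp_vector K. (\<Sum>i=1..K. E i) ^ 2 / (fact (K + 2 - 1) / fact (K - 1)) * g (concrete_sample K ?\<beta> ?\<tau> E)
      = V a E * V b E / (real K * (real K + 1))"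
      using AE_exp_vector_pos
    proof eventually_elim
      case (elim E)
      then have E: "\<And>i. i \<in> {1..K} \<Longrightarrow> 0 < E i" by blast
      note L = log_density_deriv_sample[where K = K and E = E and \<beta> = ?\<beta> and \<tau> = ?\<tau>, OF K E \<beta> \<tau>]
      have gs: "g (concrete_sample K ?\<beta> ?\<tau> E) = D a (concrete_sample K ?\<beta> ?\<tau> E) * D b (concrete_sample K ?\<beta> ?\<tau> E)"
        unfolding g_def using L(1) by simp
      have VD: "V a E = (\<Sum>i=1..K. E i) * D a (concrete_sample K ?\<beta> ?\<tau> E)" for a
        unfolding V_def coord_coeff_def D_def by (rule L(3)[symmetric])
      have "(\<Sum>i=1..K. E i) ^ 2 * g (concrete_sample K ?\<beta> ?\<tau> E) = V a E * V b E"
        unfolding gs VD by (simp add: power2_eq_square mult_ac)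
      then show ?case unfolding fct by simp
    qed
  qed
  also have "\<dots> = (\<integral>E. V a E * V b E \<partial>exp_vector K) / (real K * (real K + 1))" by simp
  also have "(\<integral>E. V a E * V b E \<partial>exp_vector K) = (\<Sum>i=1..K. coord_coeff K \<eta> (unit_dir a) i * coord_coeff K \<eta> (unit_dir b) i)
      + unit_dir a K / \<eta> K * (unit_dir b K / \<eta> K) * (real K * (real K - 1) * (real K * pi\<^sup>2 / 6 + 1))"
    unfolding V_def by (rule has_bochner_integral_integral_eq[OF exp_vector_score_moment])
  finally show ?thesis .
qed

section \<open>The Fisher metric as a quadratic form in the velocity\<close>

lemma chart_velocity_unit_dir:
  assumes "i \<in> {1..K}"
  shows "(\<Sum>a=1..K. chart_velocity K (unit_dir a) i * w a) = chart_velocity K w i"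
proof (cases "i = K")
  case True
  have "(\<Sum>a=1..K. chart_velocity K (unit_dir a) K * w a) = - (\<Sum>a=1..K. (\<Sum>j=1..<K. if j = a then w a else 0))"
    by (simp add: chart_velocity_def unit_dir_def sum_distrib_right sum_negf if_distrib[of "\<lambda>t. t * _"] cong: if_cong)
  also have "\<dots> = - (\<Sum>j=1..<K. \<Sum>a=1..K. if j = a then w a else 0)" by (subst sum.swap) simp
  also have "(\<Sum>j=1..<K. \<Sum>a=1..K. if j = a then w a else 0) = (\<Sum>j=1..<K. w j)"
    by (intro sum.cong refl) auto
  finally show ?thesis using True by (simp add: chart_velocity_def)
next
  case False
  then show ?thesis using assms
    by (simp add: chart_velocity_def unit_dir_def if_distrib[of "\<lambda>t. t * _"] cong: if_cong)
qed

text \<open>Linearity in the direction: it lets the double sum over chart directions collapse to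
  squares of the coefficients of one velocity.\<close>

lemma coord_coeff_unit_dir:
  assumes "i \<in> {1..K}"
  shows "(\<Sum>a=1..K. coord_coeff K \<eta> (unit_dir a) i * w a) = coord_coeff K \<eta> w i"
proof -
  define v where "v w i = w K / \<eta> K * ln (fill_last K \<eta> i) - chart_velocity K w i / fill_last K \<eta> i" for w i
  have K: "K \<in> {1..K}" using assms by auto
  have u: "(\<Sum>a=1..K. unit_dir a K * w a) = w K"
    using K by (simp add: unit_dir_def if_distrib[of "\<lambda>t. t * _"] cong: if_cong)
  have v: "(\<Sum>a=1..K. v (unit_dir a) j * w a) = v w j" if "j \<in> {1..K}" for j
  proof -
    have "(\<Sum>a=1..K. v (unit_dir a) j * w a)
      = (\<Sum>a=1..K. unit_dir a K * w a) / \<eta> K * ln (fill_last K \<eta> j) - (\<Sum>a=1..K. chart_velocity K (unit_dir a) j * w a) / fill_last K \<eta> j"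
      unfolding v_def left_diff_distrib sum_subtractf sum_divide_distrib sum_distrib_right by (simp add: mult_ac)
    then show ?thesis unfolding u chart_velocity_unit_dir[OF that] v_def .
  qed
  have "(\<Sum>a=1..K. coord_coeff K \<eta> (unit_dir a) i * w a)
    = real K * (\<Sum>a=1..K. v (unit_dir a) i * w a) - (\<Sum>a=1..K. \<Sum>j=1..K. v (unit_dir a) j * w a)"
  proof -
    have "coord_coeff K \<eta> (unit_dir a) i * w a = real K * (v (unit_dir a) i * w a) - (\<Sum>j=1..K. v (unit_dir a) j * w a)" for a
      unfolding coord_coeff_def score_coeff_def v_def by (simp only: left_diff_distrib sum_distrib_right mult.assoc)
    then show ?thesis by (simp only: sum_subtractf sum_distrib_left)
  qed
  also have "(\<Sum>a=1..K. \<Sum>j=1..K. v (unit_dir a) j * w a) = (\<Sum>j=1..K. v w j)"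
    by (subst sum.swap) (intro sum.cong refl v)
  finally show ?thesis unfolding v[OF assms] by (simp only: coord_coeff_def score_coeff_def v_def)
qed

text \<open>The constant l of the theorem, a radius of curvature: its square is the variance of
  \<open>ln_sum_c\<close> over K (K + 1), and the metric is this square times one of curvature -
  1.\<close>

definition curv_len :: "nat \<Rightarrow> real" where
  "curv_len K = sqrt ((real K - 1) * (real K * pi\<^sup>2 / 6 + 1) / (real K + 1))"

lemma curv_len_sq:
  assumes "1 \<le> K"
  shows "(curv_len K)\<^sup>2 = (real K - 1) * (real K * pi\<^sup>2 / 6 + 1) / (real K + 1)"
  unfolding curv_len_def using assms by (intro real_sqrt_pow2 divide_nonneg_pos mult_nonneg_nonneg) auto

lemma fisher_quadratic_form:
  assumes K: "1 \<le> K" and \<eta>: "\<eta> \<in> concrete_coords K"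
  shows "(\<Sum>a=1..K. \<Sum>b=1..K. fisher_information K \<eta> a b * w a * w b)
    = (\<Sum>i=1..K. (coord_coeff K \<eta> w i)\<^sup>2) / (real K * (real K + 1)) + (curv_len K)\<^sup>2 * (w K / \<eta> K)\<^sup>2"
proof -
  define T where "T = real K * (real K - 1) * (real K * pi\<^sup>2 / 6 + 1)"
  define N where "N = real K * (real K + 1)"
  define c where "c a = coord_coeff K \<eta> (unit_dir a)" for a
  define r where "r a = unit_dir a K / \<eta> K" for a
  have rw: "(\<Sum>a=1..K. r a * w a) = w K / \<eta> K"
    using K by (simp add: r_def unit_dir_def if_distrib[of "\<lambda>t. t * _"] if_distrib[of "\<lambda>t. t / _"] cong: if_cong)
  have "(\<Sum>a=1..K. \<Sum>b=1..K. fisher_information K \<eta> a b * w a * w b)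
    = (\<Sum>a=1..K. \<Sum>b=1..K. ((\<Sum>i=1..K. (c a i * w a) * (c b i * w b)) + T * ((r a * w a) * (r b * w b))) / N)"
  proof (intro sum.cong refl)
    fix a b assume ab: "a \<in> {1..K}" "b \<in> {1..K}"
    have "(\<Sum>i=1..K. (c a i * w a) * (c b i * w b)) = (\<Sum>i=1..K. c a i * c b i) * w a * w b"
      unfolding sum_distrib_right by (intro sum.cong refl) (simp add: mult_ac)
    then show "fisher_information K \<eta> a b * w a * w b
      = ((\<Sum>i=1..K. (c a i * w a) * (c b i * w b)) + T * ((r a * w a) * (r b * w b))) / N"
      unfolding fisher_information_eq[OF K \<eta> ab] c_def[symmetric] r_def[symmetric] T_def[symmetric] N_def[symmetric]
      by (simp add: algebra_simps)
  qed
  also have "\<dots> = ((\<Sum>a=1..K. \<Sum>b=1..K. \<Sum>i=1..K. (c a i * w a) * (c b i * w b)) + T * (\<Sum>a=1..K. \<Sum>b=1..K. (r a * w a) * (r b * w b))) / N"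
    by (simp add: sum_divide_distrib[symmetric] sum.distrib sum_distrib_left)
  also have "(\<Sum>a=1..K. \<Sum>b=1..K. (r a * w a) * (r b * w b)) = (w K / \<eta> K)\<^sup>2"
    unfolding sum_product[symmetric] rw by (simp add: power2_eq_square)
  also have "(\<Sum>a=1..K. \<Sum>b=1..K. \<Sum>i=1..K. (c a i * w a) * (c b i * w b)) = (\<Sum>i=1..K. (coord_coeff K \<eta> w i)\<^sup>2)"
  proof -
    have "(\<Sum>a=1..K. \<Sum>b=1..K. \<Sum>i=1..K. (c a i * w a) * (c b i * w b)) = (\<Sum>a=1..K. \<Sum>i=1..K. \<Sum>b=1..K. (c a i * w a) * (c b i * w b))"
      by (intro sum.cong refl sum.swap)
    also have "\<dots> = (\<Sum>i=1..K. \<Sum>a=1..K. \<Sum>b=1..K. (c a i * w a) * (c b i * w b))" by (rule sum.swap)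
    also have "\<dots> = (\<Sum>i=1..K. (coord_coeff K \<eta> w i)\<^sup>2)"
      unfolding sum_product[symmetric] c_def
      by (intro sum.cong refl) (simp only: coord_coeff_unit_dir power2_eq_square)
    finally show ?thesis .
  qed
  also have "((\<Sum>i=1..K. (coord_coeff K \<eta> w i)\<^sup>2) + T * (w K / \<eta> K)\<^sup>2) / N
    = (\<Sum>i=1..K. (coord_coeff K \<eta> w i)\<^sup>2) / N + (curv_len K)\<^sup>2 * (w K / \<eta> K)\<^sup>2"
    unfolding curv_len_sq[OF K] T_def N_def using K by (simp add: add_divide_distrib)
  finally show ?thesis unfolding N_def .
qed

section \<open>Identifiability\<close>

text \<open>The factor c ^ K of the product over i cancels against the K-th power of the sum in the
  denominator.\<close>

lemma concrete_cong_scale: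
  assumes "0 < c" "\<And>i. i \<in> {1..K} \<Longrightarrow> \<beta>' i = c * \<beta> i"
  shows "concrete K \<beta>' \<tau> = concrete K \<beta> \<tau>"
proof -
  have "concrete_density K \<beta>' \<tau> x = concrete_density K \<beta> \<tau> x" for x
  proof -
    have "(\<Sum>j=1..K. \<beta>' j / x j powr \<tau>) = c * (\<Sum>j=1..K. \<beta> j / x j powr \<tau>)"
      unfolding sum_distrib_left using assms(2) by (intro sum.cong) auto
    moreover have "(\<Prod>i=1..K. \<beta>' i / x i powr (\<tau> + 1)) = (\<Prod>i=1..K. c * (\<beta> i / x i powr (\<tau> + 1)))"
      using assms(2) by (intro prod.cong) auto
    moreover have "\<dots> = c ^ K * (\<Prod>i=1..K. \<beta> i / x i powr (\<tau> + 1))" unfolding prod.distrib by simp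
    ultimately show ?thesis unfolding concrete_density_def using assms(1) by (simp only: power_mult_distrib) simp
  qed
  then show ?thesis unfolding concrete_def by simp
qed

lemma exp_vector_ln_moments:
  assumes i: "i \<in> {1..K}" and j: "j \<in> {1..K}" "i \<noteq> j"
  shows "has_vec_mean K (\<lambda>x. ln_c (x i)) 0"
    and "has_vec_mean K (\<lambda>x. ln_c (x i) * ln_c (x i)) (pi\<^sup>2 / 6)"
    and "has_vec_mean K (\<lambda>x. ln_c (x i) * ln_c (x j)) 0"
proof -
  note m = std_exp_centred_moments
  have pd: "(\<Prod>n=1..K. if n = i then g n else (1::real)) = g i" if "i \<in> {1..K}" for i and g :: "nat \<Rightarrow> real"
    using that by (simp add: prod.delta)
  have one: "has_vec_mean K (\<lambda>x. h (x i)) y" if h: "has_exp_mean h y" for h :: "real \<Rightarrow> real" and y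
  proof -
    have "has_vec_mean K (\<lambda>x. \<Prod>n=1..K. if n = i then h (x n) else 1) (\<Prod>n=1..K. if n = i then y else 1)"
      by (rule has_vec_mean_prod[of K "\<lambda>n t. if n = i then h t else 1"]) (use h m(10) in auto)
    moreover have "(\<Prod>n=1..K. if n = i then h (x n) else 1) = h (x i)" for x :: "nat \<Rightarrow> real" by (rule pd[OF i])
    ultimately show ?thesis by (simp only: pd[OF i])
  qed
  show "has_vec_mean K (\<lambda>x. ln_c (x i)) 0" by (rule one[OF m(2)])
  show "has_vec_mean K (\<lambda>x. ln_c (x i) * ln_c (x i)) (pi\<^sup>2 / 6)" by (rule one[OF m(6)])
  have "has_vec_mean K
    (\<lambda>x. \<Prod>n=1..K. (if n = i then ln_c (x n) else 1) * (if n = j then ln_c (x n) else 1)) (\<Prod>n=1..K. if n = i \<or> n = j then 0 else 1)"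
    by (rule has_vec_mean_prod[of K "\<lambda>n t. (if n = i then ln_c t else 1) * (if n = j then ln_c t else 1)"])
      (use m j in auto)
  moreover have "(\<Prod>n=1..K. if n = i \<or> n = j then 0 else (1::real)) = 0"
    using i by (intro prod_zero) auto
  ultimately show "has_vec_mean K (\<lambda>x. ln_c (x i) * ln_c (x j)) 0"
    by (simp only: prod.distrib pd[OF i] pd[OF j(1)])
qed

text \<open>In a log-ratio the normalising constant cancels, leaving \<open>m\<close> plus the
  difference of two independent centred log-exponentials over \<tau>. The variance is twice pi^2 / 6
  over \<tau>^2, so it depends on \<tau> alone.\<close>

lemma concrete_log_ratio_moments:
  assumes K: "1 \<le> K" and \<beta>: "\<And>i. i \<in> {1..K} \<Longrightarrow> 0 < \<beta> i" and \<tau>: "0 < \<tau>"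
    and i: "i \<in> {1..K}" and j: "j \<in> {1..K}" "i \<noteq> j"
  defines "m \<equiv> (ln (\<beta> i) - ln (\<beta> j)) / \<tau>"
  shows "(\<integral>x. ln (x i) - ln (x j) \<partial>concrete K \<beta> \<tau>) = m"
    and "(\<integral>x. (ln (x i) - ln (x j))\<^sup>2 \<partial>concrete K \<beta> \<tau>) = m\<^sup>2 + pi\<^sup>2 / 3 / \<tau>\<^sup>2"
proof -
  define Y where "Y E = (ln_c (E j) - ln_c (E i)) / \<tau>" for E :: "nat \<Rightarrow> real"
  have one: "has_vec_mean K (\<lambda>_. 1) (1::real)"
    using has_vec_mean_prod[of K "\<lambda>n t. 1" "\<lambda>_. 1"] std_exp_centred_moments(10) by simp
  have Y: "has_vec_mean K Y ((0 - 0) / \<tau>)"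
    unfolding Y_def[abs_def] by (intro has_bochner_integral_divide_zero has_bochner_integral_diff
      exp_vector_ln_moments(1)[OF i j] exp_vector_ln_moments(1)[OF j(1) i j(2)[symmetric]])
  have "has_vec_mean K
    (\<lambda>E. (1 / \<tau>\<^sup>2) * (ln_c (E j) * ln_c (E j) + ln_c (E i) * ln_c (E i) - 2 * (ln_c (E i) * ln_c (E j))))
    ((1 / \<tau>\<^sup>2) * (pi\<^sup>2 / 6 + pi\<^sup>2 / 6 - 2 * 0))"
    by (intro has_bochner_integral_mult_right has_bochner_integral_diff has_bochner_integral_add
      exp_vector_ln_moments[OF i j] exp_vector_ln_moments[OF j(1) i j(2)[symmetric]])
  moreover have "(1 / \<tau>\<^sup>2) * (ln_c (E j) * ln_c (E j) + ln_c (E i) * ln_c (E i) - 2 * (ln_c (E i) * ln_c (E j))) = (Y E)\<^sup>2" for E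
    unfolding Y_def by (simp add: power2_eq_square algebra_simps add_divide_distrib diff_divide_distrib)
  ultimately have Y2: "has_vec_mean K (\<lambda>E. (Y E)\<^sup>2) ((1 / \<tau>\<^sup>2) * (pi\<^sup>2 / 6 + pi\<^sup>2 / 6 - 2 * 0))"
    by (simp only:)
  have mY: "has_vec_mean K (\<lambda>E. m * 1 + Y E) (m * 1 + (0 - 0) / \<tau>)"
    by (intro has_bochner_integral_add has_bochner_integral_mult_right one Y)
  have mY2: "has_vec_mean K (\<lambda>E. m\<^sup>2 * 1 + 2 * m * Y E + (Y E)\<^sup>2)
      (m\<^sup>2 * 1 + 2 * m * ((0 - 0) / \<tau>) + (1 / \<tau>\<^sup>2) * (pi\<^sup>2 / 6 + pi\<^sup>2 / 6 - 2 * 0))"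
    by (intro has_bochner_integral_add has_bochner_integral_mult_right one Y Y2)
  have meas: "(\<lambda>x. (ln (x i :: real) - ln (x j)) ^ p) \<in> borel_measurable (rvec K)" for p :: nat
    by (intro borel_measurable_power borel_measurable_diff borel_measurable_ln measurable_component_singleton i j(1))
  have AE: "AE E in exp_vector K. ln (concrete_sample K \<beta> \<tau> E i) - ln (concrete_sample K \<beta> \<tau> E j) = m + Y E"
    using AE_exp_vector_pos
  proof eventually_elim
    case (elim E)
    then obtain N where "\<forall>i\<in>{1..K}. ln (concrete_sample K \<beta> \<tau> E i) = (ln (\<beta> i) - ln (E i)) / \<tau> - N"
      using log_density_deriv_sample(2)[where K = K and E = E and \<beta> = \<beta> and \<tau> = \<tau>, OF K _ \<beta> \<tau>] by blast
    then show ?case using i j by (simp add: m_def Y_def ln_c_def diff_divide_distrib add_divide_distrib)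
  qed
  have key: "(\<integral>x. (ln (x i) - ln (x j)) ^ p \<partial>concrete K \<beta> \<tau>) = (\<integral>E. (m + Y E) ^ p \<partial>exp_vector K)"
    if "(\<lambda>E. (m + Y E) ^ p) \<in> borel_measurable (exp_vector K)" for p
  proof -
    have "(\<integral>x. (ln (x i) - ln (x j)) ^ p \<partial>concrete K \<beta> \<tau>)
      = (\<integral>E. (ln (concrete_sample K \<beta> \<tau> E i) - ln (concrete_sample K \<beta> \<tau> E j)) ^ p \<partial>exp_vector K)"
      using integral_concrete[OF K \<beta> \<tau> meas[of p], where d = 0] by simp
    also have "\<dots> = (\<integral>E. (m + Y E) ^ p \<partial>exp_vector K)"
    proof (rule integral_cong_AE[OF _ that])
      show "(\<lambda>E. (ln (concrete_sample K \<beta> \<tau> E i) - ln (concrete_sample K \<beta> \<tau> E j)) ^ p) \<in> borel_measurable (exp_vector K)"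
        using measurable_compose[OF measurable_concrete_sample meas] by (simp cong: measurable_cong_sets add: sets_exp_vector)
      show "AE E in exp_vector K. (ln (concrete_sample K \<beta> \<tau> E i) - ln (concrete_sample K \<beta> \<tau> E j)) ^ p = (m + Y E) ^ p"
        using AE by eventually_elim simp
    qed
    finally show ?thesis .
  qed
  show "(\<integral>x. ln (x i) - ln (x j) \<partial>concrete K \<beta> \<tau>) = m"
    using key[of 1] borel_measurable_has_bochner_integral[OF mY] has_bochner_integral_integral_eq[OF mY] by simp
  have sq: "m\<^sup>2 * 1 + 2 * m * Y E + (Y E)\<^sup>2 = (m + Y E)\<^sup>2" for E by (simp add: power2_sum)
  show "(\<integral>x. (ln (x i) - ln (x j))\<^sup>2 \<partial>concrete K \<beta> \<tau>) = m\<^sup>2 + pi\<^sup>2 / 3 / \<tau>\<^sup>2"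
    using key[of 2] borel_measurable_has_bochner_integral[OF mY2] has_bochner_integral_integral_eq[OF mY2] unfolding sq by simp
qed

text \<open>Mean and variance of the log-ratios of the coordinates determine the parameters up to scaling.\<close>

lemma concrete_identifiable:
  assumes K: "2 \<le> K" and \<beta>: "\<And>i. i \<in> {1..K} \<Longrightarrow> 0 < \<beta> i" and \<tau>: "0 < \<tau>"
    and \<beta>': "\<And>i. i \<in> {1..K} \<Longrightarrow> 0 < \<beta>' i" and \<tau>': "0 < \<tau>'"
    and eq: "concrete K \<beta> \<tau> = concrete K \<beta>' \<tau>'"
  shows "\<tau> = \<tau>'" and "\<And>i j. i \<in> {1..K} \<Longrightarrow> j \<in> {1..K} \<Longrightarrow> ln (\<beta> i) - ln (\<beta> j) = ln (\<beta>' i) - ln (\<beta>' j)"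
proof -
  have K1: "1 \<le> K" using K by simp
  have mo: "(\<integral>x. ln (x i) - ln (x j) \<partial>concrete K \<beta> \<tau>) = (ln (\<beta> i) - ln (\<beta> j)) / \<tau>"
    "(\<integral>x. (ln (x i) - ln (x j))\<^sup>2 \<partial>concrete K \<beta> \<tau>) = ((ln (\<beta> i) - ln (\<beta> j)) / \<tau>)\<^sup>2 + pi\<^sup>2 / 3 / \<tau>\<^sup>2"
    if "i \<in> {1..K}" "j \<in> {1..K}" "i \<noteq> j" for i j
    by (rule concrete_log_ratio_moments; use K1 \<beta> \<tau> that in \<open>simp; fail\<close>)+
  have mo': "(\<integral>x. ln (x i) - ln (x j) \<partial>concrete K \<beta>' \<tau>') = (ln (\<beta>' i) - ln (\<beta>' j)) / \<tau>'"
    "(\<integral>x. (ln (x i) - ln (x j))\<^sup>2 \<partial>concrete K \<beta>' \<tau>') = ((ln (\<beta>' i) - ln (\<beta>' j)) / \<tau>')\<^sup>2 + pi\<^sup>2 / 3 / \<tau>'\<^sup>2"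
    if "i \<in> {1..K}" "j \<in> {1..K}" "i \<noteq> j" for i j
    by (rule concrete_log_ratio_moments; use K1 \<beta>' \<tau>' that in \<open>simp; fail\<close>)+
  have e: "(ln (\<beta> i) - ln (\<beta> j)) / \<tau> = (ln (\<beta>' i) - ln (\<beta>' j)) / \<tau>'" if "i \<in> {1..K}" "j \<in> {1..K}" "i \<noteq> j" for i j
    using mo(1)[OF that] mo'(1)[OF that] eq by simp
  have 12: "1 \<in> {1..K}" "2 \<in> {1..K}" "1 \<noteq> (2::nat)" using K by auto
  \<comment> \<open>The means agree by \<open>e\<close>, so comparing second moments compares the
    variances. Two distinct indices exist because K is at least 2.\<close>
  have "pi\<^sup>2 / 3 / \<tau>\<^sup>2 = pi\<^sup>2 / 3 / \<tau>'\<^sup>2"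
    using mo(2)[OF 12] mo'(2)[OF 12] e[OF 12] eq by simp
  then have "\<tau>\<^sup>2 = \<tau>'\<^sup>2" using \<tau> \<tau>' by (simp add: field_simps)
  then show t: "\<tau> = \<tau>'" using \<tau> \<tau>' by (simp add: power2_eq_iff_nonneg)
  show "ln (\<beta> i) - ln (\<beta> j) = ln (\<beta>' i) - ln (\<beta>' j)" if "i \<in> {1..K}" "j \<in> {1..K}" for i j
    using e[OF that] \<tau> unfolding t[symmetric] by (cases "i = j") auto
qed

section \<open>Hyperbolic half-space\<close>

text \<open>Cauchy-Schwarz with one coordinate kept apart from the indexed ones, as the height of
  the half-space is. The mixed term is bounded by the inequality of arithmetic and geometric
  means.\<close>

lemma Cauchy_Schwarz_add:
  fixes x y :: real
  shows "(x * y + (\<Sum>i\<in>I. b i * c i))\<^sup>2 \<le> (x\<^sup>2 + (\<Sum>i\<in>I. (b i)\<^sup>2)) * (y\<^sup>2 + (\<Sum>i\<in>I. (c i)\<^sup>2))"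
proof -
  define B where "B = (\<Sum>i\<in>I. (b i)\<^sup>2)"
  define C where "C = (\<Sum>i\<in>I. (c i)\<^sup>2)"
  define S where "S = (\<Sum>i\<in>I. b i * c i)"
  have BC: "0 \<le> B" "0 \<le> C" by (simp_all add: B_def C_def sum_nonneg)
  have S: "S\<^sup>2 \<le> B * C" unfolding S_def B_def C_def by (rule Cauchy_Schwarz_ineq_sum)
  have "(2 * (x * y * S))\<^sup>2 = 4 * (x\<^sup>2 * y\<^sup>2) * S\<^sup>2" by (simp add: power_mult_distrib)
  also have "\<dots> \<le> 4 * (x\<^sup>2 * y\<^sup>2) * (B * C)" using S by (intro mult_left_mono) auto
  also have "\<dots> = (x\<^sup>2 * C + y\<^sup>2 * B)\<^sup>2 - (x\<^sup>2 * C - y\<^sup>2 * B)\<^sup>2"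
    by (simp add: power2_eq_square algebra_simps)
  also have "\<dots> \<le> (x\<^sup>2 * C + y\<^sup>2 * B)\<^sup>2" by simp
  finally have "2 * (x * y * S) \<le> x\<^sup>2 * C + y\<^sup>2 * B"
    by (rule power2_le_imp_le) (use BC in auto)
  then show ?thesis using S unfolding B_def[symmetric] C_def[symmetric] S_def[symmetric]
    by (simp add: power2_eq_square algebra_simps)
qed

text \<open>
  The curve \<open>(\<rho>, z)\<close> runs in the upper half-space and \<open>F\<close> is the hyperbolic cosine of its distance from
  the starting point, so \<open>F'\<close> is at most \<open>sqrt (F\<^sup>2 - 1)\<close> times the speed. The antiderivative of
  \<open>1 / sqrt (F\<^sup>2 - 1 + \<delta>)\<close> avoids the singularity of the distance function at the starting point.
\<close>

lemma hyperbolic_length_lower_bound: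
  fixes \<rho> \<rho>' :: "real \<Rightarrow> real" and z z' :: "'i \<Rightarrow> real \<Rightarrow> real"
  assumes I: "finite I" and S: "finite S"
    and cont: "continuous_on {0..1} \<rho>" "\<And>i. i \<in> I \<Longrightarrow> continuous_on {0..1} (z i)"
    and pos: "\<And>t. t \<in> {0..1} \<Longrightarrow> 0 < \<rho> t"
    and der: "\<And>t. t \<in> {0..1} - S \<Longrightarrow> (\<rho> has_real_derivative \<rho>' t) (at t)"
      "\<And>i t. i \<in> I \<Longrightarrow> t \<in> {0..1} - S \<Longrightarrow> (z i has_real_derivative z' i t) (at t)"
    and cont': "continuous_on ({0..1} - S) \<rho>'" "\<And>i. i \<in> I \<Longrightarrow> continuous_on ({0..1} - S) (z' i)"
    and c: "0 \<le> c"
    and d: "0 \<le> d" "cosh d = ((\<rho> 1)\<^sup>2 + (\<rho> 0)\<^sup>2 + (\<Sum>i\<in>I. (z i 1 - z i 0)\<^sup>2)) / (2 * \<rho> 1 * \<rho> 0)"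
  shows "ennreal (c * d) \<le> (\<integral>\<^sup>+t\<in>{0..1} - S. ennreal (c * (sqrt ((\<rho>' t)\<^sup>2 + (\<Sum>i\<in>I. (z' i t)\<^sup>2)) / \<rho> t)) \<partial>lborel)"
proof -
  define g where "g t = sqrt ((\<rho>' t)\<^sup>2 + (\<Sum>i\<in>I. (z' i t)\<^sup>2)) / \<rho> t" for t
  define G where "G t = indicator ({0..1} - S) t * g t" for t
  have g0: "0 \<le> g t" if "t \<in> {0..1}" for t using pos[OF that] by (auto simp: g_def sum_nonneg)
  have G0: "0 \<le> G t" for t using g0 by (auto simp: G_def split: split_indicator)
  have "continuous_on ({0..1} - S) g"
    unfolding g_def using pos cont' I
    by (intro continuous_intros continuous_on_subset[OF cont(1)]) (auto simp: less_imp_neq[symmetric] dest: pos)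
  moreover have "{0..1} - S \<in> sets borel" using S by (intro sets.Diff borel_closed) (auto simp: finite_imp_closed)
  ultimately have "(\<lambda>t. indicator ({0..1} - S) t *\<^sub>R g t) \<in> borel_measurable borel"
    by (intro borel_measurable_continuous_on_indicator)
  then have Gm [measurable]: "G \<in> borel_measurable borel" by (simp add: G_def[abs_def])
  have "(\<integral>\<^sup>+t\<in>{0..1} - S. ennreal (c * g t) \<partial>lborel) = (\<integral>\<^sup>+t. ennreal c * ennreal (G t) \<partial>lborel)"
    by (intro nn_integral_cong) (auto simp: G_def ennreal_mult'[OF c] split: split_indicator)
  also have "\<dots> = ennreal c * (\<integral>\<^sup>+t. ennreal (G t) \<partial>lborel)"
    by (rule nn_integral_cmult) simp
  finally have nnG: "(\<integral>\<^sup>+t\<in>{0..1} - S. ennreal (c * g t) \<partial>lborel) = ennreal c * (\<integral>\<^sup>+t. ennreal (G t) \<partial>lborel)" .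
  have "ennreal d \<le> (\<integral>\<^sup>+t. ennreal (G t) \<partial>lborel)"
  \<comment> \<open>A curve of infinite length satisfies the bound trivially; for the others
    \<open>G\<close> is integrable and can be compared with the derivative of an
    antiderivative.\<close>
  proof (cases "(\<integral>\<^sup>+t. ennreal (G t) \<partial>lborel) = \<infinity>")
    case True
    then show ?thesis by simp
  next
    case False
    then have Gi: "integrable lborel G"
      using G0 by (intro integrableI_nonneg) (auto simp: less_top)
    define J where "J = integral\<^sup>L lborel G"
    have nJ: "(\<integral>\<^sup>+t. ennreal (G t) \<partial>lborel) = ennreal J"
      unfolding J_def by (rule nn_integral_eq_integral[OF Gi]) (simp add: G0)
    have "(G has_integral J) UNIV" unfolding J_def by (rule has_integral_integral_lborel[OF Gi])
    moreover have "G = (\<lambda>t. if t \<in> {0..1} then G t else 0)" by (auto simp: G_def fun_eq_iff)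
    ultimately have GJ: "(G has_integral J) {0..1}" using has_integral_restrict_UNIV[of "{0..1}" G J] by simp
    let ?W = "\<lambda>t. \<Sum>i\<in>I. (z i t - z i 0)\<^sup>2"
    define F where "F t = ((\<rho> t)\<^sup>2 + (\<rho> 0)\<^sup>2 + ?W t) / (2 * \<rho> t * \<rho> 0)" for t
    define F' where "F' t = \<rho>' t * (((\<rho> t)\<^sup>2 - (\<rho> 0)\<^sup>2 - ?W t) / (2 * (\<rho> t)\<^sup>2 * \<rho> 0))
       + (\<Sum>i\<in>I. ((z i t - z i 0) / (\<rho> t * \<rho> 0)) * z' i t)" for t
    have r0: "0 < \<rho> 0" using pos[of 0] by simp
    have F1: "1 \<le> F t" if "t \<in> {0..1}" for t
    proof -
      have "2 * \<rho> t * \<rho> 0 \<le> (\<rho> t)\<^sup>2 + (\<rho> 0)\<^sup>2" by (rule sum_squares_bound)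
      also have "\<dots> \<le> (\<rho> t)\<^sup>2 + (\<rho> 0)\<^sup>2 + ?W t" by (simp add: sum_nonneg)
      finally show ?thesis unfolding F_def using pos[OF that] r0 by (simp add: le_divide_eq)
    qed
    have dF: "(F has_real_derivative F' t) (at t)" if t: "t \<in> {0..1} - S" for t
    proof -
      have rt: "0 < \<rho> t" using pos t by simp
      have r2: "((\<lambda>t. (\<rho> t)\<^sup>2) has_real_derivative 2 * \<rho> t * \<rho>' t) (at t)"
        using DERIV_power[OF der(1)[OF t], of 2] by (simp add: mult_ac)
      have z2: "((\<lambda>t. (z i t - z i 0)\<^sup>2) has_real_derivative 2 * (z i t - z i 0) * z' i t) (at t)" if "i \<in> I" for i
        using DERIV_power[OF DERIV_diff[OF der(2)[OF that t] DERIV_const], of "z i 0" 2] by (simp add: algebra_simps)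
      have "((\<lambda>t. \<Sum>i\<in>I. (z i t - z i 0)\<^sup>2) has_real_derivative (\<Sum>i\<in>I. 2 * (z i t - z i 0) * z' i t)) (at t)"
        by (rule DERIV_sum) (rule z2)
      then have dN: "((\<lambda>t. (\<rho> t)\<^sup>2 + (\<rho> 0)\<^sup>2 + ?W t) has_real_derivative
          2 * \<rho> t * \<rho>' t + (\<Sum>i\<in>I. 2 * (z i t - z i 0) * z' i t)) (at t)"
        using DERIV_add[OF DERIV_add[OF r2 DERIV_const[of "(\<rho> 0)\<^sup>2"]]] by simp
      have dD: "((\<lambda>t. 2 * \<rho> t * \<rho> 0) has_real_derivative 2 * \<rho>' t * \<rho> 0) (at t)"
        by (auto intro!: derivative_eq_intros der(1)[OF t])
      have "(F has_real_derivative
          ((2 * \<rho> t * \<rho>' t + (\<Sum>i\<in>I. 2 * (z i t - z i 0) * z' i t)) * (2 * \<rho> t * \<rho> 0)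
          - ((\<rho> t)\<^sup>2 + (\<rho> 0)\<^sup>2 + ?W t) * (2 * \<rho>' t * \<rho> 0))
          / ((2 * \<rho> t * \<rho> 0) * (2 * \<rho> t * \<rho> 0))) (at t)"
        unfolding F_def[abs_def] by (rule DERIV_divide[OF dN dD]) (use rt r0 in simp)
      moreover have "((2 * \<rho> t * \<rho>' t + (\<Sum>i\<in>I. 2 * (z i t - z i 0) * z' i t)) * (2 * \<rho> t * \<rho> 0)
          - ((\<rho> t)\<^sup>2 + (\<rho> 0)\<^sup>2 + ?W t) * (2 * \<rho>' t * \<rho> 0))
          / ((2 * \<rho> t * \<rho> 0) * (2 * \<rho> t * \<rho> 0)) = F' t"
      proof -
        define W where "W = ?W t"
        define Y where "Y = (\<Sum>i\<in>I. (z i t - z i 0) * z' i t)"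
        have y: "(\<Sum>i\<in>I. 2 * (z i t - z i 0) * z' i t) = 2 * Y" "(\<Sum>i\<in>I. ((z i t - z i 0) / (\<rho> t * \<rho> 0)) * z' i t) = Y / (\<rho> t * \<rho> 0)"
          unfolding Y_def by (simp_all add: sum_distrib_left sum_divide_distrib algebra_simps diff_divide_distrib)
        show ?thesis unfolding F'_def W_def[symmetric] y using rt r0
          by (simp add: field_simps power2_eq_square)
      qed
      ultimately show ?thesis by simp
    qed
    have F'b: "(F' t)\<^sup>2 \<le> ((F t)\<^sup>2 - 1) * (g t)\<^sup>2" if t: "t \<in> {0..1}" for t
    proof -
      have rt: "0 < \<rho> t" using pos t by simp
      define W where "W = ?W t"
      define a where "a = ((\<rho> t)\<^sup>2 - (\<rho> 0)\<^sup>2 - W) / (2 * (\<rho> t)\<^sup>2 * \<rho> 0)"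
      have "(F' t)\<^sup>2 = (a * \<rho>' t + (\<Sum>i\<in>I. ((z i t - z i 0) / (\<rho> t * \<rho> 0)) * z' i t))\<^sup>2"
        unfolding F'_def a_def W_def by (simp add: mult.commute)
      also have "\<dots> \<le> (a\<^sup>2 + (\<Sum>i\<in>I. ((z i t - z i 0) / (\<rho> t * \<rho> 0))\<^sup>2)) * ((\<rho>' t)\<^sup>2 + (\<Sum>i\<in>I. (z' i t)\<^sup>2))"
        by (rule Cauchy_Schwarz_add)
      also have "(\<Sum>i\<in>I. ((z i t - z i 0) / (\<rho> t * \<rho> 0))\<^sup>2) = W / (\<rho> t * \<rho> 0)\<^sup>2"
        by (simp add: W_def power_divide sum_divide_distrib)
      \<comment> \<open>The coefficients of the velocities in \<open>F'\<close> are the partial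
        derivatives of \<open>F\<close>. This identity says that the cosine-hyperbolic of the
        distance has a gradient of hyperbolic norm sinh, so that the distance itself has gradient of
        norm 1.\<close>
      also have "a\<^sup>2 + W / (\<rho> t * \<rho> 0)\<^sup>2 = ((F t)\<^sup>2 - 1) / (\<rho> t)\<^sup>2"
        unfolding a_def F_def W_def[symmetric] using rt r0 by (simp add: field_simps power2_eq_square)
      also have "((F t)\<^sup>2 - 1) / (\<rho> t)\<^sup>2 * ((\<rho>' t)\<^sup>2 + (\<Sum>i\<in>I. (z' i t)\<^sup>2)) = ((F t)\<^sup>2 - 1) * (g t)\<^sup>2"
        by (simp add: g_def power_divide sum_nonneg)
      finally show ?thesis .
    qed
    have cF: "continuous_on {0..1} F"
    proof -
      have "2 * \<rho> t * \<rho> 0 \<noteq> 0" if "t \<in> {0..1}" for t using pos[OF that] r0 by simp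
      then show ?thesis unfolding F_def by (intro continuous_intros cont) auto
    qed
    have main: "ln (F 1 + sqrt ((F 1)\<^sup>2 - 1 + \<delta>)) - ln (F 0 + sqrt ((F 0)\<^sup>2 - 1 + \<delta>)) \<le> J" if \<delta>: "0 < \<delta>" for \<delta>
    proof -
      define \<psi> where "\<psi> t = ln (F t + sqrt ((F t)\<^sup>2 - 1 + \<delta>))" for t
      have Fs: "0 < (F t)\<^sup>2 - 1 + \<delta>" "1 \<le> (F t)\<^sup>2" if "t \<in> {0..1}" for t
      proof -
        show "1 \<le> (F t)\<^sup>2" using F1[OF that] by (simp add: one_le_power)
        then show "0 < (F t)\<^sup>2 - 1 + \<delta>" using \<delta> by simp
      qed
      have Fp: "0 < F t + sqrt ((F t)\<^sup>2 - 1 + \<delta>)" if "t \<in> {0..1}" for t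
        using Fs[OF that] F1[OF that] by (smt (verit) real_sqrt_gt_zero)
      have d\<psi>: "(\<psi> has_real_derivative F' t / sqrt ((F t)\<^sup>2 - 1 + \<delta>)) (at t)" if t: "t \<in> {0..1} - S" for t
      proof -
        define R where "R = sqrt ((F t)\<^sup>2 - 1 + \<delta>)"
        have R: "0 < R" "0 < F t + R" using Fs[of t] Fp[of t] t by (auto simp: R_def)
        have "((\<lambda>t. (F t)\<^sup>2 - 1 + \<delta>) has_real_derivative 2 * F t * F' t) (at t)"
          using DERIV_add[OF DERIV_diff[OF DERIV_power[OF dF[OF t], of 2] DERIV_const[of 1]] DERIV_const[of \<delta>]]
          by (simp add: mult_ac)
        then have "((\<lambda>t. sqrt ((F t)\<^sup>2 - 1 + \<delta>)) has_real_derivative inverse (sqrt ((F t)\<^sup>2 - 1 + \<delta>)) / 2 * (2 * F t * F' t)) (at t)"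
          by (rule DERIV_chain2[OF DERIV_real_sqrt, rotated]) (use Fs t in simp)
        from DERIV_add[OF dF[OF t] this]
        have "(\<psi> has_real_derivative inverse (F t + R) * (F' t + inverse R / 2 * (2 * F t * F' t))) (at t)"
          unfolding \<psi>_def[abs_def] R_def by (rule DERIV_chain2[OF DERIV_ln, rotated]) (use Fp t in simp)
        moreover have "inverse (F t + R) * (F' t + inverse R / 2 * (2 * F t * F' t)) = F' t / R"
        proof -
          have "F' t + inverse R / 2 * (2 * F t * F' t) = (F t + R) * (F' t / R)" using R by (simp add: field_simps)
          then show ?thesis using R by simp
        qed
        ultimately show ?thesis unfolding R_def by simp
      qed
      have c\<psi>: "continuous_on {0..1} \<psi>"
        unfolding \<psi>_def using Fp by (intro continuous_intros cF) (force dest: Fp)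
      have "((\<lambda>t. F' t / sqrt ((F t)\<^sup>2 - 1 + \<delta>)) has_integral (\<psi> 1 - \<psi> 0)) {0..1}"
        using d\<psi> by (intro fundamental_theorem_of_calculus_interior_strong[OF S _ _ c\<psi>])
          (auto simp flip: has_real_derivative_iff_has_vector_derivative)
      \<comment> \<open>At the break points \<open>G\<close> is 0 and nothing is known about
        \<open>F'\<close>; setting the integrand to 0 there allows a pointwise comparison on the
        whole interval.\<close>
      then have "((\<lambda>t. if t \<in> S then 0 else F' t / sqrt ((F t)\<^sup>2 - 1 + \<delta>)) has_integral (\<psi> 1 - \<psi> 0)) {0..1}"
        by (rule has_integral_spike_finite[OF S, rotated]) auto
      then have "\<psi> 1 - \<psi> 0 \<le> J"
      proof (rule has_integral_le[OF _ GJ])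
        fix t :: real assume t: "t \<in> {0..1}"
        show "(if t \<in> S then 0 else F' t / sqrt ((F t)\<^sup>2 - 1 + \<delta>)) \<le> G t"
        proof (cases "t \<in> S")
          case False
          have "(F' t)\<^sup>2 \<le> ((F t)\<^sup>2 - 1) * (g t)\<^sup>2" by (rule F'b[OF t])
          also have "\<dots> \<le> ((F t)\<^sup>2 - 1 + \<delta>) * (g t)\<^sup>2" using \<delta> by (intro mult_right_mono) auto
          also have "\<dots> = (sqrt ((F t)\<^sup>2 - 1 + \<delta>) * g t)\<^sup>2" using Fs[OF t] by (simp add: power_mult_distrib)
          finally have "F' t \<le> sqrt ((F t)\<^sup>2 - 1 + \<delta>) * g t"
            by (rule power2_le_imp_le) (use Fs[OF t] g0[OF t] in auto)
          then show ?thesis using False t Fs[OF t] by (simp add: G_def pos_divide_le_eq mult.commute)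
        qed (simp add: G0)
      qed
      then show ?thesis by (simp add: \<psi>_def)
    qed
    have F0: "F 0 = 1" using r0 by (simp add: F_def power2_eq_square)
    have Fd: "F 1 = cosh d" using d(2) by (simp add: F_def)
    \<comment> \<open>As \<delta> tends to 0 the right summand tends to ln 1 = 0, since
      \<open>F 0 = 1\<close>, and the left one to ln (cosh d + sinh d) = d.\<close>
    have lim: "((\<lambda>\<delta>. ln (F 1 + sqrt ((F 1)\<^sup>2 - 1 + \<delta>)) - ln (F 0 + sqrt ((F 0)\<^sup>2 - 1 + \<delta>)))
      \<longlongrightarrow> ln (F 1 + sqrt ((F 1)\<^sup>2 - 1 + 0)) - ln (F 0 + sqrt ((F 0)\<^sup>2 - 1 + 0))) (at_right 0)"
    proof (intro tendsto_intros)
      have "0 \<le> sqrt ((F 1)\<^sup>2 - 1 + 0)" using F1[of 1] by (simp add: one_le_power)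
      moreover have "1 \<le> F 1" by (rule F1) simp
      ultimately have "0 < F 1 + sqrt ((F 1)\<^sup>2 - 1 + 0)" by linarith
      then show "F 1 + sqrt ((F 1)\<^sup>2 - 1 + 0) \<noteq> 0" by (rule less_imp_neq[symmetric])
      show "F 0 + sqrt ((F 0)\<^sup>2 - 1 + 0) \<noteq> 0" by (simp add: F0)
    qed
    have "ln (F 1 + sqrt ((F 1)\<^sup>2 - 1 + 0)) - ln (F 0 + sqrt ((F 0)\<^sup>2 - 1 + 0)) \<le> J"
    proof (rule tendsto_upperbound[OF lim])
      show "\<forall>\<^sub>F \<delta> in at_right 0. ln (F 1 + sqrt ((F 1)\<^sup>2 - 1 + \<delta>)) - ln (F 0 + sqrt ((F 0)\<^sup>2 - 1 + \<delta>)) \<le> J"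
        using main by (auto simp: eventually_at_filter)
    qed simp
    moreover have "(F 1)\<^sup>2 - 1 = (sinh d)\<^sup>2" unfolding Fd by (simp add: cosh_square_eq)
    ultimately have "ln (cosh d + sinh d) \<le> J" using d(1) by (simp add: F0 Fd)
    then have "d \<le> J" by (simp add: cosh_plus_sinh)
    then show ?thesis using nJ by (simp add: ennreal_leI)
  qed
  then have "ennreal c * ennreal d \<le> (\<integral>\<^sup>+t\<in>{0..1} - S. ennreal (c * g t) \<partial>lborel)"
    unfolding nnG by (rule mult_left_mono) simp
  then show ?thesis unfolding g_def ennreal_mult'[OF c] .
qed

text \<open>
  On the hyperboloid the geodesic joining two points at distance \<open>d\<close> is their combination with weights
  \<open>sinh ((1 - t) d) / sinh d\<close> and \<open>sinh (t d) / sinh d\<close>; the half-space coordinates \<open>(1 / \<tau>, z / \<tau>)\<close>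
  make \<open>\<tau>\<close> and \<open>z\<close> linear functions on the hyperboloid.
\<close>

lemma hyperbolic_geodesic_weights:
  fixes x y M d :: real
  assumes xy: "0 < x" "0 < y" and M: "0 \<le> M" and d: "0 \<le> d" "cosh d = (x\<^sup>2 + y\<^sup>2 + M) / (2 * x * y)"
  obtains A B A' B' :: "real \<Rightarrow> real"
  where "A 0 = 1" "A 1 = 0" "B 0 = 0" "B 1 = 1"
    and "\<And>t. (A has_real_derivative A' t) (at t)" "\<And>t. (B has_real_derivative B' t) (at t)"
    and "continuous_on UNIV A'" "continuous_on UNIV B'"
    and "\<And>t. t \<in> {0..1} \<Longrightarrow> 0 < A t * x + B t * y"
    and "\<And>t. (A' t * x + B' t * y)\<^sup>2 + (A t * B' t - A' t * B t)\<^sup>2 * M = d\<^sup>2 * (A t * x + B t * y)\<^sup>2"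
proof (cases "d = 0")
  \<comment> \<open>The endpoints coincide and \<open>sinh d\<close> vanishes, so affine weights
    replace the quotients of hyperbolic sines.\<close>
  case True
  then have "x\<^sup>2 + y\<^sup>2 + M = 2 * x * y" using d xy by simp
  then have "(x - y)\<^sup>2 + M = 0" by (simp add: power2_eq_square algebra_simps)
  then have xyM: "x = y" "M = 0" using M zero_le_power2[of "x - y"] by (smt (verit) power_eq_0_iff)+
  show thesis
  proof (rule that[of "\<lambda>t. 1 - t" "\<lambda>t. t" "\<lambda>_. -1" "\<lambda>_. 1"])
    show "0 < (1 - t) * x + t * y" for t using xyM xy by (simp add: algebra_simps)
  qed (auto intro!: derivative_eq_intros simp: True xyM)
next
  case False
  then have d0: "0 < d" using d by simp
  then have s: "0 < sinh d" by simp
  have ch: "2 * x * y * cosh d = x\<^sup>2 + y\<^sup>2 + M" using d xy by simp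
  let ?A = "\<lambda>t. sinh ((1 - t) * d) / sinh d" and ?B = "\<lambda>t. sinh (t * d) / sinh d"
  let ?A' = "\<lambda>t. - d * cosh ((1 - t) * d) / sinh d" and ?B' = "\<lambda>t. d * cosh (t * d) / sinh d"
  show thesis
  proof (rule that[of ?A ?B ?A' ?B'])
    show "0 < ?A t * x + ?B t * y" if t: "t \<in> {0..1}" for t
    proof (cases "t = 0")
      case True
      then show ?thesis using s xy by simp
    next
      case False
      then have "0 < ?B t * y" using t d0 s xy by (intro mult_pos_pos divide_pos_pos) auto
      moreover have "0 \<le> ?A t * x" using t d0 s xy by (intro mult_nonneg_nonneg divide_nonneg_pos) auto
      ultimately show ?thesis by simp
    qed
    show "(?A' t * x + ?B' t * y)\<^sup>2 + (?A t * ?B' t - ?A' t * ?B t)\<^sup>2 * M = d\<^sup>2 * (?A t * x + ?B t * y)\<^sup>2" for t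
    proof -
      define a where "a = (1 - t) * d"
      define b where "b = t * d"
      have ab: "a + b = d" by (simp add: a_def b_def algebra_simps)
      have w: "sinh a * cosh b + cosh a * sinh b = sinh d" using ab sinh_add[of a b] by simp
      have c: "cosh a * cosh b + sinh a * sinh b = cosh d" using ab cosh_add[of a b] by simp
      \<comment> \<open>The Wronskian of the two weights is constant, as both solve f'' = d^2
        f.\<close>
      have W: "?A t * ?B' t - ?A' t * ?B t = d / sinh d"
      proof -
        have "?A t * ?B' t - ?A' t * ?B t = d * (sinh a * cosh b + cosh a * sinh b) / (sinh d * sinh d)"
          unfolding a_def[symmetric] b_def[symmetric] by (simp add: algebra_simps add_divide_distrib)
        then show ?thesis unfolding w using s by simp
      qed
      have Ca: "(cosh a)\<^sup>2 = (sinh a)\<^sup>2 + 1" "(cosh b)\<^sup>2 = (sinh b)\<^sup>2 + 1" by (simp_all add: cosh_square_eq)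
      \<comment> \<open>The difference reduces to d^2 (- x^2 - y^2 + 2 x y cosh d), and the defining
        relation of \<open>d\<close> identifies the bracket with \<open>M\<close>.\<close>
      have "d\<^sup>2 * (sinh a * x + sinh b * y)\<^sup>2 - (- d * cosh a * x + d * cosh b * y)\<^sup>2
        = d\<^sup>2 * (((sinh a)\<^sup>2 - (cosh a)\<^sup>2) * x\<^sup>2 + ((sinh b)\<^sup>2 - (cosh b)\<^sup>2) * y\<^sup>2
          + 2 * x * y * (cosh a * cosh b + sinh a * sinh b))"
        by (simp add: power2_eq_square algebra_simps)
      also have "\<dots> = d\<^sup>2 * M" unfolding Ca c ch by simp
      finally have "(- d * cosh a * x + d * cosh b * y)\<^sup>2 + d\<^sup>2 * M = d\<^sup>2 * (sinh a * x + sinh b * y)\<^sup>2" by simp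
      then have "((- d * cosh a * x + d * cosh b * y)\<^sup>2 + d\<^sup>2 * M) / (sinh d)\<^sup>2 = d\<^sup>2 * (sinh a * x + sinh b * y)\<^sup>2 / (sinh d)\<^sup>2"
        by simp
      moreover have "(?A' t * x + ?B' t * y)\<^sup>2 = (- d * cosh a * x + d * cosh b * y)\<^sup>2 / (sinh d)\<^sup>2"
        unfolding a_def[symmetric] b_def[symmetric] power_divide[symmetric]
        by (simp add: add_divide_distrib diff_divide_distrib)
      moreover have "(?A t * x + ?B t * y)\<^sup>2 = (sinh a * x + sinh b * y)\<^sup>2 / (sinh d)\<^sup>2"
        unfolding a_def[symmetric] b_def[symmetric] power_divide[symmetric]
        by (simp add: add_divide_distrib)
      ultimately show ?thesis unfolding W by (simp add: power_divide add_divide_distrib)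
    qed
    show "(?A has_real_derivative ?A' t) (at t)" for t
      using s by (auto intro!: derivative_eq_intros)
    show "(?B has_real_derivative ?B' t) (at t)" for t
      using s by (auto intro!: derivative_eq_intros)
  qed (use s in \<open>auto intro!: continuous_intros\<close>)
qed

section \<open>The Fisher--Rao distance\<close>

text \<open>In the metric the squared coefficients are divided by K (K + 1), while the \<tau> part
  carries the factor l^2. This scale equalises the two.\<close>

definition hyp_scale :: "nat \<Rightarrow> real" where
  "hyp_scale K = curv_len K * sqrt (real K * (real K + 1))"

text \<open>
  With \<open>1 / \<tau>\<close> as height and \<open>hyp_coord\<close> as horizontal coordinates, the Fisher metric becomes
  \<open>(curv_len K)\<^sup>2\<close> times the metric of the hyperbolic half-space.
\<close>

definition hyp_coord :: "nat \<Rightarrow> (nat \<Rightarrow> real) \<Rightarrow> real \<Rightarrow> nat \<Rightarrow> real" where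
  "hyp_coord K \<beta> \<tau> i = (\<Sum>j=1..K. ln (\<beta> i) - ln (\<beta> j)) / (\<tau> * hyp_scale K)"

text \<open>The classical half-space formula for cosh of the distance, with the squares of the
  heights multiplied out.\<close>

abbreviation hyp_cosh :: "nat \<Rightarrow> (nat \<Rightarrow> real) \<Rightarrow> real \<Rightarrow> (nat \<Rightarrow> real) \<Rightarrow> real \<Rightarrow> real" where
  "hyp_cosh K \<beta> \<tau> \<beta>' \<tau>' \<equiv> ((1 / \<tau>')\<^sup>2 + (1 / \<tau>)\<^sup>2 + (\<Sum>i=1..K. (hyp_coord K \<beta>' \<tau>' i - hyp_coord K \<beta> \<tau> i)\<^sup>2)) / (2 * (1 / \<tau>') * (1 / \<tau>))"

abbreviation fisher_speed :: "nat \<Rightarrow> (real \<Rightarrow> nat \<Rightarrow> real) \<Rightarrow> real \<Rightarrow> real" where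
  "fisher_speed K \<gamma> t \<equiv> sqrt (\<Sum>a=1..K. \<Sum>b=1..K. fisher_information K (\<gamma> t) a b * deriv (\<lambda>s. \<gamma> s a) t * deriv (\<lambda>s. \<gamma> s b) t)"

section \<open>The Fisher metric in half-space coordinates\<close>

lemma curv_len_pos: "2 \<le> K \<Longrightarrow> 0 < curv_len K"
  unfolding curv_len_def by (intro real_sqrt_gt_zero divide_pos_pos mult_pos_pos add_nonneg_pos) auto

lemma hyp_scale_pos: "2 \<le> K \<Longrightarrow> 0 < hyp_scale K"
  unfolding hyp_scale_def using curv_len_pos by simp

lemma hyp_scale_sq: "(hyp_scale K)\<^sup>2 = (curv_len K)\<^sup>2 * (real K * (real K + 1))"
  by (simp add: hyp_scale_def power_mult_distrib)

text \<open>This explains the choice of coordinates: the quotient rule for the centred log-weights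
  over \<tau> reproduces exactly the coefficients of the score.\<close>

lemma hyp_coord_has_derivative:
  assumes K: "2 \<le> K" and \<gamma>: "\<gamma> t \<in> concrete_coords K" and i: "i \<in> {1..K}"
    and der: "\<And>a. a \<in> {1..K} \<Longrightarrow> ((\<lambda>s. \<gamma> s a) has_real_derivative w a) (at t)"
  shows "((\<lambda>s. hyp_coord K (fill_last K (\<gamma> s)) (\<gamma> s K) i) has_real_derivative
    - coord_coeff K (\<gamma> t) w i / (\<gamma> t K * hyp_scale K)) (at t)"
proof -
  define \<tau> where "\<tau> = \<gamma> t K"
  have \<tau>: "0 < \<tau>" using \<gamma> K by (simp add: \<tau>_def concrete_coords_def)
  define \<beta> where "\<beta> = fill_last K (\<gamma> t)"
  define b where "b = chart_velocity K w"
  have \<beta>: "0 < \<beta> j" if "j \<in> {1..K}" for j unfolding \<beta>_def by (rule fill_last_pos[OF \<gamma> that])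
  have dl: "((\<lambda>s. ln (fill_last K (\<gamma> s) j)) has_real_derivative inverse (\<beta> j) * b j) (at t)" if j: "j \<in> {1..K}" for j
    unfolding \<beta>_def b_def
    by (rule DERIV_chain2[OF DERIV_ln fill_last_has_derivative[OF der j]]) (use fill_last_pos[OF \<gamma> j] in auto)
  define L where "L s = (\<Sum>j=1..K. ln (fill_last K (\<gamma> s) i) - ln (fill_last K (\<gamma> s) j))" for s
  have dL: "(L has_real_derivative (\<Sum>j=1..K. inverse (\<beta> i) * b i - inverse (\<beta> j) * b j)) (at t)"
    unfolding L_def[abs_def] by (rule DERIV_sum) (intro DERIV_diff dl i)
  have "((\<lambda>s. L s / (\<gamma> s K * hyp_scale K)) has_real_derivative
      ((\<Sum>j=1..K. inverse (\<beta> i) * b i - inverse (\<beta> j) * b j) * (\<gamma> t K * hyp_scale K) - L t * (w K * hyp_scale K))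
      / ((\<gamma> t K * hyp_scale K) * (\<gamma> t K * hyp_scale K))) (at t)"
    by (rule DERIV_divide[OF dL DERIV_cmult_right[OF der]]) (use K \<tau> hyp_scale_pos[OF K] in \<open>auto simp: \<tau>_def\<close>)
  moreover have "((\<Sum>j=1..K. inverse (\<beta> i) * b i - inverse (\<beta> j) * b j) * (\<gamma> t K * hyp_scale K) - L t * (w K * hyp_scale K))
      / ((\<gamma> t K * hyp_scale K) * (\<gamma> t K * hyp_scale K))
    = - coord_coeff K (\<gamma> t) w i / (\<gamma> t K * hyp_scale K)"
  proof -
    define P where "P = (\<Sum>j=1..K. b j / \<beta> j)"
    define Q where "Q = (\<Sum>j=1..K. ln (\<beta> j))"
    have 1: "(\<Sum>j=1..K. inverse (\<beta> i) * b i - inverse (\<beta> j) * b j) = real K * (b i / \<beta> i) - P"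
      by (simp add: sum_subtractf P_def divide_inverse mult.commute)
    have 2: "L t = real K * ln (\<beta> i) - Q" by (simp add: L_def sum_subtractf Q_def \<beta>_def)
    have 3: "coord_coeff K (\<gamma> t) w i = real K * (w K / \<tau> * ln (\<beta> i) - b i / \<beta> i) - (w K / \<tau> * Q - P)"
      unfolding coord_coeff_def score_coeff_def \<tau>_def[symmetric] \<beta>_def[symmetric] b_def[symmetric] P_def Q_def
      by (simp add: sum_subtractf sum_distrib_left)
    show ?thesis unfolding 1 2 3 \<tau>_def[symmetric] using \<tau> hyp_scale_pos[OF K] by (simp add: field_simps)
  qed
  ultimately show ?thesis unfolding hyp_coord_def L_def by simp
qed

text \<open>The derivatives \<open>z'\<close> are left open and matched by uniqueness of
  derivatives. A general curve supplies the expression from the score coefficients, the geodesic a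
  simpler one of its own.\<close>

lemma fisher_speed_eq:
  assumes K: "2 \<le> K" and \<gamma>: "\<gamma> t \<in> concrete_coords K"
    and der: "\<And>a. a \<in> {1..K} \<Longrightarrow> ((\<lambda>s. \<gamma> s a) has_real_derivative w a) (at t)"
    and z: "\<And>i. i \<in> {1..K} \<Longrightarrow> ((\<lambda>s. hyp_coord K (fill_last K (\<gamma> s)) (\<gamma> s K) i) has_real_derivative z' i) (at t)"
  shows "fisher_speed K \<gamma> t
    = curv_len K * sqrt ((w K / \<gamma> t K)\<^sup>2 + (\<gamma> t K)\<^sup>2 * (\<Sum>i=1..K. (z' i)\<^sup>2))"
proof -
  have K1: "1 \<le> K" using K by simp
  define \<tau> where "\<tau> = \<gamma> t K"
  have \<tau>: "0 < \<tau>" using \<gamma> K by (simp add: \<tau>_def concrete_coords_def)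
  have sc: "0 < curv_len K" "0 < hyp_scale K" using K curv_len_pos hyp_scale_pos by auto
  have c: "coord_coeff K (\<gamma> t) w i = - z' i * (\<tau> * hyp_scale K)" if "i \<in> {1..K}" for i
    using DERIV_unique[OF z[OF that] hyp_coord_has_derivative[OF K \<gamma> that der]] \<tau> sc(2)
    by (simp add: \<tau>_def)
  have "(\<Sum>a=1..K. \<Sum>b=1..K. fisher_information K (\<gamma> t) a b * deriv (\<lambda>s. \<gamma> s a) t * deriv (\<lambda>s. \<gamma> s b) t)
    = (\<Sum>a=1..K. \<Sum>b=1..K. fisher_information K (\<gamma> t) a b * w a * w b)"
    by (intro sum.cong refl) (simp add: DERIV_imp_deriv[OF der])
  also have "\<dots> = (\<Sum>i=1..K. (coord_coeff K (\<gamma> t) w i)\<^sup>2) / (real K * (real K + 1)) + (curv_len K)\<^sup>2 * (w K / \<tau>)\<^sup>2"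
    unfolding \<tau>_def by (rule fisher_quadratic_form[OF K1 \<gamma>])
  also have "(\<Sum>i=1..K. (coord_coeff K (\<gamma> t) w i)\<^sup>2) = (\<tau>\<^sup>2 * (\<Sum>i=1..K. (z' i)\<^sup>2)) * (hyp_scale K)\<^sup>2"
    unfolding sum_distrib_left sum_distrib_right
    by (intro sum.cong refl) (simp add: c power_mult_distrib)
  also have "(\<tau>\<^sup>2 * (\<Sum>i=1..K. (z' i)\<^sup>2)) * (hyp_scale K)\<^sup>2 / (real K * (real K + 1)) = (curv_len K)\<^sup>2 * (\<tau>\<^sup>2 * (\<Sum>i=1..K. (z' i)\<^sup>2))"
    unfolding hyp_scale_sq using K by simp
  finally show ?thesis unfolding \<tau>_def[symmetric]
    using sc by (simp add: distrib_left[symmetric] add.commute real_sqrt_mult)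
qed

text \<open>Both double sums reduce to the sum of squares and the square of the sum. It converts
  deviations from the mean into the pairwise differences of the theorem.\<close>

lemma sum_pairwise_diff_sq:
  fixes D :: "nat \<Rightarrow> real"
  shows "(\<Sum>i=1..K. (\<Sum>j=1..K. D i - D j)\<^sup>2) = real K / 2 * (\<Sum>i=1..K. \<Sum>j=1..K. (D i - D j)\<^sup>2)"
proof -
  define P where "P = (\<Sum>i=1..K. D i)"
  define Q where "Q = (\<Sum>i=1..K. (D i)\<^sup>2)"
  have "(\<Sum>i=1..K. (\<Sum>j=1..K. D i - D j)\<^sup>2) = (\<Sum>i=1..K. (real K)\<^sup>2 * (D i)\<^sup>2 - 2 * real K * P * D i + P\<^sup>2)"
  proof (intro sum.cong refl)
    fix i
    have "(\<Sum>j=1..K. D i - D j) = real K * D i - P" unfolding sum_subtractf P_def by simp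
    then show "(\<Sum>j=1..K. D i - D j)\<^sup>2 = (real K)\<^sup>2 * (D i)\<^sup>2 - 2 * real K * P * D i + P\<^sup>2"
      by (simp only:) (simp add: power2_eq_square algebra_simps)
  qed
  also have "\<dots> = (real K)\<^sup>2 * Q - 2 * real K * P * P + real K * P\<^sup>2"
    unfolding sum.distrib sum_subtractf sum_distrib_left[symmetric] P_def[symmetric] Q_def[symmetric] by simp
  finally have 1: "(\<Sum>i=1..K. (\<Sum>j=1..K. D i - D j)\<^sup>2) = real K * (real K * Q - P\<^sup>2)"
    by (simp add: power2_eq_square algebra_simps)
  have "(\<Sum>i=1..K. \<Sum>j=1..K. (D i - D j)\<^sup>2) = (\<Sum>i=1..K. real K * (D i)\<^sup>2 - 2 * D i * P + Q)"
  proof (intro sum.cong refl)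
    fix i
    have "(\<Sum>j=1..K. (D i - D j)\<^sup>2) = (\<Sum>j=1..K. (D i)\<^sup>2 - 2 * D i * D j + (D j)\<^sup>2)"
      by (intro sum.cong refl) (simp add: power2_eq_square algebra_simps)
    then show "(\<Sum>j=1..K. (D i - D j)\<^sup>2) = real K * (D i)\<^sup>2 - 2 * D i * P + Q"
      unfolding sum.distrib sum_subtractf sum_distrib_left[symmetric] P_def[symmetric] Q_def[symmetric] by simp
  qed
  also have "\<dots> = real K * Q - 2 * P * P + real K * Q"
    unfolding sum.distrib sum_subtractf sum_distrib_left[symmetric] sum_distrib_right[symmetric] P_def[symmetric] Q_def[symmetric] by simp
  finally have 2: "(\<Sum>i=1..K. \<Sum>j=1..K. (D i - D j)\<^sup>2) = 2 * (real K * Q - P\<^sup>2)"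
    by (simp add: power2_eq_square algebra_simps)
  show ?thesis unfolding 1 2 by simp
qed

lemma cosh_double_arsinh: "cosh (2 * arsinh (1 / 2 * sqrt X)) = 1 + X / 2" if "0 \<le> X" for X :: real
proof -
  have "cosh (2 * y) = 1 + 2 * (sinh y)\<^sup>2" for y :: real
    by (simp add: cosh_double cosh_square_eq)
  then show ?thesis using that by (simp add: sinh_arsinh_real power_mult_distrib power_divide)
qed

text \<open>Since sqrt (\<tau>' / \<tau>) = sqrt (\<tau> \<tau>') / \<tau>, the differences of
  \<Delta> are sqrt (\<tau> \<tau>') times differences of log-weights over \<tau>. The normalisation
  in \<Delta> thus absorbs the product of heights in the half-space formula.\<close>

lemma cosh_hyp_dist:
  fixes \<beta> \<beta>' :: "nat \<Rightarrow> real"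
  assumes K: "2 \<le> K" and \<tau>: "0 < \<tau>" "0 < \<tau>'"
  defines "\<Delta> \<equiv> (\<lambda>i. sqrt (\<tau>' / \<tau>) * ln (\<beta> i) - sqrt (\<tau> / \<tau>') * ln (\<beta>' i))"
  defines "X \<equiv> (sqrt (\<tau>' / \<tau>) - sqrt (\<tau> / \<tau>'))\<^sup>2 + (\<Sum>i=1..K. \<Sum>j=1..K. (\<Delta> i - \<Delta> j)\<^sup>2) / (2 * (real K + 1) * (curv_len K)\<^sup>2)"
  shows "0 \<le> X"
    and "1 + X / 2 = hyp_cosh K \<beta> \<tau> \<beta>' \<tau>'"
proof -
  have cl: "0 < curv_len K" using K by (rule curv_len_pos)
  have hs: "0 < hyp_scale K" using K by (rule hyp_scale_pos)
  show "0 \<le> X" unfolding X_def by (intro add_nonneg_nonneg divide_nonneg_nonneg sum_nonneg) auto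
  have sqrt_ratio: "sqrt (y / x) = sqrt (x * y) / x" if "0 < x" for x y :: real
  proof -
    have "y / x = (x * y) / x\<^sup>2" using that by (simp add: power2_eq_square)
    then have "sqrt (y / x) = sqrt (x * y) / sqrt (x\<^sup>2)" by (simp only: real_sqrt_divide)
    then show ?thesis using that by simp
  qed
  have s1: "sqrt (\<tau>' / \<tau>) = sqrt (\<tau> * \<tau>') / \<tau>" and s2: "sqrt (\<tau> / \<tau>') = sqrt (\<tau> * \<tau>') / \<tau>'"
    using sqrt_ratio[OF \<tau>(1), of \<tau>'] sqrt_ratio[OF \<tau>(2), of \<tau>] by (simp_all add: mult.commute)
  have sq: "(sqrt (\<tau> * \<tau>'))\<^sup>2 = \<tau> * \<tau>'" using \<tau> by simp
  have h: "hyp_coord K \<beta>' \<tau>' i - hyp_coord K \<beta> \<tau> i = - (\<Sum>j=1..K. \<Delta> i - \<Delta> j) / (sqrt (\<tau> * \<tau>') * hyp_scale K)" for i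
  proof -
    have q: "sqrt (\<tau> * \<tau>') \<noteq> 0" using \<tau> by simp
    have "(\<Sum>j=1..K. \<Delta> i - \<Delta> j) = (\<Sum>j=1..K. sqrt (\<tau> * \<tau>') * ((ln (\<beta> i) - ln (\<beta> j)) / \<tau> - (ln (\<beta>' i) - ln (\<beta>' j)) / \<tau>'))"
      unfolding \<Delta>_def s1 s2 by (intro sum.cong refl) (simp add: algebra_simps diff_divide_distrib)
    also have "\<dots> = sqrt (\<tau> * \<tau>') * ((\<Sum>j=1..K. ln (\<beta> i) - ln (\<beta> j)) / \<tau> - (\<Sum>j=1..K. ln (\<beta>' i) - ln (\<beta>' j)) / \<tau>')"
      unfolding sum_distrib_left[symmetric] sum_subtractf sum_divide_distrib[symmetric] by simp
    finally have N: "(\<Sum>j=1..K. \<Delta> i - \<Delta> j)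
      = sqrt (\<tau> * \<tau>') * ((\<Sum>j=1..K. ln (\<beta> i) - ln (\<beta> j)) / \<tau> - (\<Sum>j=1..K. ln (\<beta>' i) - ln (\<beta>' j)) / \<tau>')" .
    show ?thesis unfolding hyp_coord_def N using q hs \<tau> by (simp add: field_simps)
  qed
  have "(\<Sum>i=1..K. (hyp_coord K \<beta>' \<tau>' i - hyp_coord K \<beta> \<tau> i)\<^sup>2) = (\<Sum>i=1..K. (\<Sum>j=1..K. \<Delta> i - \<Delta> j)\<^sup>2) / (\<tau> * \<tau>' * (hyp_scale K)\<^sup>2)"
    unfolding h sum_divide_distrib by (simp add: power_divide power_mult_distrib sq)
  also have "\<dots> = (\<Sum>i=1..K. \<Sum>j=1..K. (\<Delta> i - \<Delta> j)\<^sup>2) / (2 * (real K + 1) * (curv_len K)\<^sup>2) / (\<tau> * \<tau>')"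
    unfolding sum_pairwise_diff_sq hyp_scale_sq using K by simp
  finally have Z: "(\<Sum>i=1..K. (hyp_coord K \<beta>' \<tau>' i - hyp_coord K \<beta> \<tau> i)\<^sup>2)
    = (\<Sum>i=1..K. \<Sum>j=1..K. (\<Delta> i - \<Delta> j)\<^sup>2) / (2 * (real K + 1) * (curv_len K)\<^sup>2) / (\<tau> * \<tau>')" .
  have "(sqrt (\<tau>' / \<tau>) - sqrt (\<tau> / \<tau>'))\<^sup>2 = (sqrt (\<tau> * \<tau>'))\<^sup>2 * (1 / \<tau> - 1 / \<tau>')\<^sup>2"
    unfolding s1 s2 power_mult_distrib[symmetric] by (simp add: algebra_simps)
  then have S: "(sqrt (\<tau>' / \<tau>) - sqrt (\<tau> / \<tau>'))\<^sup>2 = \<tau> * \<tau>' * (1 / \<tau> - 1 / \<tau>')\<^sup>2" unfolding sq .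
  show "1 + X / 2 = hyp_cosh K \<beta> \<tau> \<beta>' \<tau>'"
  proof -
    define R where "R = (\<Sum>i=1..K. \<Sum>j=1..K. (\<Delta> i - \<Delta> j)\<^sup>2) / (2 * (real K + 1) * (curv_len K)\<^sup>2)"
    show ?thesis unfolding X_def Z S R_def[symmetric] using \<tau> by (simp add: field_simps power2_eq_square)
  qed
qed

text \<open>Along any admissible curve the Fisher speed is l times the hyperbolic speed away from
  finitely many points. The endpoints are prescribed only as measures; identifiability recovers
  their half-space coordinates.\<close>

lemma fisher_rao_length_lower_bound:
  assumes K: "2 \<le> K" and \<beta>: "\<And>i. i \<in> {1..K} \<Longrightarrow> 0 < \<beta> i" "\<And>i. i \<in> {1..K} \<Longrightarrow> 0 < \<beta>' i" and \<tau>: "0 < \<tau>" "0 < \<tau>'"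
    and \<gamma>: "\<gamma> \<in> fisher_rao_curves K (concrete K \<beta> \<tau>) (concrete K \<beta>' \<tau>')"
    and d: "0 \<le> d" "cosh d = hyp_cosh K \<beta> \<tau> \<beta>' \<tau>'"
  shows "ennreal (curv_len K * d) \<le> fisher_rao_length K \<gamma>"
proof -
  have \<gamma>c: "\<And>t. t \<in> {0..1} \<Longrightarrow> \<gamma> t \<in> concrete_coords K"
    and \<gamma>p: "\<And>a. a \<in> {1..K} \<Longrightarrow> (\<lambda>t. \<gamma> t a) piecewise_C1_differentiable_on {0..1}"
    and \<gamma>0: "concrete K (fill_last K (\<gamma> 0)) (\<gamma> 0 K) = concrete K \<beta> \<tau>"
    and \<gamma>1: "concrete K (fill_last K (\<gamma> 1)) (\<gamma> 1 K) = concrete K \<beta>' \<tau>'"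
    using \<gamma> by (auto simp: fisher_rao_curves_def coord_concrete_def)
  have Kin: "K \<in> {1..K}" using K by simp
  have \<gamma>pos: "0 < \<gamma> t K" if "t \<in> {0..1}" for t using \<gamma>c[OF that] Kin by (auto simp: concrete_coords_def)
  have cl: "0 < curv_len K" using K by (rule curv_len_pos)
  define w where "w a t = deriv (\<lambda>s. \<gamma> s a) t" for a t
  have "\<exists>S. finite S \<and> (\<lambda>t. \<gamma> t a) C1_differentiable_on ({0..1} - S)" if "a \<in> {1..K}" for a
    using \<gamma>p[OF that] by (auto simp: piecewise_C1_differentiable_on_def)
  then obtain S where S: "\<And>a. a \<in> {1..K} \<Longrightarrow> finite (S a)" "\<And>a. a \<in> {1..K} \<Longrightarrow> (\<lambda>t. \<gamma> t a) C1_differentiable_on ({0..1} - S a)"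
    by metis
  \<comment> \<open>One finite exceptional set for all coordinates together.\<close>
  define U where "U = (\<Union>a\<in>{1..K}. S a)"
  have U: "finite U" unfolding U_def using S by auto
  have C1: "(\<lambda>t. \<gamma> t a) C1_differentiable_on ({0..1} - U)" if "a \<in> {1..K}" for a
    by (rule C1_differentiable_on_subset[OF S(2)[OF that]]) (use that in \<open>auto simp: U_def\<close>)
  have der: "((\<lambda>s. \<gamma> s a) has_real_derivative w a t) (at t)" if "a \<in> {1..K}" "t \<in> {0..1} - U" for a t
    using C1[OF that(1)] that(2) unfolding w_def
    by (auto simp: C1_differentiable_on_eq DERIV_deriv_iff_real_differentiable)
  have wc: "continuous_on ({0..1} - U) (w a)" if "a \<in> {1..K}" for a
  proof -
    have "(\<lambda>t. \<gamma> t a) C1_differentiable_on ({0..1} - U)" by (rule C1[OF that])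
    then obtain D where D: "\<And>t. t \<in> {0..1} - U \<Longrightarrow> ((\<lambda>t. \<gamma> t a) has_vector_derivative D t) (at t)" "continuous_on ({0..1} - U) D"
      unfolding C1_differentiable_on_def by blast
    have e: "w a t = D t" if "t \<in> {0..1} - U" for t
      unfolding w_def using D(1)[OF that] by (intro DERIV_imp_deriv) (simp add: has_real_derivative_iff_has_vector_derivative)
    have "continuous_on ({0..1} - U) (w a) \<longleftrightarrow> continuous_on ({0..1} - U) D"
      by (rule continuous_on_cong[OF refl e])
    with D(2) show ?thesis by simp
  qed
  have gc: "continuous_on {0..1} (\<lambda>t. \<gamma> t a)" if "a \<in> {1..K}" for a
    using \<gamma>p[OF that] by (simp add: piecewise_C1_differentiable_on_def)
  have flc: "continuous_on {0..1} (\<lambda>t. fill_last K (\<gamma> t) i)" if "i \<in> {1..K}" for i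
    using that gc by (cases "i = K") (auto simp: fill_last_def intro!: continuous_intros)
  have lnc: "continuous_on {0..1} (\<lambda>t. ln (fill_last K (\<gamma> t) i))" if "i \<in> {1..K}" for i
    using fill_last_pos[OF \<gamma>c that] by (intro continuous_intros flc that) (auto simp: less_imp_neq[symmetric])
  define \<rho> where "\<rho> t = 1 / \<gamma> t K" for t
  define \<rho>' where "\<rho>' t = - w K t / (\<gamma> t K)\<^sup>2" for t
  define z where "z i t = hyp_coord K (fill_last K (\<gamma> t)) (\<gamma> t K) i" for i t
  define z' where "z' i t = - coord_coeff K (\<gamma> t) (\<lambda>a. w a t) i / (\<gamma> t K * hyp_scale K)" for i t
  have hs: "hyp_scale K \<noteq> 0" using hyp_scale_pos[OF K] by simp
  have gnz: "\<gamma> t K \<noteq> 0" if "t \<in> {0..1}" for t using \<gamma>pos[OF that] by simp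
  have dz: "(z i has_real_derivative z' i t) (at t)" if "i \<in> {1..K}" "t \<in> {0..1} - U" for i t
    unfolding z_def[abs_def] z'_def using that \<gamma>c der by (intro hyp_coord_has_derivative[OF K]) auto
  have "ennreal (curv_len K * d) \<le> (\<integral>\<^sup>+t\<in>{0..1} - U. ennreal (curv_len K * (sqrt ((\<rho>' t)\<^sup>2 + (\<Sum>i\<in>{1..K}. (z' i t)\<^sup>2)) / \<rho> t)) \<partial>lborel)"
  proof (rule hyperbolic_length_lower_bound[where z = z and \<rho> = \<rho>])
    show "continuous_on {0..1} \<rho>" unfolding \<rho>_def using gnz Kin by (intro continuous_intros gc) auto
    show "continuous_on {0..1} (z i)" if "i \<in> {1..K}" for i
      unfolding z_def hyp_coord_def using gnz hs that Kin
      by (intro continuous_intros lnc gc) auto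
    show "0 < \<rho> t" if "t \<in> {0..1}" for t unfolding \<rho>_def using \<gamma>pos[OF that] by simp
    show "(\<rho> has_real_derivative \<rho>' t) (at t)" if t: "t \<in> {0..1} - U" for t
      unfolding \<rho>_def[abs_def] \<rho>'_def using gnz[of t] t DERIV_divide[OF DERIV_const[of 1] der[OF Kin t]]
      by (simp add: power2_eq_square)
    show "(z i has_real_derivative z' i t) (at t)" if "i \<in> {1..K}" "t \<in> {0..1} - U" for i t
      by (rule dz[OF that])
    have gc': "continuous_on ({0..1} - U) (\<lambda>t. \<gamma> t K)" by (rule continuous_on_subset[OF gc[OF Kin]]) auto
    show "continuous_on ({0..1} - U) \<rho>'"
      unfolding \<rho>'_def using gnz by (intro continuous_intros wc Kin gc') auto
    show "continuous_on ({0..1} - U) (z' i)" if i: "i \<in> {1..K}" for i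
    proof -
      have cv: "continuous_on ({0..1} - U) (\<lambda>t. chart_velocity K (\<lambda>a. w a t) j)" if "j \<in> {1..K}" for j
        using that wc by (cases "j = K") (auto simp: chart_velocity_def intro!: continuous_intros)
      have fl: "continuous_on ({0..1} - U) (\<lambda>t. fill_last K (\<gamma> t) j)" if "j \<in> {1..K}" for j
        by (rule continuous_on_subset[OF flc[OF that]]) auto
      have ln: "continuous_on ({0..1} - U) (\<lambda>t. ln (fill_last K (\<gamma> t) j))" if "j \<in> {1..K}" for j
        by (rule continuous_on_subset[OF lnc[OF that]]) auto
      have fnz: "fill_last K (\<gamma> t) j \<noteq> 0" if "j \<in> {1..K}" "t \<in> {0..1} - U" for j t
        using fill_last_pos[OF \<gamma>c that(1)] that(2) by (metis DiffD1 less_irrefl)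
      show ?thesis
        unfolding z'_def coord_coeff_def score_coeff_def
        by (intro continuous_intros cv fl ln gc' wc Kin i ballI fnz) (use gnz hs in auto)
    qed
    \<comment> \<open>Only \<tau> and differences of log-weights are recovered, which is all that
      \<open>hyp_coord\<close> depends on.\<close>
    have e0: "\<gamma> 0 K = \<tau>" "\<And>i j. i \<in> {1..K} \<Longrightarrow> j \<in> {1..K} \<Longrightarrow> ln (fill_last K (\<gamma> 0) i) - ln (fill_last K (\<gamma> 0) j) = ln (\<beta> i) - ln (\<beta> j)"
      by (rule concrete_identifiable[OF K _ _ _ _ \<gamma>0];
          use fill_last_pos[OF \<gamma>c[of 0]] \<gamma>pos[of 0] \<beta>(1) \<tau>(1) in \<open>simp; fail\<close>)+
    have e1: "\<gamma> 1 K = \<tau>'" "\<And>i j. i \<in> {1..K} \<Longrightarrow> j \<in> {1..K} \<Longrightarrow> ln (fill_last K (\<gamma> 1) i) - ln (fill_last K (\<gamma> 1) j) = ln (\<beta>' i) - ln (\<beta>' j)"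
      by (rule concrete_identifiable[OF K _ _ _ _ \<gamma>1];
          use fill_last_pos[OF \<gamma>c[of 1]] \<gamma>pos[of 1] \<beta>(2) \<tau>(2) in \<open>simp; fail\<close>)+
    have "z i 0 = hyp_coord K \<beta> \<tau> i" "z i 1 = hyp_coord K \<beta>' \<tau>' i" if i: "i \<in> {1..K}" for i
    proof -
      have "(\<Sum>j=1..K. ln (fill_last K (\<gamma> 0) i) - ln (fill_last K (\<gamma> 0) j)) = (\<Sum>j=1..K. ln (\<beta> i) - ln (\<beta> j))"
        "(\<Sum>j=1..K. ln (fill_last K (\<gamma> 1) i) - ln (fill_last K (\<gamma> 1) j)) = (\<Sum>j=1..K. ln (\<beta>' i) - ln (\<beta>' j))"
        by (intro sum.cong refl e0(2) e1(2) i; assumption)+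
      then show "z i 0 = hyp_coord K \<beta> \<tau> i" "z i 1 = hyp_coord K \<beta>' \<tau>' i"
        unfolding z_def hyp_coord_def e0(1) e1(1) by (simp_all only:)
    qed
    then have "(\<Sum>i=1..K. (hyp_coord K \<beta>' \<tau>' i - hyp_coord K \<beta> \<tau> i)\<^sup>2) = (\<Sum>i=1..K. (z i 1 - z i 0)\<^sup>2)"
      by (intro sum.cong refl) (simp only:)
    then show "cosh d = ((\<rho> 1)\<^sup>2 + (\<rho> 0)\<^sup>2 + (\<Sum>i\<in>{1..K}. (z i 1 - z i 0)\<^sup>2)) / (2 * \<rho> 1 * \<rho> 0)"
      unfolding d(2) \<rho>_def e0(1) e1(1) by (simp only:)
  qed (use U d cl in auto)
  also have "\<dots> \<le> fisher_rao_length K \<gamma>"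
    unfolding fisher_rao_length_def
  \<comment> \<open>Omitting the break points can only decrease the integral, so no control of
    \<open>deriv\<close> there is required.\<close>
  proof (rule nn_integral_mono)
    fix t :: real
    show "ennreal (curv_len K * (sqrt ((\<rho>' t)\<^sup>2 + (\<Sum>i\<in>{1..K}. (z' i t)\<^sup>2)) / \<rho> t)) * indicator ({0..1} - U) t
      \<le> ennreal (fisher_speed K \<gamma> t) * indicator {0..1} t"
    proof (cases "t \<in> {0..1} - U")
      case True
      then have t: "t \<in> {0..1}" by simp
      have "fisher_speed K \<gamma> t
        = curv_len K * sqrt ((w K t / \<gamma> t K)\<^sup>2 + (\<gamma> t K)\<^sup>2 * (\<Sum>i=1..K. (z' i t)\<^sup>2))"
        by (rule fisher_speed_eq[where \<gamma> = \<gamma> and t = t and w = "\<lambda>a. w a t" and z' = "\<lambda>i. z' i t", OF K \<gamma>c[OF t]])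
          (use der[OF _ True] dz[OF _ True] in \<open>simp_all add: z_def[abs_def]\<close>)
      also have "sqrt ((w K t / \<gamma> t K)\<^sup>2 + (\<gamma> t K)\<^sup>2 * (\<Sum>i=1..K. (z' i t)\<^sup>2)) = sqrt ((\<rho>' t)\<^sup>2 + (\<Sum>i\<in>{1..K}. (z' i t)\<^sup>2)) / \<rho> t"
      proof -
        have "(w K t / \<gamma> t K)\<^sup>2 = (\<gamma> t K)\<^sup>2 * (\<rho>' t)\<^sup>2"
          unfolding \<rho>'_def using gnz[OF t] by (simp add: power_divide field_simps power2_eq_square)
        then have "(w K t / \<gamma> t K)\<^sup>2 + (\<gamma> t K)\<^sup>2 * (\<Sum>i=1..K. (z' i t)\<^sup>2) = (\<gamma> t K)\<^sup>2 * ((\<rho>' t)\<^sup>2 + (\<Sum>i=1..K. (z' i t)\<^sup>2))"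
          by (simp only: distrib_left)
        then show ?thesis using \<gamma>pos[OF t] by (simp add: real_sqrt_mult \<rho>_def)
      qed
      finally show ?thesis using True t by simp
    qed simp
  qed
  finally show ?thesis .
qed

text \<open>\<tau> and the log-weights are combined with the same two weight functions. The chart
  demands weights of sum 1, so the exponentials of the combined log-weights are divided by their
  sum; the centred coordinates do not see this common factor.\<close>

lemma fisher_rao_geodesic:
  assumes K: "2 \<le> K" and \<beta>: "\<And>i. i \<in> {1..K} \<Longrightarrow> 0 < \<beta> i" "\<And>i. i \<in> {1..K} \<Longrightarrow> 0 < \<beta>' i" and \<tau>: "0 < \<tau>" "0 < \<tau>'"
    and d: "0 \<le> d" "cosh d = hyp_cosh K \<beta> \<tau> \<beta>' \<tau>'"
  obtains \<gamma> where "\<gamma> \<in> fisher_rao_curves K (concrete K \<beta> \<tau>) (concrete K \<beta>' \<tau>')"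
    and "fisher_rao_length K \<gamma> = ennreal (curv_len K * d)"
proof -
  have Kin: "K \<in> {1..K}" and Ks: "{1..K} = insert K {1..<K}" using K by auto
  have hs: "0 < hyp_scale K" using K by (rule hyp_scale_pos)
  define y0 where "y0 i = (\<Sum>j=1..K. ln (\<beta> i) - ln (\<beta> j)) / hyp_scale K" for i
  define y1 where "y1 i = (\<Sum>j=1..K. ln (\<beta>' i) - ln (\<beta>' j)) / hyp_scale K" for i
  \<comment> \<open>The squared horizontal separation after clearing the denominators \<tau> and
    \<tau>'.\<close>
  define M where "M = (\<Sum>i=1..K. (y1 i * \<tau> - y0 i * \<tau>')\<^sup>2)"
  have M: "0 \<le> M" by (simp add: M_def sum_nonneg)
  have "(\<Sum>i=1..K. (hyp_coord K \<beta>' \<tau>' i - hyp_coord K \<beta> \<tau> i)\<^sup>2) = (\<Sum>i=1..K. (y1 i * \<tau> - y0 i * \<tau>')\<^sup>2 / (\<tau> * \<tau>')\<^sup>2)"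
  proof (intro sum.cong refl)
    fix i
    have "hyp_coord K \<beta>' \<tau>' i - hyp_coord K \<beta> \<tau> i = (y1 i * \<tau> - y0 i * \<tau>') / (\<tau> * \<tau>')"
      unfolding hyp_coord_def y0_def y1_def using \<tau> hs by (simp add: field_simps)
    then show "(hyp_coord K \<beta>' \<tau>' i - hyp_coord K \<beta> \<tau> i)\<^sup>2 = (y1 i * \<tau> - y0 i * \<tau>')\<^sup>2 / (\<tau> * \<tau>')\<^sup>2"
      by (simp add: power_divide)
  qed
  also have "\<dots> = M / (\<tau> * \<tau>')\<^sup>2" unfolding M_def sum_divide_distrib ..
  finally have hM: "(\<Sum>i=1..K. (hyp_coord K \<beta>' \<tau>' i - hyp_coord K \<beta> \<tau> i)\<^sup>2) = M / (\<tau> * \<tau>')\<^sup>2" .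
  have cd: "cosh d = (\<tau>\<^sup>2 + \<tau>'\<^sup>2 + M) / (2 * \<tau> * \<tau>')"
    unfolding d(2) hM using \<tau> by (simp add: field_simps power2_eq_square)
  obtain A B A' B' :: "real \<Rightarrow> real" where AB: "A 0 = 1" "A 1 = 0" "B 0 = 0" "B 1 = 1"
    and dA: "\<And>t. (A has_real_derivative A' t) (at t)" and dB: "\<And>t. (B has_real_derivative B' t) (at t)"
    and cA: "continuous_on UNIV A'" and cB: "continuous_on UNIV B'"
    and Tpos: "\<And>t. t \<in> {0..1} \<Longrightarrow> 0 < A t * \<tau> + B t * \<tau>'"
    and speed: "\<And>t. (A' t * \<tau> + B' t * \<tau>')\<^sup>2 + (A t * B' t - A' t * B t)\<^sup>2 * M = d\<^sup>2 * (A t * \<tau> + B t * \<tau>')\<^sup>2"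
  proof (rule hyperbolic_geodesic_weights[OF \<tau> M d(1) cd])
    fix A B A' B' :: "real \<Rightarrow> real"
    assume "A 0 = 1" "A 1 = 0" "B 0 = 0" "B 1 = 1"
      and "\<And>t. (A has_real_derivative A' t) (at t)" "\<And>t. (B has_real_derivative B' t) (at t)"
      and "continuous_on UNIV A'" "continuous_on UNIV B'"
      and "\<And>t. t \<in> {0..1} \<Longrightarrow> 0 < A t * \<tau> + B t * \<tau>'"
      and "\<And>t. (A' t * \<tau> + B' t * \<tau>')\<^sup>2 + (A t * B' t - A' t * B t)\<^sup>2 * M = d\<^sup>2 * (A t * \<tau> + B t * \<tau>')\<^sup>2"
    from that[OF this] show thesis .
  qed
  define T where "T t = A t * \<tau> + B t * \<tau>'" for t
  define T' where "T' t = A' t * \<tau> + B' t * \<tau>'" for t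
  define \<theta> where "\<theta> i t = A t * ln (\<beta> i) + B t * ln (\<beta>' i)" for i t
  define \<theta>' where "\<theta>' i t = A' t * ln (\<beta> i) + B' t * ln (\<beta>' i)" for i t
  define Z where "Z t = (\<Sum>j=1..K. exp (\<theta> j t))" for t
  define Z' where "Z' t = (\<Sum>j=1..K. exp (\<theta> j t) * \<theta>' j t)" for t
  have Z: "0 < Z t" for t unfolding Z_def using K by (intro sum_pos) auto
  define \<gamma> where "\<gamma> t i = (if i = K then T t else exp (\<theta> i t) / Z t)" for t i
  define w where "w i t = (if i = K then T' t else (exp (\<theta> i t) * \<theta>' i t * Z t - exp (\<theta> i t) * Z' t) / (Z t * Z t))" for i t
  have fl: "fill_last K (\<gamma> t) i = exp (\<theta> i t) / Z t" if "i \<in> {1..K}" for i t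
  proof (cases "i = K")
    case True
    have "Z t = exp (\<theta> K t) + (\<Sum>j=1..<K. exp (\<theta> j t))" unfolding Z_def Ks by simp
    then have "(\<Sum>j=1..<K. exp (\<theta> j t)) = Z t - exp (\<theta> K t)" by simp
    then have "(\<Sum>j=1..<K. \<gamma> t j) = (Z t - exp (\<theta> K t)) / Z t"
      by (simp add: \<gamma>_def sum_divide_distrib[symmetric])
    then show ?thesis using True Z[of t] by (simp add: fill_last_def diff_divide_distrib)
  qed (use that in \<open>simp add: fill_last_def \<gamma>_def\<close>)
  have d\<theta>: "(\<theta> i has_real_derivative \<theta>' i t) (at t)" for i t
    unfolding \<theta>_def[abs_def] \<theta>'_def by (intro DERIV_add DERIV_cmult_right dA dB)
  have dT: "(T has_real_derivative T' t) (at t)" for t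
    unfolding T_def[abs_def] T'_def by (intro DERIV_add DERIV_cmult_right dA dB)
  have dE: "((\<lambda>t. exp (\<theta> i t)) has_real_derivative exp (\<theta> i t) * \<theta>' i t) (at t)" for i t
    by (rule DERIV_chain2[OF DERIV_exp d\<theta>])
  have dZ: "(Z has_real_derivative Z' t) (at t)" for t
    unfolding Z_def[abs_def] Z'_def by (rule DERIV_sum) (rule dE)
  have dg: "((\<lambda>t. \<gamma> t a) has_real_derivative w a t) (at t)" for a t
    using DERIV_divide[OF dE[of a] dZ, of t] Z[of t] dT by (cases "a = K") (auto simp: \<gamma>_def w_def)
  have cont: "continuous_on UNIV A" "continuous_on UNIV B"
    by (rule DERIV_continuous_on, rule has_field_derivative_at_within, rule dA)
      (rule DERIV_continuous_on, rule has_field_derivative_at_within, rule dB)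
  have c\<theta>: "continuous_on UNIV (\<theta> i)" for i unfolding \<theta>_def by (intro continuous_intros cont)
  have c\<theta>': "continuous_on UNIV (\<theta>' i)" for i unfolding \<theta>'_def by (intro continuous_intros cA cB)
  have Zn: "Z t * Z t \<noteq> 0" for t using Z[of t] by simp
  have wc: "continuous_on UNIV (w a)" for a
  proof (cases "a = K")
    case True
    then show ?thesis unfolding w_def T'_def by (auto intro!: continuous_intros cA cB)
  next
    case False
    have "continuous_on UNIV (\<lambda>t. (exp (\<theta> a t) * \<theta>' a t * Z t - exp (\<theta> a t) * Z' t) / (Z t * Z t))"
      using Zn unfolding Z_def Z'_def by (intro continuous_intros c\<theta> c\<theta>') auto
    then show ?thesis using False unfolding w_def by simp
  qed
  have coords: "\<gamma> t \<in> concrete_coords K" if t: "t \<in> {0..1}" for t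
  proof -
    have "(\<Sum>i=1..<K. \<gamma> t i) = 1 - fill_last K (\<gamma> t) K" by (simp add: fill_last_def)
    also have "\<dots> < 1" unfolding fl[OF Kin] using Z[of t] by simp
    finally show ?thesis using Tpos[OF t] Z[of t] by (auto simp: concrete_coords_def \<gamma>_def T_def)
  qed
  have end0: "concrete K (fill_last K (\<gamma> 0)) (\<gamma> 0 K) = concrete K \<beta> \<tau>"
  proof -
    have "fill_last K (\<gamma> 0) i = (1 / Z 0) * \<beta> i" if "i \<in> {1..K}" for i
      unfolding fl[OF that] using \<beta>(1)[OF that] by (simp add: \<theta>_def AB)
    then have "concrete K (fill_last K (\<gamma> 0)) (\<gamma> 0 K) = concrete K \<beta> (\<gamma> 0 K)"
      using Z[of 0] by (intro concrete_cong_scale[of "1 / Z 0"]) auto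
    then show ?thesis by (simp add: \<gamma>_def T_def AB)
  qed
  have end1: "concrete K (fill_last K (\<gamma> 1)) (\<gamma> 1 K) = concrete K \<beta>' \<tau>'"
  proof -
    have "fill_last K (\<gamma> 1) i = (1 / Z 1) * \<beta>' i" if "i \<in> {1..K}" for i
      unfolding fl[OF that] using \<beta>(2)[OF that] by (simp add: \<theta>_def AB)
    then have "concrete K (fill_last K (\<gamma> 1)) (\<gamma> 1 K) = concrete K \<beta>' (\<gamma> 1 K)"
      using Z[of 1] by (intro concrete_cong_scale[of "1 / Z 1"]) auto
    then show ?thesis by (simp add: \<gamma>_def T_def AB)
  qed
  have "(\<lambda>t. \<gamma> t a) piecewise_C1_differentiable_on {0..1}" for a
  proof (rule C1_differentiable_imp_piecewise)
    show "(\<lambda>t. \<gamma> t a) C1_differentiable_on {0..1}"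
      unfolding C1_differentiable_on_def
      using dg[of a] continuous_on_subset[OF wc[of a] subset_UNIV]
      by (intro exI[of _ "w a"]) (auto simp flip: has_real_derivative_iff_has_vector_derivative)
  qed
  then have curve: "\<gamma> \<in> fisher_rao_curves K (concrete K \<beta> \<tau>) (concrete K \<beta>' \<tau>')"
    using coords end0 end1 by (auto simp: fisher_rao_curves_def coord_concrete_def)
  have hyp: "hyp_coord K (fill_last K (\<gamma> s)) (\<gamma> s K) i = (A s * y0 i + B s * y1 i) / T s" if i: "i \<in> {1..K}" for i s
  proof -
    have lnf: "ln (fill_last K (\<gamma> s) j) = \<theta> j s - ln (Z s)" if "j \<in> {1..K}" for j
      unfolding fl[OF that] using Z[of s] by (simp add: ln_div)
    have "(\<Sum>j=1..K. ln (fill_last K (\<gamma> s) i) - ln (fill_last K (\<gamma> s) j))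
      = (\<Sum>j=1..K. A s * (ln (\<beta> i) - ln (\<beta> j)) + B s * (ln (\<beta>' i) - ln (\<beta>' j)))"
    proof (intro sum.cong refl)
      fix j assume j: "j \<in> {1..K}"
      show "ln (fill_last K (\<gamma> s) i) - ln (fill_last K (\<gamma> s) j)
        = A s * (ln (\<beta> i) - ln (\<beta> j)) + B s * (ln (\<beta>' i) - ln (\<beta>' j))"
        unfolding lnf[OF i] lnf[OF j] by (simp add: \<theta>_def algebra_simps)
    qed
    also have "\<dots> = (A s * y0 i + B s * y1 i) * hyp_scale K"
      unfolding sum.distrib sum_distrib_left[symmetric] y0_def y1_def using hs by (simp add: distrib_right)
    finally show ?thesis unfolding hyp_coord_def using hs by (simp add: \<gamma>_def)
  qed
  have spd: "fisher_speed K \<gamma> t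
    = curv_len K * d" if t: "t \<in> {0..1}" for t
  proof -
    \<comment> \<open>By the quotient rule the velocity of each horizontal coordinate is this
      Wronskian times a constant, over the square of \<open>T t\<close>.\<close>
    define W where "W = A t * B' t - A' t * B t"
    define m where "m i = y1 i * \<tau> - y0 i * \<tau>'" for i
    have Tt: "0 < T t" using Tpos[OF t] by (simp add: T_def)
    have dz: "((\<lambda>s. hyp_coord K (fill_last K (\<gamma> s)) (\<gamma> s K) i) has_real_derivative W * m i / (T t * T t)) (at t)"
      if i: "i \<in> {1..K}" for i
    proof -
      have "((\<lambda>s. A s * y0 i + B s * y1 i) has_real_derivative A' t * y0 i + B' t * y1 i) (at t)"
        by (intro DERIV_add DERIV_cmult_right dA dB)
      from DERIV_divide[OF this dT] Tt
      have "((\<lambda>s. (A s * y0 i + B s * y1 i) / T s) has_real_derivative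
        ((A' t * y0 i + B' t * y1 i) * T t - (A t * y0 i + B t * y1 i) * T' t) / (T t * T t)) (at t)" by simp
      moreover have "(A' t * y0 i + B' t * y1 i) * T t - (A t * y0 i + B t * y1 i) * T' t = W * m i"
        unfolding T_def T'_def W_def m_def by (simp add: algebra_simps)
      ultimately show ?thesis by (simp only: hyp[OF i])
    qed
    have "fisher_speed K \<gamma> t
      = curv_len K * sqrt ((w K t / \<gamma> t K)\<^sup>2 + (\<gamma> t K)\<^sup>2 * (\<Sum>i=1..K. (W * m i / (T t * T t))\<^sup>2))"
      by (rule fisher_speed_eq[where \<gamma> = \<gamma> and t = t and w = "\<lambda>a. w a t", OF K coords[OF t] dg dz])
    also have "(w K t / \<gamma> t K)\<^sup>2 + (\<gamma> t K)\<^sup>2 * (\<Sum>i=1..K. (W * m i / (T t * T t))\<^sup>2) = d\<^sup>2"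
    proof -
      have "(\<Sum>i=1..K. (W * m i / (T t * T t))\<^sup>2) = W\<^sup>2 * M / (T t * T t)\<^sup>2"
        unfolding M_def m_def by (simp add: power_divide power_mult_distrib sum_divide_distrib sum_distrib_left)
      then have "(w K t / \<gamma> t K)\<^sup>2 + (\<gamma> t K)\<^sup>2 * (\<Sum>i=1..K. (W * m i / (T t * T t))\<^sup>2) = ((T' t)\<^sup>2 + W\<^sup>2 * M) / (T t)\<^sup>2"
        using Tt by (simp add: w_def \<gamma>_def power_divide add_divide_distrib power_mult_distrib power2_eq_square)
      also have "(T' t)\<^sup>2 + W\<^sup>2 * M = d\<^sup>2 * (T t)\<^sup>2" using speed[of t] by (simp add: T_def T'_def W_def)
      finally show ?thesis using Tt by simp
    qed
    finally show ?thesis using d(1) by simp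
  qed
  have "fisher_rao_length K \<gamma> = (\<integral>\<^sup>+t. ennreal (curv_len K * d) * indicator {0..1} t \<partial>(lborel :: real measure))"
    unfolding fisher_rao_length_def
  proof (rule nn_integral_cong)
    fix t :: real
    show "ennreal (fisher_speed K \<gamma> t)
        * indicator {0..1} t = ennreal (curv_len K * d) * indicator {0..1} t"
      by (cases "t \<in> {0..1}") (simp_all only: spd indicator_simps mult_zero_right simp_thms)
  qed
  also have "\<dots> = ennreal (curv_len K * d)" by (subst nn_integral_cmult_indicator) auto
  finally show thesis using curve by (rule that[rotated])
qed

theorem proposition4p5:
  fixes K :: nat and \<beta> \<beta>' :: "nat \<Rightarrow> real" and \<tau> \<tau>' :: real
  assumes "2 \<le> K"
    and "\<And>i. i \<in> {1..K} \<Longrightarrow> 0 < \<beta> i"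
    and "\<And>i. i \<in> {1..K} \<Longrightarrow> 0 < \<beta>' i"
    and "0 < \<tau>" and "0 < \<tau>'"
  shows "let \<Delta> = (\<lambda>i. sqrt (\<tau>' / \<tau>) * ln (\<beta> i) - sqrt (\<tau> / \<tau>') * ln (\<beta>' i));
             l = sqrt ((real K - 1) * (real K * pi\<^sup>2 / 6 + 1) / (real K + 1))
         in fisher_rao_dist K (concrete K \<beta> \<tau>) (concrete K \<beta>' \<tau>') =
            ennreal (2 * l * arsinh (1 / 2 * sqrt (
              (sqrt (\<tau>' / \<tau>) - sqrt (\<tau> / \<tau>'))\<^sup>2
              + (\<Sum>i=1..K. \<Sum>j=1..K. (\<Delta> i - \<Delta> j)\<^sup>2) / (2 * (real K + 1) * l\<^sup>2))))"
proof -
  define \<Delta> where "\<Delta> = (\<lambda>i. sqrt (\<tau>' / \<tau>) * ln (\<beta> i) - sqrt (\<tau> / \<tau>') * ln (\<beta>' i))"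
  define X where "X = (sqrt (\<tau>' / \<tau>) - sqrt (\<tau> / \<tau>'))\<^sup>2
    + (\<Sum>i=1..K. \<Sum>j=1..K. (\<Delta> i - \<Delta> j)\<^sup>2) / (2 * (real K + 1) * (curv_len K)\<^sup>2)"
  \<comment> \<open>The distance in the metric of curvature - 1; the factor l is applied at the
    end.\<close>
  define d where "d = 2 * arsinh (1 / 2 * sqrt X)"
  have X: "0 \<le> X" "1 + X / 2 = hyp_cosh K \<beta> \<tau> \<beta>' \<tau>'"
    unfolding X_def \<Delta>_def by (rule cosh_hyp_dist[OF assms(1,4,5)])+
  have "\<not> arsinh (1 / 2 * sqrt X) < 0" unfolding arsinh_real_neg_iff using X(1) by simp
  then have d: "0 \<le> d" unfolding d_def by linarith
  have dX: "cosh d = hyp_cosh K \<beta> \<tau> \<beta>' \<tau>'"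
    unfolding d_def cosh_double_arsinh[OF X(1)] by (rule X(2))
  obtain \<gamma> where \<gamma>: "\<gamma> \<in> fisher_rao_curves K (concrete K \<beta> \<tau>) (concrete K \<beta>' \<tau>')"
    "fisher_rao_length K \<gamma> = ennreal (curv_len K * d)"
    by (rule fisher_rao_geodesic[OF assms d dX])
  have "fisher_rao_dist K (concrete K \<beta> \<tau>) (concrete K \<beta>' \<tau>') = ennreal (curv_len K * d)"
    unfolding fisher_rao_dist_def
  proof (rule antisym)
    show "(INF \<gamma>\<in>fisher_rao_curves K (concrete K \<beta> \<tau>) (concrete K \<beta>' \<tau>'). fisher_rao_length K \<gamma>) \<le> ennreal (curv_len K * d)"
      using INF_lower[OF \<gamma>(1), of "fisher_rao_length K"] by (simp only: \<gamma>(2))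
    show "ennreal (curv_len K * d) \<le> (INF \<gamma>\<in>fisher_rao_curves K (concrete K \<beta> \<tau>) (concrete K \<beta>' \<tau>'). fisher_rao_length K \<gamma>)"
    proof (rule INF_greatest)
      fix \<delta> assume \<delta>: "\<delta> \<in> fisher_rao_curves K (concrete K \<beta> \<tau>) (concrete K \<beta>' \<tau>')"
      show "ennreal (curv_len K * d) \<le> fisher_rao_length K \<delta>"
        by (rule fisher_rao_length_lower_bound[OF assms(1) _ _ assms(4,5) \<delta> d dX]) (use assms(2,3) in auto)
    qed
  qed
  then show ?thesis
    unfolding Let_def \<Delta>_def[symmetric] curv_len_def[symmetric] X_def[symmetric] d_def by (simp add: mult_ac)
qed

end
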